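(* Let $T\subset\mathbb{R}^3$ be a nondegenerate tetrahedron with Alfeld split $T^z$. For every integer $r\ge 1$ the following three sequences are exact: $$\mathbb{R}\to M_{d,r}^0(T^z)\xrightarrow{\operatorname{grad}}M_{d,r-1}^1(T^z)\xrightarrow{\operatorname{curl}}M_{d,r-2}^2(T^z)\xrightarrow{\operatorname{div}}M_{d,r-3}^3(T^z)\to 0,$$ $$\mathbb{R}\to M_{d,r}^0(T^z)\xrightarrow{\operatorname{grad}}M_{d,r-1}^1(T^z)\xrightarrow{\operatorname{curl}}M_{r-2}^2(T^z)\xrightarrow{\operatorname{div}}V_{d,r-3}^3(T^z)\to 0,$$ $$\mathbb{R}\to M_{d,r}^0(T^z)\xrightarrow{\operatorname{grad}}M_{c,r-1}^1(T^z)\xrightarrow{\operatorname{curl}}V_{c,r-2}^2(T^z)\xrightarrow{\operatorname{div}}V_{d,r-3}^3(T^z)\to 0.$$ Here exact means that the range of each map is the kernel of the succeeding map, the first map being the inclusion of constants.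
   Context: Let $T=[x_0,x_1,x_2,x_3]\subset\mathbb{R}^3$ be a nondegenerate tetrahedron with barycenter $z$. The Alfeld split is $T^z=\{T_0,\dots,T_3\}$, where $T_i$ is the tetrahedron obtained from $T$ by replacing the vertex $x_i$ by $z$; $\Delta_0(T^z)=\{x_0,x_1,x_2,x_3,z\}$. $\mathcal{P}_r(S)$ denotes polynomials of total degree at most $r$ on $S$, with $\mathcal{P}_r(S)=\{0\}$ for $r<0$. Differential operators are understood in the weak sense and $C^0(T)$ means continuous on the closed tetrahedron. A piecewise polynomial $\omega$ on $T^z$ is said to be $C^j$ on $\Delta_0(T^z)$ if, for every $a\in\Delta_0(T^z)$ and $|\alpha|\le j$, the values $D^\alpha(\omega|_K)(a)$ agree for all $K\in T^z$ having $a$ as a vertex. Spaces: $V_r^0(T^z)=V_r^3(T^z)=\{\omega\in L^2(T):\omega|_{T_i}\in\mathcal{P}_r(T_i),\ 0\le i\le 3\}$; $V_{d,r}^2(T^z)=\{\omega\in[V_r^0(T^z)]^3:\operatorname{div}\omega\in L^2(T)\}$; $V_{d,r}^3(T^z)=V_r^3(T^z)$. $M_r^0(T^z)=M_r^3(T^z)=\{\omega\in C^0(T):\omega|_{T_i}\in\mathcal{P}_r(T_i),\ 0\le i\le3\}$; $M_r^1(T^z)=M_r^2(T^z)=[M_r^0(T^z)]^3$. $M_{d,r}^0(T^z)=\{\omega\in M_r^0(T^z):\operatorname{grad}\omega\in[C^0(T)]^3\}$; $M_{d,r}^1(T^z)=\{\omega\in M_r^1(T^z):\operatorname{curl}\omega\in[C^0(T)]^3\}$;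 $M_{d,r}^2(T^z)=\{\omega\in M_r^2(T^z):\operatorname{div}\omega\in C^0(T)\}$; $M_{d,r}^3(T^z)=M_r^3(T^z)$. $M_{c,r-1}^1(T^z)=\{\omega\in M_{r-1}^1(T^z):\omega\text{ is }C^1\text{ on }\Delta_0(T^z)\}$; $V_{c,r-2}^2(T^z)=\{\omega\in V_{d,r-2}^2(T^z):\omega\text{ is }C^0\text{ on }\Delta_0(T^z)\}$. *)

theory Defs
  imports "HOL-Analysis.Analysis"
begin

section \<open>Geometry of the Alfeld split\<close>

text \<open>A tetrahedron is given by its vertices \<open>x 0, \<dots>, x 3\<close>; other values of \<open>x\<close> are irrelevant.\<close>

definition nondegenerate :: "(nat \<Rightarrow> real^3) \<Rightarrow> bool" where
  "nondegenerate x \<longleftrightarrow> inj_on x {..3} \<and> \<not> affine_dependent (x ` {..3})"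

definition tet :: "(nat \<Rightarrow> real^3) \<Rightarrow> (real^3) set" where
  "tet x = convex hull (x ` {..3})"

definition barycenter :: "(nat \<Rightarrow> real^3) \<Rightarrow> real^3" where
  "barycenter x = (1/4) *\<^sub>R (\<Sum>i\<le>3. x i)"

definition sub_verts :: "(nat \<Rightarrow> real^3) \<Rightarrow> nat \<Rightarrow> nat \<Rightarrow> real^3" where
  "sub_verts x i = x(i := barycenter x)"

definition alfeld_vertices :: "(nat \<Rightarrow> real^3) \<Rightarrow> (real^3) set" where
  "alfeld_vertices x = insert (barycenter x) (x ` {..3})"

section \<open>Partial derivatives, polynomials and test functions\<close>

definition partial :: "3 \<Rightarrow> (real^3 \<Rightarrow> real) \<Rightarrow> real^3 \<Rightarrow> real" where
  "partial k f y = frechet_derivative f (at y) (axis k 1)"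

definition mi_order :: "nat^3 \<Rightarrow> nat" where
  "mi_order \<alpha> = (\<Sum>k\<in>UNIV. \<alpha> $ k)"

definition mi_deriv :: "nat^3 \<Rightarrow> (real^3 \<Rightarrow> real) \<Rightarrow> real^3 \<Rightarrow> real" where
  "mi_deriv \<alpha> f = (partial 1 ^^ (\<alpha> $ 1)) ((partial 2 ^^ (\<alpha> $ 2)) ((partial 3 ^^ (\<alpha> $ 3)) f))"

text \<open>Polynomial functions of total degree at most \<open>r\<close>. The degree is an integer; for \<open>r < 0\<close>
  the index set is empty and only the zero function remains.\<close>

definition polys :: "int \<Rightarrow> (real^3 \<Rightarrow> real) set" where
  "polys r = {p. \<exists>c :: nat^3 \<Rightarrow> real. p =
     (\<lambda>y. \<Sum>\<alpha> | int (mi_order \<alpha>) \<le> r. c \<alpha> * (\<Prod>k\<in>UNIV. (y $ k) ^ (\<alpha> $ k)))}"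

text \<open>C-infinity: iterated partial derivatives of every order exist and are Frechet differentiable.\<close>

definition smooth :: "(real^3 \<Rightarrow> real) \<Rightarrow> bool" where
  "smooth \<phi> \<longleftrightarrow> (\<forall>ks y. foldr partial ks \<phi> differentiable (at y))"

definition test_functions :: "(real^3) set \<Rightarrow> (real^3 \<Rightarrow> real) set" where
  "test_functions T = {\<phi>. smooth \<phi> \<and> compact (closure {y. \<phi> y \<noteq> 0}) \<and>
     closure {y. \<phi> y \<noteq> 0} \<subseteq> interior T}"

definition curl_classical :: "(real^3 \<Rightarrow> real^3) \<Rightarrow> real^3 \<Rightarrow> real^3" where
  "curl_classical \<Phi> y = vector
     [partial 2 (\<lambda>w. \<Phi> w $ 3) y - partial 3 (\<lambda>w. \<Phi> w $ 2) y,
      partial 3 (\<lambda>w. \<Phi> w $ 1) y - partial 1 (\<lambda>w. \<Phi> w $ 3) y,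
      partial 1 (\<lambda>w. \<Phi> w $ 2) y - partial 2 (\<lambda>w. \<Phi> w $ 1) y]"

section \<open>L2 and weak differential operators\<close>

text \<open>Elements of \<open>L\<^sup>2(T)\<close> are represented by functions on the whole space, of which only the
  almost-everywhere class on \<open>T\<close> matters. Every function space below is closed under changing
  a representative, and equality of elements is \<open>ae_eq\<close>.\<close>

definition ae_eq :: "(real^3) set \<Rightarrow> (real^3 \<Rightarrow> 'a) \<Rightarrow> (real^3 \<Rightarrow> 'a) \<Rightarrow> bool" where
  "ae_eq S u v \<longleftrightarrow> (AE y in lebesgue_on S. u y = v y)"

definition L2 :: "(real^3) set \<Rightarrow> (real^3 \<Rightarrow> real) set" where
  "L2 T = {u \<in> borel_measurable (lebesgue_on T). integrable (lebesgue_on T) (\<lambda>y. (u y)\<^sup>2)}"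

text \<open>As a subset of \<open>L\<^sup>2(T)\<close>, \<open>C0 T\<close> consists of the classes with a representative that is
  continuous on \<open>T\<close>.\<close>

definition C0 :: "(real^3) set \<Rightarrow> (real^3 \<Rightarrow> real) set" where
  "C0 T = {u. \<exists>g. continuous_on T g \<and> ae_eq T u g}"

text \<open>\<open>cube A\<close> is \<open>[A]\<^sup>3\<close>.\<close>

definition cube :: "(real^3 \<Rightarrow> real) set \<Rightarrow> (real^3 \<Rightarrow> real^3) set" where
  "cube A = {\<omega>. \<forall>k. (\<lambda>y. \<omega> y $ k) \<in> A}"

text \<open>The weak operators, as unbounded operators between \<open>L\<^sup>2\<close> spaces, given by their graphs.\<close>

definition weak_grad :: "(real^3) set \<Rightarrow> ((real^3 \<Rightarrow> real) \<times> (real^3 \<Rightarrow> real^3)) set" where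
  "weak_grad T = {(u, g). u \<in> L2 T \<and> g \<in> cube (L2 T) \<and>
     (\<forall>\<phi>\<in>test_functions T. \<forall>k.
        (LINT y|lebesgue_on T. u y * partial k \<phi> y) = - (LINT y|lebesgue_on T. g y $ k * \<phi> y))}"

definition weak_curl :: "(real^3) set \<Rightarrow> ((real^3 \<Rightarrow> real^3) \<times> (real^3 \<Rightarrow> real^3)) set" where
  "weak_curl T = {(u, g). u \<in> cube (L2 T) \<and> g \<in> cube (L2 T) \<and>
     (\<forall>\<Phi>\<in>cube (test_functions T).
        (LINT y|lebesgue_on T. u y \<bullet> curl_classical \<Phi> y) = (LINT y|lebesgue_on T. g y \<bullet> \<Phi> y))}"

definition weak_div :: "(real^3) set \<Rightarrow> ((real^3 \<Rightarrow> real^3) \<times> (real^3 \<Rightarrow> real)) set" where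
  "weak_div T = {(u, d). u \<in> cube (L2 T) \<and> d \<in> L2 T \<and>
     (\<forall>\<phi>\<in>test_functions T.
        (LINT y|lebesgue_on T. (\<Sum>k\<in>UNIV. u y $ k * partial k \<phi> y)) =
          - (LINT y|lebesgue_on T. d y * \<phi> y))}"

section \<open>Piecewise polynomial spaces\<close>

definition pw_polys :: "(nat \<Rightarrow> real^3) \<Rightarrow> int \<Rightarrow> (real^3 \<Rightarrow> real) set" where
  "pw_polys x r = {\<omega>. \<forall>i\<le>3. \<exists>p\<in>polys r. ae_eq (tet (sub_verts x i)) \<omega> p}"

text \<open>\<open>C\<^sup>j\<close> on the vertices of the split: \<open>p i\<close> is the polynomial representing \<open>\<omega>\<close> on the
  \<open>i\<close>-th subtetrahedron; it is unique because that subtetrahedron is nondegenerate.\<close>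

definition Cj_at_vertices :: "(nat \<Rightarrow> real^3) \<Rightarrow> nat \<Rightarrow> (real^3 \<Rightarrow> real) set" where
  "Cj_at_vertices x j = {\<omega>. \<exists>p.
     (\<forall>i\<le>3. p i \<in> (\<Union>s. polys s) \<and> ae_eq (tet (sub_verts x i)) \<omega> (p i)) \<and>
     (\<forall>a\<in>alfeld_vertices x. \<forall>\<alpha>. mi_order \<alpha> \<le> j \<longrightarrow>
       (\<forall>i\<le>3. \<forall>i'\<le>3. a \<in> sub_verts x i ` {..3} \<and> a \<in> sub_verts x i' ` {..3} \<longrightarrow>
          mi_deriv \<alpha> (p i) a = mi_deriv \<alpha> (p i') a))}"

definition V0 :: "(nat \<Rightarrow> real^3) \<Rightarrow> int \<Rightarrow> (real^3 \<Rightarrow> real) set" where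
  "V0 x r = L2 (tet x) \<inter> pw_polys x r"

definition V3 :: "(nat \<Rightarrow> real^3) \<Rightarrow> int \<Rightarrow> (real^3 \<Rightarrow> real) set" where
  "V3 x r = V0 x r"

definition Vd2 :: "(nat \<Rightarrow> real^3) \<Rightarrow> int \<Rightarrow> (real^3 \<Rightarrow> real^3) set" where
  "Vd2 x r = {\<omega> \<in> cube (V0 x r). \<exists>d\<in>L2 (tet x). (\<omega>, d) \<in> weak_div (tet x)}"

definition Vd3 :: "(nat \<Rightarrow> real^3) \<Rightarrow> int \<Rightarrow> (real^3 \<Rightarrow> real) set" where
  "Vd3 x r = V3 x r"

definition M0 :: "(nat \<Rightarrow> real^3) \<Rightarrow> int \<Rightarrow> (real^3 \<Rightarrow> real) set" where
  "M0 x r = C0 (tet x) \<inter> pw_polys x r"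

definition M1 :: "(nat \<Rightarrow> real^3) \<Rightarrow> int \<Rightarrow> (real^3 \<Rightarrow> real^3) set" where
  "M1 x r = cube (M0 x r)"

definition M2 :: "(nat \<Rightarrow> real^3) \<Rightarrow> int \<Rightarrow> (real^3 \<Rightarrow> real^3) set" where
  "M2 x r = cube (M0 x r)"

definition M3 :: "(nat \<Rightarrow> real^3) \<Rightarrow> int \<Rightarrow> (real^3 \<Rightarrow> real) set" where
  "M3 x r = M0 x r"

definition Md0 :: "(nat \<Rightarrow> real^3) \<Rightarrow> int \<Rightarrow> (real^3 \<Rightarrow> real) set" where
  "Md0 x r = {\<omega> \<in> M0 x r. \<exists>g\<in>cube (C0 (tet x)). (\<omega>, g) \<in> weak_grad (tet x)}"

definition Md1 :: "(nat \<Rightarrow> real^3) \<Rightarrow> int \<Rightarrow> (real^3 \<Rightarrow> real^3) set" where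
  "Md1 x r = {\<omega> \<in> M1 x r. \<exists>g\<in>cube (C0 (tet x)). (\<omega>, g) \<in> weak_curl (tet x)}"

definition Md2 :: "(nat \<Rightarrow> real^3) \<Rightarrow> int \<Rightarrow> (real^3 \<Rightarrow> real^3) set" where
  "Md2 x r = {\<omega> \<in> M2 x r. \<exists>d\<in>C0 (tet x). (\<omega>, d) \<in> weak_div (tet x)}"

definition Md3 :: "(nat \<Rightarrow> real^3) \<Rightarrow> int \<Rightarrow> (real^3 \<Rightarrow> real) set" where
  "Md3 x r = M3 x r"

definition Mc1 :: "(nat \<Rightarrow> real^3) \<Rightarrow> int \<Rightarrow> (real^3 \<Rightarrow> real^3) set" where
  "Mc1 x r = M1 x r \<inter> cube (Cj_at_vertices x 1)"

definition Vc2 :: "(nat \<Rightarrow> real^3) \<Rightarrow> int \<Rightarrow> (real^3 \<Rightarrow> real^3) set" where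
  "Vc2 x r = Vd2 x r \<inter> cube (Cj_at_vertices x 0)"

section \<open>Exact sequences\<close>

text \<open>The operator with graph \<open>D\<close> is defined on all of \<open>X\<close> and maps it into \<open>Y\<close>.\<close>

definition op_maps :: "('a \<times> 'b) set \<Rightarrow> 'a set \<Rightarrow> 'b set \<Rightarrow> bool" where
  "op_maps D X Y \<longleftrightarrow> X \<subseteq> Domain D \<and> D `` X \<subseteq> Y"

definition op_ker :: "('a \<times> (real^3 \<Rightarrow> 'b::zero)) set \<Rightarrow> 'a set \<Rightarrow> 'a set" where
  "op_ker D X = {u \<in> X. (u, \<lambda>_. 0) \<in> D}"

definition constants :: "(real^3) set \<Rightarrow> (real^3 \<Rightarrow> real) set" where
  "constants T = {u. \<exists>c. ae_eq T u (\<lambda>_. c)}"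

text \<open>Exactness of \<open>\<real> \<rightarrow> X0 \<rightarrow> X1 \<rightarrow> X2 \<rightarrow> X3 \<rightarrow> 0\<close> with the maps inclusion, grad, curl, div; the
  kernel of the last map is all of \<open>X3\<close>.\<close>

definition exact_sequence ::
  "(real^3) set \<Rightarrow> (real^3 \<Rightarrow> real) set \<Rightarrow> (real^3 \<Rightarrow> real^3) set \<Rightarrow>
   (real^3 \<Rightarrow> real^3) set \<Rightarrow> (real^3 \<Rightarrow> real) set \<Rightarrow> bool" where
  "exact_sequence T X0 X1 X2 X3 \<longleftrightarrow>
     constants T \<subseteq> X0 \<and> op_maps (weak_grad T) X0 X1 \<and>
     op_maps (weak_curl T) X1 X2 \<and> op_maps (weak_div T) X2 X3 \<and>
     constants T = op_ker (weak_grad T) X0 \<and>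
     weak_grad T `` X0 = op_ker (weak_curl T) X1 \<and>
     weak_curl T `` X1 = op_ker (weak_div T) X2 \<and>
     weak_div T `` X2 = X3"

end

theory Submission
  imports Defs
begin

text \<open>
  Seen from the barycenter \<open>z\<close>, the four subtetrahedra are the traces of four cones that cover the space, and
  a piecewise polynomial is a family of four polynomials, one for each cone. The class of a piecewise polynomial
  has a continuous representative exactly if any two polynomials of the family agree on the plane through \<open>z\<close>
  that contains the common face (\<open>conforming\<close>). As these planes pass through \<open>z\<close>, the outer boundary of the
  tetrahedron imposes no condition.

  Potentials. The Poincare homotopy with centre \<open>z\<close> integrates along rays from \<open>z\<close>. These stay in one cone,
  so the homotopy preserves continuity, and it gives exactness at the second place of all three sequences and at
  the third place of the first two (\<open>grad_potential\<close>, \<open>curl_potential\<close>). Instead of integrals the proofs use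
  polynomial solutions of an Euler equation (\<open>euler_solve\<close>, \<open>euler_unique\<close>).

  Lifting. The vectors from \<open>z\<close> to the vertices add up to zero, so the space is the quotient of \<open>real^4\<close> by
  \<open>(1, 1, 1, 1)\<close>, the cones are the images of the facets of the positive orthant, and each polynomial on \<open>real^4\<close>
  restricts to a conforming family. Polynomials on \<open>real^4\<close> can be integrated in the direction
  \<open>(1, 1, 1, 1)\<close>. This shows that the divergence of continuous fields reaches all piecewise polynomials
  (\<open>div_onto\<close>), and it allows a potential with continuous tangential components to be corrected by a gradient so
  that it becomes continuous (\<open>tangential_correction\<close>). The second fact gives exactness at the third place of the
  third sequence, where only the normal components of the given field are continuous.

  Vertices. Every vertex of the split lies on an interior edge at which three cells meet. A continuous field whose
  curl is continuous at a point of such an edge is automatically \<open>C\<^sup>1\<close> there, because the jumps of its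
  derivative across the three planes are multiples of linearly independent matrices (\<open>C1_on_edge\<close>). So the vertex
  conditions on the second and the third space of the third sequence correspond to each other.

  Weak operators. For conforming families they are the operators applied cell by cell: integration by parts follows
  from the translation invariance of the integral (\<open>weak_dderiv\<close>), and the converse from the fundamental lemma of
  the calculus of variations (\<open>fundamental_lemma\<close>). If a discontinuous piecewise polynomial field has a
  square-integrable weak divergence, its normal jumps vanish (\<open>weak_div_jump\<close>).
\<close>

section \<open>Directional derivatives\<close>

definition dderiv :: "'a::euclidean_space \<Rightarrow> ('a \<Rightarrow> real) \<Rightarrow> 'a \<Rightarrow> real" where
  "dderiv v f y = frechet_derivative f (at y) v"

lemma partial_eq_dderiv: "partial k = dderiv (axis k 1)"
  by (auto simp: fun_eq_iff partial_def dderiv_def)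

lemma dderiv_eqI: "(f has_derivative f') (at y) \<Longrightarrow> dderiv v f y = f' v"
  unfolding dderiv_def by (metis frechet_derivative_at)

lemma dderiv_works: "f differentiable (at y) \<Longrightarrow> (f has_derivative (\<lambda>v. dderiv v f y)) (at y)"
  unfolding dderiv_def by (simp add: frechet_derivative_works[symmetric] eta_contract_eq)

lemma dderiv_const [simp]: "dderiv v (\<lambda>_. c) y = 0"
  by (rule dderiv_eqI) (auto intro!: derivative_eq_intros)

lemma dderiv_add:
  "f differentiable (at y) \<Longrightarrow> g differentiable (at y) \<Longrightarrow>
   dderiv v (\<lambda>y. f y + g y) y = dderiv v f y + dderiv v g y"
  by (rule dderiv_eqI[OF has_derivative_add[OF dderiv_works dderiv_works]])

lemma dderiv_diff:
  "f differentiable (at y) \<Longrightarrow> g differentiable (at y) \<Longrightarrow>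
   dderiv v (\<lambda>y. f y - g y) y = dderiv v f y - dderiv v g y"
  by (rule dderiv_eqI[OF has_derivative_diff[OF dderiv_works dderiv_works]])

lemma dderiv_mult:
  "f differentiable (at y) \<Longrightarrow> g differentiable (at y) \<Longrightarrow>
   dderiv v (\<lambda>y. f y * g y) y = dderiv v f y * g y + f y * dderiv v g y"
  by (subst dderiv_eqI[OF has_derivative_mult[OF dderiv_works dderiv_works]]) auto

lemma dderiv_cmult:
  "f differentiable (at y) \<Longrightarrow> dderiv v (\<lambda>y. c * f y) y = c * dderiv v f y"
  by (simp add: dderiv_mult)

lemma dderiv_sum:
  "(\<And>i. i \<in> I \<Longrightarrow> f i differentiable (at y)) \<Longrightarrow>
   dderiv v (\<lambda>y. \<Sum>i\<in>I. f i y) y = (\<Sum>i\<in>I. dderiv v (f i) y)"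
  by (rule dderiv_eqI[OF has_derivative_sum[OF dderiv_works]])

lemma dderiv_linear: "bounded_linear l \<Longrightarrow> dderiv v l y = l v"
  by (rule dderiv_eqI) (rule bounded_linear_imp_has_derivative)

lemma dderiv_nth [simp]:
  fixes v :: "real^'n" shows "dderiv v (\<lambda>y. y $ k) y = v $ k" "dderiv v (\<lambda>y. y $ k - c) y = v $ k"
  by (rule dderiv_eqI, auto intro!: derivative_eq_intros bounded_linear_imp_has_derivative bounded_linear_vec_nth)+

lemma linear_dderiv: "f differentiable (at y) \<Longrightarrow> linear (\<lambda>v. dderiv v f y)"
  by (metis dderiv_works has_derivative_linear)

lemma dderiv_dir_add: "f differentiable (at y) \<Longrightarrow> dderiv (v + w) f y = dderiv v f y + dderiv w f y"
  by (rule linear_add[OF linear_dderiv])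

lemma dderiv_dir_diff: "f differentiable (at y) \<Longrightarrow> dderiv (v - w) f y = dderiv v f y - dderiv w f y"
  by (rule linear_diff[OF linear_dderiv])

lemma dderiv_dir_scaleR: "f differentiable (at y) \<Longrightarrow> dderiv (c *\<^sub>R v) f y = c * dderiv v f y"
  using linear_cmul[OF linear_dderiv] by fastforce

lemma dderiv_dir_sum:
  "f differentiable (at y) \<Longrightarrow> dderiv (\<Sum>i\<in>I. v i) f y = (\<Sum>i\<in>I. dderiv (v i) f y)"
  using linear_sum[OF linear_dderiv] by fastforce

lemma dderiv_dir_axis:
  fixes f :: "real^'n \<Rightarrow> real"
  assumes "f differentiable (at y)"
  shows "dderiv v f y = (\<Sum>k\<in>UNIV. v $ k * dderiv (axis k 1) f y)"
proof -
  have "dderiv v f y = dderiv (\<Sum>k\<in>UNIV. v $ k *\<^sub>R axis k 1) f y"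
    using basis_expansion[of v] by (simp add: scalar_mult_eq_scaleR)
  then show ?thesis using assms by (simp add: dderiv_dir_sum dderiv_dir_scaleR)
qed

lemma dderiv_compose:
  fixes g :: "'b::euclidean_space \<Rightarrow> 'a::euclidean_space"
  assumes "(g has_derivative g') (at y)" "f differentiable (at (g y))"
  shows "dderiv v (\<lambda>y. f (g y)) y = dderiv (g' v) f (g y)"
  using has_derivative_compose[OF assms(1) dderiv_works[OF assms(2)]] by (rule dderiv_eqI)

section \<open>Polynomials of bounded degree\<close>

text \<open>Closing the constants under products with linear forms and under sums makes no choice of
  coordinates, so one induction principle serves \<open>real^3\<close> and the space \<open>real^4\<close> of lifted
  polynomials. The coordinate description of \<open>polys\<close> is recovered in \<open>polys_eq\<close>.\<close>
inductive polyn :: "nat \<Rightarrow> ('a::euclidean_space \<Rightarrow> real) \<Rightarrow> bool" where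
  const: "polyn n (\<lambda>_. c)"
| lin: "bounded_linear l \<Longrightarrow> polyn n f \<Longrightarrow> polyn (Suc n) (\<lambda>y. l y * f y)"
| add: "polyn n f \<Longrightarrow> polyn n g \<Longrightarrow> polyn n (\<lambda>y. f y + g y)"

lemma polyn_differentiable: "polyn n f \<Longrightarrow> f differentiable (at y)"
  by (induction rule: polyn.induct)
     (auto intro!: differentiable_add differentiable_mult intro: bounded_linear_imp_differentiable)

lemma polyn_differentiable_on: "polyn n f \<Longrightarrow> f differentiable_on S"
  by (meson differentiable_at_imp_differentiable_on polyn_differentiable)

lemma polyn_continuous_on: "polyn n f \<Longrightarrow> continuous_on S f"
  by (meson differentiable_imp_continuous_on polyn_differentiable_on)

lemma polyn_Suc: "polyn n f \<Longrightarrow> polyn (Suc n) f"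
  by (induction rule: polyn.induct) (auto intro: polyn.intros)

lemma polyn_mono: "polyn m f \<Longrightarrow> m \<le> n \<Longrightarrow> polyn n f"
  by (induction n) (auto simp: le_Suc_eq intro: polyn_Suc)

lemma polyn_cmult: "polyn n f \<Longrightarrow> polyn n (\<lambda>y. c * f y)"
proof (induction rule: polyn.induct)
  case (lin l n f)
  then have "polyn (Suc n) (\<lambda>y. l y * (c * f y))" by (intro polyn.lin)
  then show ?case by (simp add: mult_ac)
qed (auto simp: distrib_left intro: polyn.intros)

lemma polyn_minus: "polyn n f \<Longrightarrow> polyn n (\<lambda>y. - f y)"
  using polyn_cmult[of n f "-1"] by simp

lemma polyn_diff: "polyn n f \<Longrightarrow> polyn n g \<Longrightarrow> polyn n (\<lambda>y. f y - g y)"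
  using polyn.add[OF _ polyn_minus] by fastforce

lemma polyn_sum: "(\<And>i. i \<in> I \<Longrightarrow> polyn n (f i)) \<Longrightarrow> polyn n (\<lambda>y. \<Sum>i\<in>I. f i y)"
  by (induction I rule: infinite_finite_induct) (auto intro: polyn.intros)

lemma polyn_0: "polyn 0 f \<Longrightarrow> \<exists>c. f = (\<lambda>_. c)"
  by (induction "0::nat" f rule: polyn.induct) auto

lemma polyn_mult: "polyn m f \<Longrightarrow> polyn n g \<Longrightarrow> polyn (m + n) (\<lambda>y. f y * g y)"
proof (induction arbitrary: rule: polyn.induct)
  case (const m c)
  then show ?case using polyn_cmult polyn_mono by (metis le_add2)
next
  case (lin l m f)
  then have "polyn (Suc (m + n)) (\<lambda>y. l y * (f y * g y))" by (intro polyn.lin) auto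
  then show ?case by (simp add: mult_ac)
qed (auto simp: distrib_right intro: polyn.intros)

lemma polyn_lin: "bounded_linear l \<Longrightarrow> polyn (Suc 0) l"
  using polyn.lin[OF _ polyn.const[of 0 1]] by simp

lemma polyn_nth:
  fixes z :: "real^'n" shows "polyn (Suc 0) (\<lambda>y. (y - z) $ k)" "polyn (Suc 0) (\<lambda>y::real^'n. y $ k)"
  using polyn_diff[OF polyn_lin[OF bounded_linear_vec_nth, of k] polyn.const[of _ "z $ k"]]
   polyn_lin[OF bounded_linear_vec_nth, of k]
  by simp_all

lemma polyn_power: "polyn m f \<Longrightarrow> polyn (m * k) (\<lambda>y. f y ^ k)"
  by (induction k) (auto intro: polyn.const polyn_mult)

lemma polyn_prod:
  "finite I \<Longrightarrow> (\<And>i. i \<in> I \<Longrightarrow> polyn (d i) (f i)) \<Longrightarrow> polyn (\<Sum>i\<in>I. d i) (\<lambda>y. \<Prod>i\<in>I. f i y)"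
  by (induction I rule: finite_induct) (auto intro: polyn.const polyn_mult)

lemma polyn_compose:
  assumes "polyn n f" "bounded_linear A"
  shows "polyn n (\<lambda>y. f (A y + b))"
  using assms
proof (induction rule: polyn.induct)
  case (lin l n f)
  have "bounded_linear (\<lambda>y. l (A y))" by (rule bounded_linear_compose[OF lin.hyps(1) lin.prems])
  then have "polyn (Suc n) (\<lambda>y. l (A y) * f (A y + b) + l b * f (A y + b))"
    using lin by (intro polyn.add polyn.lin polyn_cmult polyn_Suc) auto
  then show ?case using lin by (simp add: bounded_linear.linear linear_add algebra_simps)
qed (auto intro: polyn.intros)

lemma polyn_dderiv_strong: "polyn n f \<Longrightarrow> polyn (n - 1) (dderiv v f) \<and> (n = 0 \<longrightarrow> dderiv v f = (\<lambda>_. 0))"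
proof (induction rule: polyn.induct)
  case (const n c)
  have "dderiv v (\<lambda>_. c) = (\<lambda>_. 0)" by (auto simp: fun_eq_iff)
  then show ?case by (auto intro: polyn.const)
next
  case (lin l n f)
  have eq: "dderiv v (\<lambda>y. l y * f y) = (\<lambda>y. l v * f y + l y * dderiv v f y)"
    using lin by (auto simp: fun_eq_iff dderiv_mult dderiv_linear polyn_differentiable
        bounded_linear_imp_differentiable)
  have "polyn n (\<lambda>y. l y * dderiv v f y)"
  proof (cases n)
    case 0
    then show ?thesis using lin by (auto intro: polyn.const)
  next
    case (Suc m)
    then show ?thesis using lin by (auto intro: polyn.lin)
  qed
  then show ?case using lin by (auto simp: eq intro!: polyn.add polyn_cmult)
next
  case (add n f g)
  have eq: "dderiv v (\<lambda>y. f y + g y) = (\<lambda>y. dderiv v f y + dderiv v g y)"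
    using add by (auto simp: fun_eq_iff dderiv_add polyn_differentiable)
  show ?case using add by (auto simp: eq intro: polyn.add)
qed

lemma polyn_dderiv: "polyn n f \<Longrightarrow> polyn (n - 1) (dderiv v f)"
  using polyn_dderiv_strong by blast

lemma polyn_dderiv': "polyn n f \<Longrightarrow> polyn n (dderiv v f)"
  by (meson diff_le_self polyn_dderiv polyn_mono)

lemma polyn_dderiv_0: "polyn 0 f \<Longrightarrow> dderiv v f = (\<lambda>_. 0)"
  using polyn_dderiv_strong by blast

lemma dderiv_commute: "polyn n f \<Longrightarrow> dderiv v (dderiv w f) y = dderiv w (dderiv v f) y"
proof (induction arbitrary: y rule: polyn.induct)
  case (const n c)
  have "dderiv v (\<lambda>_. c) = (\<lambda>_. 0)" for v :: 'a by (auto simp: fun_eq_iff)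
  then show ?case by simp
next
  case (lin l n f)
  have eq: "dderiv v (\<lambda>y. l y * f y) = (\<lambda>y. l v * f y + l y * dderiv v f y)" for v
    using lin by (auto simp: fun_eq_iff dderiv_mult dderiv_linear polyn_differentiable
        bounded_linear_imp_differentiable)
  have d: "dderiv v f differentiable (at y)" "f differentiable (at y)" "l differentiable (at y)" for v y
    using lin by (auto intro: polyn_differentiable polyn_dderiv' bounded_linear_imp_differentiable)
  show ?case using lin.IH lin.hyps(1)
    by (simp add: eq dderiv_add dderiv_cmult dderiv_mult d dderiv_linear)
next
  case (add n f g)
  have eq: "dderiv v (\<lambda>y. f y + g y) = (\<lambda>y. dderiv v f y + dderiv v g y)" for v
    using add by (auto simp: fun_eq_iff dderiv_add polyn_differentiable)
  show ?case using add by (simp add: eq dderiv_add polyn_differentiable[OF polyn_dderiv'])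
qed

lemma polyn_line:
  assumes "polyn n f" shows "\<exists>q. \<forall>t. f (a + t *\<^sub>R w) = poly q t"
  using assms
proof (induction rule: polyn.induct)
  case (const n c)
  then show ?case by (intro exI[of _ "[:c:]"]) auto
next
  case (lin l n f)
  then obtain q where "\<forall>t. f (a + t *\<^sub>R w) = poly q t" by blast
  moreover have "l (a + t *\<^sub>R w) = poly [:l a, l w:] t" for t
    using lin by (simp add: bounded_linear.linear linear_add linear_cmul)
  ultimately show ?case by (intro exI[of _ "[:l a, l w:] * q"]) (simp only: poly_mult simp_thms)
next
  case (add n f g)
  then show ?case by (metis poly_add)
qed

text \<open>On the line through \<open>a\<close> and \<open>y\<close> the function is a polynomial in the parameter with infinitely
  many roots.\<close>
lemma polyn_eq_0_ray:
  assumes "polyn n f" "\<delta> > 0" "\<And>t. 0 < t \<Longrightarrow> t < \<delta> \<Longrightarrow> f (a + t *\<^sub>R (y - a)) = 0"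
  shows "f y = 0"
proof -
  obtain q where q: "\<And>t. f (a + t *\<^sub>R (y - a)) = poly q t" using polyn_line[OF assms(1)] by metis
  have "{0<..<\<delta>} \<subseteq> {t. poly q t = 0}" using assms q by auto
  then have "infinite {t. poly q t = 0}"
    using assms(2) infinite_Ioo finite_subset by blast
  then have "q = 0" using poly_roots_finite by blast
  then show ?thesis using q[of 1] by simp
qed

lemma polyn_eq_0_open:
  assumes "polyn n f" "open S" "S \<noteq> {}" "\<And>y. y \<in> S \<Longrightarrow> f y = 0"
  shows "f y = 0"
proof -
  obtain a where a: "a \<in> S" using assms by blast
  obtain e where e: "e > 0" "ball a e \<subseteq> S" using assms a open_contains_ball by blast
  define \<delta> where "\<delta> = e / (norm (y - a) + 1)"
  have "\<delta> > 0" using e by (simp add: \<delta>_def add_nonneg_pos)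
  moreover have "f (a + t *\<^sub>R (y - a)) = 0" if "0 < t" "t < \<delta>" for t
  proof -
    have "t * norm (y - a) \<le> t * (norm (y - a) + 1)" using that by simp
    also have "\<dots> < e" using that by (simp add: \<delta>_def pos_less_divide_eq add_nonneg_pos)
    finally have "a + t *\<^sub>R (y - a) \<in> ball a e" using that by (simp add: dist_norm)
    then show ?thesis using e assms by blast
  qed
  ultimately show ?thesis using polyn_eq_0_ray[OF assms(1)] by blast
qed

section \<open>The Euler operator\<close>

text \<open>The Euler operator about \<open>z\<close> multiplies a homogeneous polynomial by its degree, so adding a
  positive \<open>s\<close> makes it invertible without a decomposition into homogeneous parts: pulling the linear
  factor \<open>l (y - z)\<close> through the operator raises \<open>s\<close> by one. The solution is
  \<open>\<integral> t^(s - 1) f (z + t (y - z)) dt\<close> over the unit interval, the integral in the Poincare homotopy.\<close>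
lemma euler_solve:
  assumes "polyn n f" "s > (0::nat)"
  shows "\<exists>g. polyn n g \<and> (\<forall>y. dderiv (y - z) g y + s * g y = f y)"
  using assms
proof (induction arbitrary: s rule: polyn.induct)
  case (const n c)
  then show ?case by (intro exI[of _ "\<lambda>_. c / s"]) (auto intro: polyn.const)
next
  case (lin l n f)
  obtain g :: "'a \<Rightarrow> real" where g: "polyn n g" "\<And>y. dderiv (y - z) g y + real (Suc s) * g y = f y"
    using lin.IH[OF zero_less_Suc[of s]] by blast
  obtain h :: "'a \<Rightarrow> real" where h: "polyn n h" "\<And>y. dderiv (y - z) h y + real s * h y = f y"
    using lin.IH[OF lin.prems] by blast
  have l: "linear l" using lin by (simp add: bounded_linear.linear)
  have d: "l differentiable (at y)" "g differentiable (at y)" "h differentiable (at y)" for y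
    using lin g h by (auto intro: polyn_differentiable bounded_linear_imp_differentiable)
  define k where "k = (\<lambda>y. (l y * g y - l z * g y) + l z * h y)"
  have "polyn (Suc n) k" unfolding k_def
    using lin g h by (intro polyn.add polyn_diff polyn.lin polyn_cmult) (auto intro: polyn_Suc)
  moreover have "dderiv (y - z) k y + s * k y = l y * f y" for y
  proof -
    have "dderiv (y - z) k y = l (y - z) * g y + l y * dderiv (y - z) g y - l z * dderiv (y - z) g y
        + l z * dderiv (y - z) h y"
      unfolding k_def using lin.hyps(1)
      by (simp add: dderiv_add dderiv_diff dderiv_mult dderiv_cmult dderiv_linear d differentiable_mult)
    also have "\<dots> = (l y - l z) * (dderiv (y - z) g y + g y) + l z * dderiv (y - z) h y"
      using l by (simp add: linear_diff algebra_simps)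
    also have "\<dots> = (l y - l z) * (f y - real s * g y) + l z * (f y - real s * h y)"
    proof -
      have "dderiv (y - z) g y + g y = f y - real s * g y" using g(2)[of y] by (simp add: algebra_simps)
      moreover have "dderiv (y - z) h y = f y - real s * h y" using h(2)[of y] by simp
      ultimately show ?thesis by simp
    qed
    finally show ?thesis unfolding k_def by (simp add: algebra_simps)
  qed
  ultimately show ?case by blast
next
  case (add n f1 f2)
  obtain g :: "'a \<Rightarrow> real" where g: "polyn n g" "\<And>y. dderiv (y - z) g y + real s * g y = f1 y"
    using add.IH(1)[OF add.prems] by blast
  obtain h :: "'a \<Rightarrow> real" where h: "polyn n h" "\<And>y. dderiv (y - z) h y + real s * h y = f2 y"
    using add.IH(2)[OF add.prems] by blast
  show ?case
  proof (intro exI[of _ "\<lambda>y. g y + h y"] conjI allI)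
    show "polyn n (\<lambda>y. g y + h y)" using g h by (auto intro: polyn.add)
    fix y
    show "dderiv (y - z) (\<lambda>y. g y + h y) y + s * (g y + h y) = f1 y + f2 y"
      using g(2)[of y, symmetric] h(2)[of y, symmetric] g(1) h(1)
      by (simp add: dderiv_add polyn_differentiable algebra_simps)
  qed
qed

text \<open>Along the ray \<open>t \<mapsto> z + t (y - z)\<close> the equation says that \<open>t^s f\<close> has derivative zero. Only
  the values on the line through \<open>z\<close> and \<open>y\<close> enter, which is why the operator respects every relation
  between polynomials that holds on a plane through \<open>z\<close>.\<close>
lemma euler_unique:
  fixes f :: "'a::euclidean_space \<Rightarrow> real"
  assumes "polyn n f" "s > (0::nat)"
    and "\<And>t. dderiv (t *\<^sub>R (y - z)) f (z + t *\<^sub>R (y - z)) + s * f (z + t *\<^sub>R (y - z)) = 0"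
  shows "f y = 0"
proof -
  define h where "h = (\<lambda>t::real. t ^ s * f (z + t *\<^sub>R (y - z)))"
  have "(h has_field_derivative 0) (at t)" for t
  proof -
    have A: "((\<lambda>t. f (z + t *\<^sub>R (y - z))) has_derivative
       (\<lambda>e. dderiv (e *\<^sub>R (y - z)) f (z + t *\<^sub>R (y - z)))) (at t)"
      by (rule has_derivative_compose[OF _ dderiv_works[OF polyn_differentiable[OF assms(1)]]])
         (auto intro!: derivative_eq_intros)
    have "dderiv (e *\<^sub>R (y - z)) f (z + t *\<^sub>R (y - z)) = dderiv (y - z) f (z + t *\<^sub>R (y - z)) * e" for e
      by (simp add: dderiv_dir_scaleR polyn_differentiable[OF assms(1)] mult_ac)
    then have "((\<lambda>t. f (z + t *\<^sub>R (y - z))) has_field_derivative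
        dderiv (y - z) f (z + t *\<^sub>R (y - z))) (at t)"
      using A by (simp add: has_field_derivative_def mult_commute_abs)
    then have "(h has_field_derivative s * t ^ (s - 1) * f (z + t *\<^sub>R (y - z))
        + t ^ s * dderiv (y - z) f (z + t *\<^sub>R (y - z))) (at t)"
      unfolding h_def by (auto intro!: derivative_eq_intros)
    moreover have "s * t ^ (s - 1) * f (z + t *\<^sub>R (y - z))
        + t ^ s * dderiv (y - z) f (z + t *\<^sub>R (y - z)) =
        t ^ (s - 1) * (dderiv (t *\<^sub>R (y - z)) f (z + t *\<^sub>R (y - z)) + s * f (z + t *\<^sub>R (y - z)))"
      using assms(2) unfolding dderiv_dir_scaleR[OF polyn_differentiable[OF assms(1)]]
      by (cases s) (simp_all add: distrib_left distrib_right mult_ac)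
    ultimately show ?thesis using assms(3)[of t] by simp
  qed
  then have "h 1 = h 0" by (metis DERIV_isconst_all)
  then show ?thesis using assms(2) by (simp add: h_def)
qed

section \<open>Antiderivatives in a direction\<close>

text \<open>Integration by parts: an antiderivative of \<open>l^m f\<close> is \<open>l^(m+1) f / (m+1)\<close> minus an antiderivative
  of \<open>l^(m+1) \<partial>f / (m+1)\<close>, and \<open>\<partial>f\<close> has smaller degree. The factor \<open>l^(m+1)\<close> is kept visible
  because \<open>div_onto\<close> needs antiderivatives that vanish to second order on a hyperplane.\<close>
lemma polyn_antiderivative:
  fixes l :: "'a::euclidean_space \<Rightarrow> real"
  assumes "polyn n f" "bounded_linear l" "l v = 1"
  shows "\<exists>H. polyn n H \<and> (\<forall>y. dderiv v (\<lambda>y. l y ^ Suc m * H y) y = l y ^ m * f y)"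
  using assms(1)
proof (induction n arbitrary: f m)
  have dl: "l differentiable (at y)" for y using assms by (simp add: bounded_linear_imp_differentiable)
  have dp: "dderiv v (\<lambda>y. l y ^ Suc m) y = Suc m * l y ^ m" for m y
  proof (induction m)
    case 0
    then show ?case using assms by (simp add: dderiv_linear)
  next
    case (Suc m)
    have "dderiv v (\<lambda>y. l y * l y ^ Suc m) y = l v * l y ^ Suc m + l y * dderiv v (\<lambda>y. l y ^ Suc m) y"
      using assms by (subst dderiv_mult) (auto simp: dderiv_linear dl intro!: differentiable_mult differentiable_power)
    then show ?case using Suc assms by (simp add: algebra_simps)
  qed
  have dpow: "(\<lambda>y. l y ^ k) differentiable (at y)" for k y
    by (intro differentiable_power dl)
  {
    case 0
    then obtain c where c: "f = (\<lambda>_. c)" using polyn_0 by blast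
    show ?case
    proof (intro exI[of _ "\<lambda>_. c / Suc m"] conjI allI)
      fix y
      show "dderiv v (\<lambda>y. l y ^ Suc m * (c / real (Suc m))) y = l y ^ m * f y"
        using dp[of m y] dpow[of "Suc m"] by (subst dderiv_mult) (auto simp: c simp del: power_Suc)
    qed (auto intro: polyn.const)
  next
    case (Suc n)
    have "polyn n (dderiv v f)" using polyn_dderiv[OF Suc.prems] by simp
    from Suc.IH[OF this, of "Suc m"] obtain H where H: "polyn n H"
      "\<And>y. dderiv v (\<lambda>y. l y ^ Suc (Suc m) * H y) y = l y ^ Suc m * dderiv v f y" by blast
    define K where "K = (\<lambda>y. inverse (Suc m) * (f y - l y * H y))"
    have "polyn (Suc n) K" unfolding K_def
      using Suc.prems H assms by (intro polyn_cmult polyn_diff polyn.lin)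
    moreover have "dderiv v (\<lambda>y. l y ^ Suc m * K y) y = l y ^ m * f y" for y
    proof -
      have d: "f differentiable (at y)" "H differentiable (at y)"
        using Suc.prems H(1) by (auto intro: polyn_differentiable)
      have "(\<lambda>y. l y ^ Suc m * K y) = (\<lambda>y. inverse (Suc m) * (l y ^ Suc m * f y - l y ^ Suc (Suc m) * H y))"
        by (auto simp: K_def fun_eq_iff algebra_simps)
      then have "dderiv v (\<lambda>y. l y ^ Suc m * K y) y = inverse (Suc m) *
          (dderiv v (\<lambda>y. l y ^ Suc m * f y) y - dderiv v (\<lambda>y. l y ^ Suc (Suc m) * H y) y)"
        using d dpow by (simp only: dderiv_cmult dderiv_diff differentiable_mult differentiable_diff)
      also have "dderiv v (\<lambda>y. l y ^ Suc m * f y) y = Suc m * l y ^ m * f y + l y ^ Suc m * dderiv v f y"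
        using d dpow dp by (simp only: dderiv_mult)
      finally show ?thesis unfolding H(2) by (simp del: of_nat_Suc)
    qed
    ultimately show ?case by blast
  }
qed

section \<open>Polynomials in coordinates\<close>

lemma polys_add: "f \<in> polys r \<Longrightarrow> g \<in> polys r \<Longrightarrow> (\<lambda>y. f y + g y) \<in> polys r"
  unfolding polys_def
proof clarify
  fix c d :: "nat^3 \<Rightarrow> real"
  show "\<exists>e. (\<lambda>y. (\<Sum>\<alpha> | int (mi_order \<alpha>) \<le> r. c \<alpha> * (\<Prod>k\<in>UNIV. y $ k ^ \<alpha> $ k)) +
                 (\<Sum>\<alpha> | int (mi_order \<alpha>) \<le> r. d \<alpha> * (\<Prod>k\<in>UNIV. y $ k ^ \<alpha> $ k))) =
             (\<lambda>y. \<Sum>\<alpha> | int (mi_order \<alpha>) \<le> r. e \<alpha> * (\<Prod>k\<in>UNIV. y $ k ^ \<alpha> $ k))"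
    by (rule exI[of _ "\<lambda>\<alpha>. c \<alpha> + d \<alpha>"]) (simp add: sum.distrib distrib_right)
qed

lemma polys_cmult: "f \<in> polys r \<Longrightarrow> (\<lambda>y. a * f y) \<in> polys r"
  unfolding polys_def
proof clarify
  fix c :: "nat^3 \<Rightarrow> real"
  show "\<exists>e. (\<lambda>y. a * (\<Sum>\<alpha> | int (mi_order \<alpha>) \<le> r. c \<alpha> * (\<Prod>k\<in>UNIV. y $ k ^ \<alpha> $ k))) =
             (\<lambda>y. \<Sum>\<alpha> | int (mi_order \<alpha>) \<le> r. e \<alpha> * (\<Prod>k\<in>UNIV. y $ k ^ \<alpha> $ k))"
    by (rule exI[of _ "\<lambda>\<alpha>. a * c \<alpha>"]) (simp add: sum_distrib_left mult_ac)
qed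

lemma polys_0: "(\<lambda>_. 0) \<in> polys r"
  unfolding polys_def by (auto intro!: exI[of _ "\<lambda>_. 0"])

lemma polys_sum: "(\<And>i. i \<in> I \<Longrightarrow> f i \<in> polys r) \<Longrightarrow> (\<lambda>y. \<Sum>i\<in>I. f i y) \<in> polys r"
  by (induction I rule: infinite_finite_induct) (auto intro: polys_add polys_0)

lemma finite_mi_order: "finite {\<alpha>. int (mi_order \<alpha>) \<le> r}"
proof -
  have "{\<alpha>. int (mi_order \<alpha>) \<le> r} \<subseteq> vec_lambda ` (UNIV \<rightarrow>\<^sub>E {..nat r})"
  proof
    fix \<alpha> :: "nat^3" assume "\<alpha> \<in> {\<alpha>. int (mi_order \<alpha>) \<le> r}"
    then have "mi_order \<alpha> \<le> nat r" by auto
    moreover have "\<alpha> $ k \<le> mi_order \<alpha>" for k unfolding mi_order_def by (rule member_le_sum) auto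
    ultimately have "vec_nth \<alpha> \<in> UNIV \<rightarrow>\<^sub>E {..nat r}" by (auto intro: le_trans)
    then show "\<alpha> \<in> vec_lambda ` (UNIV \<rightarrow>\<^sub>E {..nat r})" by (metis image_eqI vec_nth_inverse)
  qed
  then show ?thesis by (rule finite_subset) (auto intro!: finite_PiE)
qed

lemma polys_monomial: "int (mi_order \<beta>) \<le> r \<Longrightarrow> (\<lambda>y. \<Prod>k\<in>UNIV. y $ k ^ \<beta> $ k) \<in> polys r"
proof -
  assume *: "int (mi_order \<beta>) \<le> r"
  have "(\<Sum>\<alpha> | int (mi_order \<alpha>) \<le> r. (if \<alpha> = \<beta> then 1 else 0) * (\<Prod>k\<in>UNIV. y $ k ^ \<alpha> $ k)) =
    (\<Prod>k\<in>UNIV. y $ k ^ \<beta> $ k)" for y :: "real^3"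
  proof -
    have "(\<Sum>\<alpha> | int (mi_order \<alpha>) \<le> r. (if \<alpha> = \<beta> then 1 else 0) * (\<Prod>k\<in>UNIV. y $ k ^ \<alpha> $ k)) =
      (\<Sum>\<alpha> | int (mi_order \<alpha>) \<le> r. if \<alpha> = \<beta> then (\<Prod>k\<in>UNIV. y $ k ^ \<alpha> $ k) else 0)"
      by (rule sum.cong) auto
    then show ?thesis using * finite_mi_order by (simp add: sum.delta)
  qed
  then show ?thesis unfolding polys_def by (auto intro!: exI[of _ "\<lambda>\<alpha>. if \<alpha> = \<beta> then 1 else 0"])
qed

lemma polys_nth_mult: "f \<in> polys r \<Longrightarrow> (\<lambda>y. y $ j * f y) \<in> polys (r + 1)"
proof -
  assume "f \<in> polys r"
  then obtain c where f: "f = (\<lambda>y. \<Sum>\<alpha> | int (mi_order \<alpha>) \<le> r. c \<alpha> * (\<Prod>k\<in>UNIV. (y $ k) ^ (\<alpha> $ k)))"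
    unfolding polys_def by auto
  have "(\<lambda>y. y $ j * (\<Prod>k\<in>UNIV. (y $ k) ^ (\<alpha> $ k))) \<in> polys (r + 1)" if "int (mi_order \<alpha>) \<le> r" for \<alpha> :: "nat^3"
  proof -
    define \<beta> where "\<beta> = (\<chi> k. \<alpha> $ k + (if k = j then 1 else 0))"
    have "mi_order \<beta> = mi_order \<alpha> + 1" by (simp add: mi_order_def \<beta>_def sum.distrib)
    moreover have "(\<Prod>k\<in>UNIV. y $ k ^ \<beta> $ k) = y $ j * (\<Prod>k\<in>UNIV. (y $ k) ^ (\<alpha> $ k))" for y :: "real^3"
    proof -
      have "(\<Prod>k\<in>UNIV. y $ k ^ \<beta> $ k) = (\<Prod>k\<in>UNIV. (y $ k) ^ (\<alpha> $ k) * (if k = j then y $ k else 1))"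
        by (rule prod.cong) (auto simp: \<beta>_def)
      then show ?thesis by (simp add: prod.distrib prod.delta)
    qed
    ultimately show ?thesis using polys_monomial[of \<beta> "r + 1"] that by simp
  qed
  then have "(\<lambda>y. \<Sum>\<alpha> | int (mi_order \<alpha>) \<le> r. c \<alpha> * (y $ j * (\<Prod>k\<in>UNIV. (y $ k) ^ (\<alpha> $ k)))) \<in> polys (r + 1)"
    by (intro polys_sum polys_cmult) auto
  then show ?thesis by (simp add: f sum_distrib_left mult_ac)
qed

lemma polyn_in_polys: "polyn n f \<Longrightarrow> f \<in> polys (int n)"
proof (induction rule: polyn.induct)
  case (const n c)
  have "(\<lambda>y. c * (\<Prod>k\<in>UNIV. y $ k ^ (0::nat^3) $ k)) \<in> polys (int n)"
    by (intro polys_cmult polys_monomial) (simp add: mi_order_def)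
  then show ?case by simp
next
  case (lin l n f)
  have "l y = (\<Sum>k\<in>UNIV. l (axis k 1) * y $ k)" for y
  proof -
    have "l y = l (\<Sum>k\<in>UNIV. y $ k *\<^sub>R axis k 1)"
      using basis_expansion[of y] by (simp add: scalar_mult_eq_scaleR)
    then show ?thesis using bounded_linear.linear[OF lin(1)] by (simp add: linear_sum linear_cmul mult_ac)
  qed
  then have "(\<lambda>y. l y * f y) = (\<lambda>y. \<Sum>k\<in>UNIV. l (axis k 1) * (y $ k * f y))"
    by (metis (no_types, lifting) mult.assoc sum.cong sum_distrib_right)
  moreover have "(\<lambda>y. \<Sum>k\<in>UNIV. l (axis k 1) * (y $ k * f y)) \<in> polys (int (Suc n))"
    using polys_nth_mult[OF lin.IH] by (intro polys_sum polys_cmult) (simp add: add.commute)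
  ultimately show ?case by simp
qed (auto intro: polys_add)

lemma polys_eq: "polys r = {f. if r < 0 then f = (\<lambda>_. 0) else polyn (nat r) f}"
proof (cases "r < 0")
  case True
  then have "\<not> int n \<le> r" for n by linarith
  then have "polys r = {\<lambda>_. 0}" unfolding polys_def by simp
  then show ?thesis using True by auto
next
  case False
  have "polyn (nat r) f" if f_in: "f \<in> polys r" for f
  proof -
    obtain c where f: "f = (\<lambda>y. \<Sum>\<alpha> | int (mi_order \<alpha>) \<le> r. c \<alpha> * (\<Prod>k\<in>UNIV. (y $ k) ^ (\<alpha> $ k)))"
      using f_in unfolding polys_def by blast
    show ?thesis unfolding f
    proof (intro polyn_sum polyn_cmult)
      fix \<alpha> :: "nat^3" assume "\<alpha> \<in> {\<alpha>. int (mi_order \<alpha>) \<le> r}"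
      then have *: "mi_order \<alpha> \<le> nat r" by auto
      have "polyn (\<Sum>k\<in>UNIV. \<alpha> $ k) (\<lambda>y::real^3. \<Prod>k\<in>UNIV. (y $ k) ^ (\<alpha> $ k))"
        using polyn_power[OF polyn_nth(2)] by (intro polyn_prod) auto
      then show "polyn (nat r) (\<lambda>y::real^3. \<Prod>k\<in>UNIV. (y $ k) ^ (\<alpha> $ k))"
        using * polyn_mono unfolding mi_order_def by blast
    qed
  qed
  then show ?thesis using False polyn_in_polys[of "nat r"] by auto
qed

lemma polys_polyn: "f \<in> polys r \<Longrightarrow> polyn (nat r) f"
  by (auto simp: polys_eq polyn.const split: if_splits)

lemma polys_dderiv: "f \<in> polys r \<Longrightarrow> dderiv v f \<in> polys (r - 1)"
proof (cases "r \<le> 0")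
  case True
  assume *: "f \<in> polys r"
  then have "polyn 0 f" using polys_polyn[OF *] True by simp
  then show ?thesis using polyn_dderiv_0[of f v] polys_0 by simp
next
  case False
  assume "f \<in> polys r"
  then have "polyn (nat r - 1) (dderiv v f)" using polyn_dderiv polys_polyn by blast
  then show ?thesis using False by (auto simp: polys_eq nat_diff_distrib)
qed

lemma polys_mono: "r \<le> s \<Longrightarrow> polys r \<subseteq> polys s"
  unfolding polys_eq by (auto intro: polyn.const polyn_mono nat_mono)

lemma polys_diff: "f \<in> polys r \<Longrightarrow> g \<in> polys r \<Longrightarrow> (\<lambda>y. f y - g y) \<in> polys r"
  using polys_add[OF _ polys_cmult[of g r "-1"]] by fastforce

lemma polys_inner_mult: "f \<in> polys r \<Longrightarrow> (\<lambda>y. (y - z) $ k * f y) \<in> polys (r + 1)"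
  using polys_diff[OF polys_nth_mult[of f r k] subsetD[OF polys_mono polys_cmult[of f r "z $ k"]]]
  by (simp add: left_diff_distrib)

lemma polys_euler_solve:
  assumes "f \<in> polys r" "s > (0::nat)"
  shows "\<exists>g\<in>polys r. \<forall>y. dderiv (y - z) g y + s * g y = f y"
proof (cases "r < 0")
  case True
  then show ?thesis using assms by (auto simp: polys_eq)
next
  case False
  then show ?thesis using euler_solve[of "nat r" f s z] assms by (auto simp: polys_eq)
qed

section \<open>Curl and divergence of polynomial fields\<close>

definition div_classical :: "(real^3 \<Rightarrow> real^3) \<Rightarrow> real^3 \<Rightarrow> real" where
  "div_classical u y = (\<Sum>k\<in>UNIV. partial k (\<lambda>w. u w $ k) y)"

lemma cube_polysD: "u \<in> cube (polys r) \<Longrightarrow> (\<lambda>y. u y $ k) \<in> polys r"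
  by (simp add: cube_def)

lemma polys_differentiable: "f \<in> polys r \<Longrightarrow> f differentiable (at y)"
  using polyn_differentiable polys_polyn by blast

lemma polys_partial: "f \<in> polys r \<Longrightarrow> partial k f \<in> polys (r - 1)"
  by (simp add: partial_eq_dderiv polys_dderiv)

lemma partial_commute: "f \<in> polys r \<Longrightarrow> partial i (partial j f) y = partial j (partial i f) y"
  by (simp add: partial_eq_dderiv dderiv_commute[OF polys_polyn])

lemma curl_classical_nth:
  "curl_classical u y $ 1 = partial 2 (\<lambda>w. u w $ 3) y - partial 3 (\<lambda>w. u w $ 2) y"
  "curl_classical u y $ 2 = partial 3 (\<lambda>w. u w $ 1) y - partial 1 (\<lambda>w. u w $ 3) y"
  "curl_classical u y $ 3 = partial 1 (\<lambda>w. u w $ 2) y - partial 2 (\<lambda>w. u w $ 1) y"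
  by (simp_all add: curl_classical_def)

lemma curl_classical_polys: "u \<in> cube (polys r) \<Longrightarrow> curl_classical u \<in> cube (polys (r - 1))"
proof -
  assume u: "u \<in> cube (polys r)"
  have "(\<lambda>y. curl_classical u y $ k) \<in> polys (r - 1)" for k
    using exhaust_3[of k] polys_partial[OF cube_polysD[OF u]]
    by (auto simp: curl_classical_nth intro!: polys_diff)
  then show ?thesis by (simp add: cube_def)
qed

lemma div_classical_polys: "u \<in> cube (polys r) \<Longrightarrow> div_classical u \<in> polys (r - 1)"
proof -
  assume u: "u \<in> cube (polys r)"
  have "(\<lambda>y. \<Sum>k\<in>UNIV. partial k (\<lambda>w. u w $ k) y) \<in> polys (r - 1)"
    using polys_partial[OF cube_polysD[OF u]] by (intro polys_sum)
  then show ?thesis by (simp add: div_classical_def[abs_def])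
qed

lemma div_classical_curl: "u \<in> cube (polys r) \<Longrightarrow> div_classical (curl_classical u) y = 0"
proof -
  assume u: "u \<in> cube (polys r)"
  have p: "partial i (\<lambda>w. partial j (\<lambda>w. u w $ k) w - partial j' (\<lambda>w. u w $ k') w) y
    = partial i (partial j (\<lambda>w. u w $ k)) y - partial i (partial j' (\<lambda>w. u w $ k')) y" for i j k j' k'
    unfolding partial_eq_dderiv[of i]
    by (intro dderiv_diff polys_differentiable[OF polys_partial[OF cube_polysD[OF u]]])
  have c: "partial i (partial j (\<lambda>w. u w $ k)) y = partial j (partial i (\<lambda>w. u w $ k)) y" for i j k
    by (rule partial_commute[OF cube_polysD[OF u]])
  show ?thesis
    using c[of 1 2 3] c[of 1 3 2] c[of 2 3 1] by (simp add: div_classical_def sum_3 curl_classical_nth p)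
qed

lemma curl_grad: "f \<in> polys r \<Longrightarrow> (\<And>y k. u y $ k = partial k f y) \<Longrightarrow> curl_classical u y = 0"
  by (simp add: vec_eq_iff forall_3 curl_classical_nth partial_commute[of f r])

text \<open>Directional derivatives lower the degree of homogeneity by one, which shifts the parameter of
  the Euler equation.\<close>
lemma euler_dderiv:
  fixes g :: "real^'n \<Rightarrow> real"
  assumes "polyn m g" and "\<And>y. dderiv (y - z) g y + real s * g y = f y"
  shows "dderiv (y - z) (dderiv v g) y + real (Suc s) * dderiv v g y = dderiv v f y"
proof -
  have d: "g differentiable (at y)" "dderiv w g differentiable (at y)" for w y
    using assms polyn_differentiable polyn_dderiv' by blast+
  have n: "(\<lambda>y. (y - z) $ k) differentiable (at y)" for k y
    using polyn_differentiable[OF polyn_nth(1)] by blast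
  have dn: "dderiv v (\<lambda>y. (y - z) $ k) y = v $ k" for k y
    using dderiv_nth(2)[of v k "z $ k" y] by simp
  have f: "f = (\<lambda>y. (\<Sum>k\<in>UNIV. (y - z) $ k * dderiv (axis k 1) g y) + s * g y)"
  proof
    fix y
    show "f y = (\<Sum>k\<in>UNIV. (y - z) $ k * dderiv (axis k 1) g y) + real s * g y"
      using assms(2)[of y] dderiv_dir_axis[OF d(1), of "y - z" y] by linarith
  qed
  have "dderiv v f y = (\<Sum>k\<in>UNIV. v $ k * dderiv (axis k 1) g y
      + (y - z) $ k * dderiv v (dderiv (axis k 1) g) y) + s * dderiv v g y"
  proof -
    have m: "(\<lambda>y. (y - z) $ k * dderiv (axis k 1) g y) differentiable (at y)" for k
      using d n by (intro differentiable_mult)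
    then have s: "(\<lambda>y. \<Sum>k\<in>UNIV. (y - z) $ k * dderiv (axis k 1) g y) differentiable (at y)"
      by (intro differentiable_sum) auto
    have "dderiv v (\<lambda>y. (y - z) $ k * dderiv (axis k 1) g y) y =
      v $ k * dderiv (axis k 1) g y + (y - z) $ k * dderiv v (dderiv (axis k 1) g) y" for k
      by (simp only: dderiv_mult[OF n d(2)] dn)
    then show ?thesis unfolding f
      using m s d by (simp only: dderiv_add[OF s differentiable_mult[OF differentiable_const d(1)]]
          dderiv_cmult[OF d(1)] dderiv_sum[OF m])
  qed
  also have "\<dots> = dderiv v g y + dderiv (y - z) (dderiv v g) y + s * dderiv v g y"
    using dderiv_dir_axis[OF d(1), of v] dderiv_dir_axis[OF d(2)[of v y], of "y - z"]
      dderiv_commute[OF assms(1), of v _ y]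
    by (simp add: sum.distrib)
  finally show ?thesis by (simp add: algebra_simps)
qed

section \<open>The fan of an Alfeld split\<close>

text \<open>The vectors \<open>v k\<close> point from the barycenter \<open>z\<close> to the vertices, and \<open>n k\<close> is the gradient of the
  barycentric coordinate of the vertex \<open>k\<close>. The index type \<open>4\<close> replaces the vertex numbers \<open>0, \<dots>, 3\<close>
  so that sums over all vertices are sums over a type and \<open>real^4\<close> can carry lifted coordinates.\<close>
locale alfeld_fan =
  fixes z :: "real^3" and v n :: "4 \<Rightarrow> real^3"
  assumes sum_v: "(\<Sum>k\<in>UNIV. v k) = 0" and sum_n: "(\<Sum>k\<in>UNIV. n k) = 0"
    and dual: "\<And>i j. n i \<bullet> v j = (if i = j then 1 else 0) - 1/4"
    and expand: "\<And>w. (\<Sum>j\<in>UNIV. (n j \<bullet> w) *\<^sub>R v j) = w"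
begin

definition lam :: "4 \<Rightarrow> real^3 \<Rightarrow> real" where "lam k y = 1/4 + n k \<bullet> (y - z)"

text \<open>The tetrahedra with numbers \<open>a\<close> and \<open>b\<close> meet in a part of the plane on which the two barycentric
  coordinates agree. Since polynomials that agree on a piece of a plane agree on the plane, this is the
  condition for a family of polynomials to be the restriction of one continuous function.\<close>
definition conforming :: "(4 \<Rightarrow> real^3 \<Rightarrow> 'b) \<Rightarrow> bool" where
  "conforming p \<longleftrightarrow> (\<forall>a b y. lam a y = lam b y \<longrightarrow> p a y = p b y)"

lemma conformingD: "conforming p \<Longrightarrow> lam a y = lam b y \<Longrightarrow> p a y = p b y"
  unfolding conforming_def by blast

lemma conforming_nth:
  fixes u :: "4 \<Rightarrow> real^3 \<Rightarrow> real^'n"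
  shows "conforming u \<Longrightarrow> conforming (\<lambda>i y. u i y $ k)"
  unfolding conforming_def by metis

lemma dual_diff: "(n a - n b) \<bullet> v k = (if k = a then 1 else 0) - (if k = b then 1 else 0)"
  by (auto simp: inner_diff_left dual)

lemma n_eq_iff: "n a = n b \<longleftrightarrow> a = b"
proof
  assume "n a = n b"
  then show "a = b" using dual_diff[of a b a] by (cases "a = b") simp_all
qed simp

lemma lam_eq_iff: "lam a y = lam b y \<longleftrightarrow> (n a - n b) \<bullet> (y - z) = 0"
  unfolding lam_def inner_diff_left by linarith

lemma lam_line: "lam a y = lam b y \<Longrightarrow> lam a (z + t *\<^sub>R (y - z)) = lam b (z + t *\<^sub>R (y - z))"
  by (simp add: lam_eq_iff)

subsection \<open>Potentials\<close>

text \<open>For \<open>a = b\<close> the plane is the whole space.\<close>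
lemma euler_zero_on_plane:
  assumes "polyn m d" "s > (0::nat)" "lam a y = lam b y"
    and "\<And>y. lam a y = lam b y \<Longrightarrow> dderiv (y - z) d y + s * d y = 0"
  shows "d y = 0"
proof (rule euler_unique[OF assms(1,2), of y z])
  fix t show "dderiv (t *\<^sub>R (y - z)) d (z + t *\<^sub>R (y - z)) + real s * d (z + t *\<^sub>R (y - z)) = 0"
    using assms(4)[OF lam_line[OF assms(3), of t]] by simp
qed

lemma euler_conforming:
  assumes "\<And>k. g k \<in> polys r" "s > (0::nat)" "conforming f"
    and "\<And>k y. dderiv (y - z) (g k) y + s * g k y = f k y"
  shows "conforming g"
  unfolding conforming_def
proof (intro allI impI)
  fix a b y assume y: "lam a y = lam b y"
  have d: "g k differentiable (at y)" for k y using assms polys_differentiable by blast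
  have "(\<lambda>y. g a y - g b y) y = 0"
  proof (rule euler_zero_on_plane[OF _ assms(2) y])
    show "polyn (nat r) (\<lambda>y. g a y - g b y)" using assms by (intro polyn_diff polys_polyn)
    fix y assume e: "lam a y = lam b y"
    show "dderiv (y - z) (\<lambda>y. g a y - g b y) y + real s * (g a y - g b y) = 0"
      unfolding dderiv_diff[OF d d] right_diff_distrib
      using conformingD[OF assms(3) e] assms(4)[of y a] assms(4)[of y b] by linarith
  qed
  then show "g a y = g b y" by simp
qed

text \<open>Poincare homotopy with centre \<open>z\<close>: with \<open>g\<close> solving the Euler equation for \<open>s = 1\<close>, the potential is
  \<open>(y - z) \<bullet> g\<close>. The derivatives of a curl-free \<open>om\<close> are symmetric, hence so are those of \<open>g\<close>, and the
  gradient of the potential becomes the left side of the Euler equation. Rays from \<open>z\<close> stay in one cell, so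
  conformity survives.\<close>
lemma grad_potential:
  assumes om: "\<And>k. om k \<in> cube (polys r)" "\<And>k y. curl_classical (om k) y = 0" "conforming om"
  shows "\<exists>ph. (\<forall>k. ph k \<in> polys (r + 1)) \<and> conforming ph \<and> (\<forall>k j y. partial j (ph k) y = om k y $ j)"
proof -
  have "\<exists>g\<in>polys r. \<forall>y. dderiv (y - z) g y + real 1 * g y = om k y $ j" for k j
    using polys_euler_solve[OF cube_polysD[OF om(1)], of 1] by simp
  then obtain g where g: "\<And>k j. g k j \<in> polys r"
    "\<And>k j y. dderiv (y - z) (g k j) y + real 1 * g k j y = om k y $ j" by metis
  have d: "g k j differentiable (at y)" for k j y using g polys_differentiable by blast
  have cg: "conforming (\<lambda>k. g k j)" for j
    by (rule euler_conforming[OF g(1) _ conforming_nth[OF om(3)] g(2)]) simp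
  have curlfree: "dderiv (axis i 1) (\<lambda>y. om k y $ j) y = dderiv (axis j 1) (\<lambda>y. om k y $ i) y" for i j k y
  proof -
    have "partial i (\<lambda>y. om k y $ j) y = partial j (\<lambda>y. om k y $ i) y"
      using om(2)[of k y] exhaust_3[of i] exhaust_3[of j]
      by (auto simp: vec_eq_iff forall_3 curl_classical_nth)
    then show ?thesis by (simp add: partial_eq_dderiv)
  qed
  have sym: "dderiv (axis i 1) (g k j) y = dderiv (axis j 1) (g k i) y" for i j k y
  proof -
    have p: "polyn (nat r) (dderiv w (g k j))" for w j
      using g(1)[of k j] polys_polyn polyn_dderiv' by blast
    have "(\<lambda>y. dderiv (axis i 1) (g k j) y - dderiv (axis j 1) (g k i) y) y = 0"
    proof (rule euler_zero_on_plane[where s=2 and a=1 and b=1])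
      show "polyn (nat r) (\<lambda>y. dderiv (axis i 1) (g k j) y - dderiv (axis j 1) (g k i) y)"
        using p by (intro polyn_diff)
      fix y
      have dd: "dderiv w (g k j) differentiable (at y)" for w j using p polyn_differentiable by blast
      show "dderiv (y - z) (\<lambda>y. dderiv (axis i 1) (g k j) y - dderiv (axis j 1) (g k i) y) y
        + real 2 * (dderiv (axis i 1) (g k j) y - dderiv (axis j 1) (g k i) y) = 0"
        using euler_dderiv[OF polys_polyn[OF g(1)] g(2), where v="axis i 1" and y=y]
          euler_dderiv[OF polys_polyn[OF g(1)] g(2), where v="axis j 1" and y=y]
          curlfree[of i k j y]
        by (simp add: dderiv_diff dd algebra_simps)
    qed auto
    then show ?thesis by simp
  qed
  define ph where "ph = (\<lambda>k y. \<Sum>j\<in>UNIV. (y - z) $ j * g k j y)"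
  have "ph k \<in> polys (r + 1)" for k unfolding ph_def
    using g by (intro polys_sum polys_inner_mult)
  moreover have "conforming ph"
    using cg unfolding conforming_def ph_def by (intro allI impI sum.cong refl) metis
  moreover have "partial i (ph k) y = om k y $ i" for i k y
  proof -
    have n: "(\<lambda>y. (y - z) $ k) differentiable (at y)" for k y
      using polyn_differentiable[OF polyn_nth(1)] by blast
    have dn: "dderiv v (\<lambda>y. (y - z) $ k) y = v $ k" for k y v
      using dderiv_nth(2)[of v k "z $ k" y] by simp
    have "partial i (ph k) y = (\<Sum>j\<in>UNIV. axis i 1 $ j * g k j y + (y - z) $ j * dderiv (axis i 1) (g k j) y)"
      unfolding partial_eq_dderiv ph_def using d n dn
      by (simp only: dderiv_sum dderiv_mult differentiable_mult)
    also have "\<dots> = (\<Sum>j\<in>UNIV. (if j = i then g k j y else 0) + (y - z) $ j * dderiv (axis j 1) (g k i) y)"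
    proof (rule sum.cong)
      fix j
      have ax: "axis i (1::real) $ j = (if j = i then 1 else 0)" by (simp add: axis_def)
      show "axis i 1 $ j * g k j y + (y - z) $ j * dderiv (axis i 1) (g k j) y =
        (if j = i then g k j y else 0) + (y - z) $ j * dderiv (axis j 1) (g k i) y"
        unfolding ax sym[of i k j y] by simp
    qed simp
    also have "\<dots> = g k i y + dderiv (y - z) (g k i) y"
      by (simp add: sum.distrib dderiv_dir_axis[OF d, of "y - z"])
    finally show ?thesis unfolding g(2)[symmetric] by simp
  qed
  ultimately show ?thesis by blast
qed

text \<open>Poincare homotopy again: with \<open>g\<close> solving the Euler equation for \<open>s = 2\<close>, the potential is the cross
  product of \<open>g\<close> with \<open>y - z\<close>. If only the normal component of \<open>u\<close> is continuous, the jump of \<open>g\<close> on a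
  plane through \<open>z\<close> is tangential; its cross product with the tangential \<open>y - z\<close> is then normal, that is,
  the tangential part of the potential is continuous.\<close>
lemma curl_potential:
  assumes u: "\<And>k. u k \<in> cube (polys r)" "\<And>k y. div_classical (u k) y = 0"
    and jump: "\<And>a b y. lam a y = lam b y \<Longrightarrow> (n a - n b) \<bullet> (u a y - u b y) = 0"
  shows "\<exists>om. (\<forall>k. om k \<in> cube (polys (r + 1))) \<and> (conforming u \<longrightarrow> conforming om) \<and>
    (\<forall>k y. curl_classical (om k) y = u k y) \<and>
    (\<forall>a b y. lam a y = lam b y \<longrightarrow> (\<exists>c. om a y - om b y = c *\<^sub>R (n a - n b)))"
proof -
  have "\<exists>g\<in>polys r. \<forall>y. dderiv (y - z) g y + real 2 * g y = u k y $ j" for k j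
    using polys_euler_solve[OF cube_polysD[OF u(1)], of 2] by simp
  then obtain g where g: "\<And>k j. g k j \<in> polys r"
    "\<And>k j y. dderiv (y - z) (g k j) y + real 2 * g k j y = u k y $ j" by metis
  have d: "g k j differentiable (at y)" for k j y using g polys_differentiable by blast
  have pd: "polyn (nat r) (dderiv w (g k j))" for w j k
      using g(1)[of k j] polys_polyn polyn_dderiv' by blast
  have dd: "dderiv w (g k j) differentiable (at y)" for w j k y using pd polyn_differentiable by blast
  have divg: "(\<Sum>j\<in>UNIV. dderiv (axis j 1) (g k j) y) = 0" for k y
  proof -
    have "(\<lambda>y. \<Sum>j\<in>UNIV. dderiv (axis j 1) (g k j) y) y = 0"
    proof (rule euler_zero_on_plane[where s=3 and a=1 and b=1])
      show "polyn (nat r) (\<lambda>y. \<Sum>j\<in>UNIV. dderiv (axis j 1) (g k j) y)"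
        using pd by (intro polyn_sum)
      fix y
      have "(\<Sum>j\<in>UNIV. dderiv (y - z) (dderiv (axis j 1) (g k j)) y + real (Suc 2) * dderiv (axis j 1) (g k j) y)
        = (\<Sum>j\<in>UNIV. dderiv (axis j 1) (\<lambda>y. u k y $ j) y)"
        by (intro sum.cong refl euler_dderiv[OF polys_polyn[OF g(1)] g(2)])
      also have "\<dots> = 0" using u(2)[of k y] by (simp add: div_classical_def partial_eq_dderiv)
      finally show "dderiv (y - z) (\<lambda>y. \<Sum>j\<in>UNIV. dderiv (axis j 1) (g k j) y) y
        + real 3 * (\<Sum>j\<in>UNIV. dderiv (axis j 1) (g k j) y) = 0"
        using dd by (simp add: dderiv_sum sum.distrib sum_distrib_left)
    qed auto
    then show ?thesis by simp
  qed
  define om :: "4 \<Rightarrow> real^3 \<Rightarrow> real^3" where "om = (\<lambda>k y. vector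
    [(y - z) $ 3 * g k 2 y - (y - z) $ 2 * g k 3 y,
     (y - z) $ 1 * g k 3 y - (y - z) $ 3 * g k 1 y,
     (y - z) $ 2 * g k 1 y - (y - z) $ 1 * g k 2 y])"
  have om_nth: "om k y $ 1 = (y - z) $ 3 * g k 2 y - (y - z) $ 2 * g k 3 y"
    "om k y $ 2 = (y - z) $ 1 * g k 3 y - (y - z) $ 3 * g k 1 y"
    "om k y $ 3 = (y - z) $ 2 * g k 1 y - (y - z) $ 1 * g k 2 y" for k y
    by (simp_all add: om_def)
  have "(\<lambda>y. om k y $ i) \<in> polys (r + 1)" for k i
  proof -
    have "\<forall>i. (\<lambda>y. om k y $ i) \<in> polys (r + 1)"
      unfolding forall_3 om_nth using g by (intro conjI polys_diff polys_inner_mult)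
    then show ?thesis by blast
  qed
  then have "om k \<in> cube (polys (r + 1))" for k by (simp add: cube_def)
  moreover have "conforming om" if "conforming u"
  proof -
    have cg: "conforming (\<lambda>k. g k j)" for j
      by (rule euler_conforming[OF g(1) _ conforming_nth[OF that] g(2)]) simp
    have "g a j y = g b j y" if "lam a y = lam b y" for a b j y by (rule conformingD[OF cg that])
    then show ?thesis unfolding conforming_def vec_eq_iff forall_3 om_nth
      by (intro allI impI conjI arg_cong2[where f="(-)"] arg_cong2[where f="(*)"] refl) assumption+
  qed
  moreover have "curl_classical (om k) y = u k y" for k y
  proof -
    have n: "(\<lambda>y. (y - z) $ k) differentiable (at y)" for k y
      using polyn_differentiable[OF polyn_nth(1)] by blast
    have dn: "dderiv v (\<lambda>y. (y - z) $ k) y = v $ k" for k y v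
      using dderiv_nth(2)[of v k "z $ k" y] by simp
    have prod: "partial i (\<lambda>y. (y - z) $ a * g k b y - (y - z) $ c * g k e y) y =
      axis i 1 $ a * g k b y + (y - z) $ a * dderiv (axis i 1) (g k b) y
      - (axis i 1 $ c * g k e y + (y - z) $ c * dderiv (axis i 1) (g k e) y)" for i a b c e
      unfolding partial_eq_dderiv using n dn d by (simp only: dderiv_diff dderiv_mult differentiable_mult)
    have E: "u k y $ j = (y - z) $ 1 * dderiv (axis 1 1) (g k j) y + (y - z) $ 2 * dderiv (axis 2 1) (g k j) y
       + (y - z) $ 3 * dderiv (axis 3 1) (g k j) y + 2 * g k j y" for j
      unfolding g(2)[symmetric] by (subst dderiv_dir_axis[OF d]) (simp only: sum_3 of_nat_numeral)
    have D: "dderiv (axis 1 1) (g k 1) y + dderiv (axis 2 1) (g k 2) y + dderiv (axis 3 1) (g k 3) y = 0"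
      using divg[of k y] by (simp only: sum_3)
    have D1: "dderiv (axis 1 1) (g k 1) y = - dderiv (axis 2 1) (g k 2) y - dderiv (axis 3 1) (g k 3) y"
      using D by linarith
    have ax: "axis i (1::real) $ j = (if i = j then 1 else 0)" for i j :: 3 by (simp add: axis_def)
    show ?thesis
      unfolding vec_eq_iff forall_3 curl_classical_nth om_nth prod E D1 ax
      by (simp add: algebra_simps)
  qed
  moreover have "\<exists>c. om a y - om b y = c *\<^sub>R (n a - n b)" if y: "lam a y = lam b y" for a b y
  proof -
    define N where "N = n a - n b"
    define G :: "real^3 \<Rightarrow> real^3" where "G = (\<lambda>y. \<chi> j. g a j y - g b j y)"
    have "(\<lambda>y. \<Sum>j\<in>UNIV. N $ j * (g a j y - g b j y)) y = 0"
    proof (rule euler_zero_on_plane[OF _ _ y, where s=2])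
      show "polyn (nat r) (\<lambda>y. \<Sum>j\<in>UNIV. N $ j * (g a j y - g b j y))"
        using g by (intro polyn_sum polyn_cmult polyn_diff polys_polyn)
      fix y assume "lam a y = lam b y"
      then have "0 = N \<bullet> (u a y - u b y)" using jump unfolding N_def by simp
      also have "\<dots> = (\<Sum>j\<in>UNIV. N $ j * (u a y $ j - u b y $ j))" by (simp add: inner_vec_def)
      finally show "dderiv (y - z) (\<lambda>y. \<Sum>j\<in>UNIV. N $ j * (g a j y - g b j y)) y
         + real 2 * (\<Sum>j\<in>UNIV. N $ j * (g a j y - g b j y)) = 0"
        unfolding g(2)[symmetric] using d
        by (simp add: dderiv_sum dderiv_cmult dderiv_diff differentiable_diff sum_distrib_left sum.distrib[symmetric] algebra_simps)
    qed auto
    then have NG: "N \<bullet> G y = 0" by (simp add: G_def inner_vec_def)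
    have Nw: "N \<bullet> (y - z) = 0" using y by (simp add: N_def lam_eq_iff)
    have X: "om a y - om b y = cross3 (G y) (y - z)"
      unfolding vec_eq_iff forall_3 vector_minus_component om_nth G_def
      by (simp add: cross3_def algebra_simps)
    have "(N \<bullet> N) *\<^sub>R cross3 (G y) (y - z) = (N \<bullet> cross3 (G y) (y - z)) *\<^sub>R N"
      using NG Nw unfolding cross3_def inner_vec_def vec_eq_iff forall_3 sum_3
      by (simp add: inner_real_def) algebra
    then have "cross3 (G y) (y - z) = ((N \<bullet> cross3 (G y) (y - z)) / (N \<bullet> N)) *\<^sub>R N" if "N \<noteq> 0"
      using that by (metis (no_types, lifting) divide_inverse_commute inner_eq_zero_iff left_inverse scaleR_one scaleR_scaleR)
    moreover have "a = b" if "N = 0" using that n_eq_iff unfolding N_def by auto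
    ultimately show ?thesis unfolding X[symmetric] N_def
      by (cases "N = 0") (auto simp: N_def intro!: exI)
  qed
  ultimately show ?thesis by blast
qed


subsection \<open>Lifting to four variables\<close>

text \<open>Modulo \<open>(1, 1, 1, 1)\<close>, the coordinates with respect to the four vectors \<open>v j\<close> are determined by
  \<open>y - z\<close>; this is the representative whose \<open>i\<close>-th entry is zero. On the \<open>i\<close>-th cell all its entries are
  nonnegative, and on a common face the representatives of two cells coincide. Hence every polynomial in the
  lifted coordinates gives a conforming family.\<close>
definition lift :: "4 \<Rightarrow> real^3 \<Rightarrow> real^4" where
  "lift i y = (\<chi> j. (n j - n i) \<bullet> (y - z))"

definition unlift :: "real^4 \<Rightarrow> real^3" where "unlift b = (\<Sum>j\<in>UNIV. b $ j *\<^sub>R v j) + z"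

lemma lift_eq: "lam a y = lam b y \<Longrightarrow> lift a y = lift b y"
  unfolding lift_def lam_def inner_diff_left by simp

lemma lift_nth_0: "lam a y = lam b y \<Longrightarrow> lift a y $ b = 0"
  unfolding lift_def lam_def inner_diff_left by simp

lemma unlift_lift: "unlift (lift i y) = y"
proof -
  have "(\<Sum>j\<in>UNIV. lift i y $ j *\<^sub>R v j) = (\<Sum>j\<in>UNIV. (n j \<bullet> (y - z)) *\<^sub>R v j - (n i \<bullet> (y - z)) *\<^sub>R v j)"
    by (simp add: lift_def inner_diff_left scaleR_left_diff_distrib)
  also have "\<dots> = (y - z) - (n i \<bullet> (y - z)) *\<^sub>R (\<Sum>j\<in>UNIV. v j)"
    by (simp only: sum_subtractf expand scaleR_sum_right[symmetric])
  finally show ?thesis by (simp add: unlift_def sum_v)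
qed

lemma lift_eq_affine: "lift i y = (\<chi> j. (n j - n i) \<bullet> y) + (\<chi> j. - ((n j - n i) \<bullet> z))"
  by (simp add: lift_def vec_eq_iff inner_diff_right)

lemma bounded_linear_vec_lambda:
  fixes f :: "'m::finite \<Rightarrow> 'a::euclidean_space \<Rightarrow> real"
  assumes "\<And>j. bounded_linear (f j)"
  shows "bounded_linear (\<lambda>y. \<chi> j. f j y)"
proof -
  have "linear (\<lambda>y. \<chi> j. f j y)"
    using bounded_linear.linear[OF assms] by (auto intro!: linearI simp: vec_eq_iff linear_add linear_cmul)
  then show ?thesis by (simp add: linear_conv_bounded_linear)
qed

lemma bounded_linear_lift: "bounded_linear (\<lambda>y. \<chi> j. (n j - n i) \<bullet> y)"
  by (intro bounded_linear_vec_lambda bounded_linear_inner_right)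

lemma bounded_linear_unlift: "bounded_linear (\<lambda>b::real^4. \<Sum>j\<in>UNIV. b $ j *\<^sub>R v j)"
  by (intro bounded_linear_sum bounded_linear_compose[OF bounded_linear_scaleR_left bounded_linear_vec_nth])

lemma has_derivative_lift: "(lift i has_derivative (\<lambda>w. \<chi> j. (n j - n i) \<bullet> w)) (at y)"
  unfolding lift_eq_affine[abs_def]
  using has_derivative_add[OF bounded_linear_imp_has_derivative[OF bounded_linear_lift] has_derivative_const]
  by simp

lemma polyn_lift: "polyn m P \<Longrightarrow> polyn m (\<lambda>y. P (lift i y))"
  unfolding lift_eq_affine by (rule polyn_compose[OF _ bounded_linear_lift])

lemma polyn_unlift: "polyn m q \<Longrightarrow> polyn m (\<lambda>b. q (unlift b))"
  unfolding unlift_def by (rule polyn_compose[OF _ bounded_linear_unlift])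

lemma conforming_lift: "conforming (\<lambda>i y. P (lift i y))"
  unfolding conforming_def using lift_eq by metis

lemma dderiv_lift:
  "polyn m P \<Longrightarrow> dderiv w (\<lambda>y. P (lift i y)) y = dderiv (\<chi> j. (n j - n i) \<bullet> w) P (lift i y)"
  by (rule dderiv_compose[OF has_derivative_lift polyn_differentiable])

definition ones :: "real^4" where "ones = (\<chi> j. 1)"

lemma antiderivative_ones:
  assumes "polyn m f"
  shows "\<exists>F. polyn (Suc m) F \<and> (\<forall>b. dderiv ones F b = f b)"
proof -
  have l: "bounded_linear (\<lambda>b::real^4. b $ 1)" by (rule bounded_linear_vec_nth)
  obtain H where H: "polyn m H" "\<And>b. dderiv ones (\<lambda>b. b $ 1 ^ Suc 0 * H b) b = b $ 1 ^ 0 * f b"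
    using polyn_antiderivative[OF assms l, of ones 0] by (auto simp: ones_def)
  have "polyn (Suc m) (\<lambda>b. b $ 1 * H b)" using polyn.lin[OF l H(1)] .
  moreover have "dderiv ones (\<lambda>b. b $ 1 * H b) b = f b" for b using H(2)[of b] by simp
  ultimately show ?thesis by blast
qed

subsection \<open>Divergence is onto\<close>

text \<open>Each monomial other than 1 is divisible by some variable, and \<open>b_j f\<close> is the \<open>j\<close>-th
  partial derivative of a multiple of \<open>b_j^2\<close>. The square makes the correction invisible to first order on
  the hyperplane \<open>b_j = 0\<close>.\<close>
lemma sum_of_partials:
  assumes "polyn m G"
  shows "\<exists>c h. (\<forall>j. polyn (Suc m) (\<lambda>b. b $ j * (b $ j * h j b)) \<and> polyn m (h j)) \<and>
    (\<forall>b::real^4. G b = c + (\<Sum>j\<in>UNIV. dderiv (axis j 1) (\<lambda>b. b $ j * (b $ j * h j b)) b))"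
  using assms
proof (induction rule: polyn.induct)
  case (const m c)
  show ?case by (intro exI[of _ c] exI[of _ "\<lambda>_ _. 0"]) (auto intro: polyn.const)
next
  case (lin l m f)
  have bl: "bounded_linear (\<lambda>b::real^4. b $ j)" for j by (rule bounded_linear_vec_nth)
  have "\<forall>j. \<exists>H. polyn m H \<and> (\<forall>b. dderiv (axis j 1) (\<lambda>b. b $ j ^ Suc 1 * H b) b = b $ j ^ 1 * f b)"
    by (intro allI polyn_antiderivative[OF lin.hyps(2) bl]) simp
  from choice[OF this] obtain H where H: "\<And>j. polyn m (H j)"
    "\<And>j b. dderiv (axis j 1) (\<lambda>b. b $ j ^ Suc 1 * H j b) b = b $ j ^ 1 * f b" by blast
  have H2: "dderiv (axis j 1) (\<lambda>b. b $ j * (b $ j * H j b)) b = b $ j * f b" for j b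
    using H(2)[of j b] by (simp add: mult.assoc)
  define h where "h = (\<lambda>j b. l (axis j 1) * H j b)"
  have ph: "polyn m (h j)" for j unfolding h_def by (intro polyn_cmult H)
  have pH: "polyn (Suc (Suc m)) (\<lambda>b. b $ j * (b $ j * H j b))" for j
    by (intro polyn.lin bl H)
  have p: "polyn (Suc (Suc m)) (\<lambda>b. b $ j * (b $ j * h j b))" for j
    by (intro polyn.lin bl ph)
  have hd: "dderiv (axis j 1) (\<lambda>b. b $ j * (b $ j * h j b)) b = l (axis j 1) * (b $ j * f b)" for j b
  proof -
    have eq: "(\<lambda>b. b $ j * (b $ j * h j b)) = (\<lambda>b. l (axis j 1) * (b $ j * (b $ j * H j b)))"
      by (simp add: h_def fun_eq_iff mult_ac)
    show ?thesis unfolding eq dderiv_cmult[OF polyn_differentiable[OF pH]] H2 ..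
  qed
  have lb: "l b = (\<Sum>j\<in>UNIV. l (axis j 1) * b $ j)" for b
  proof -
    have "l b = l (\<Sum>k\<in>UNIV. b $ k *\<^sub>R axis k 1)"
      using basis_expansion[of b] by (simp add: scalar_mult_eq_scaleR)
    then show ?thesis using bounded_linear.linear[OF lin(1)] by (simp add: linear_sum linear_cmul mult_ac)
  qed
  have "l b * f b = 0 + (\<Sum>j\<in>UNIV. dderiv (axis j 1) (\<lambda>b. b $ j * (b $ j * h j b)) b)" for b
    unfolding hd lb[of b] by (simp add: sum_distrib_right mult.assoc)
  then show ?case using p polyn_Suc[OF ph]
    by (intro exI[of _ 0] exI[of _ h] conjI allI)
next
  case (add m f g)
  obtain c h where h: "\<And>j. polyn (Suc m) (\<lambda>b. b $ j * (b $ j * h j b))" "\<And>j. polyn m (h j)"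
    "\<And>b::real^4. f b = c + (\<Sum>j\<in>UNIV. dderiv (axis j 1) (\<lambda>b. b $ j * (b $ j * h j b)) b)"
    using add.IH(1) by blast
  obtain c' h' where h': "\<And>j. polyn (Suc m) (\<lambda>b. b $ j * (b $ j * h' j b))" "\<And>j. polyn m (h' j)"
    "\<And>b::real^4. g b = c' + (\<Sum>j\<in>UNIV. dderiv (axis j 1) (\<lambda>b. b $ j * (b $ j * h' j b)) b)"
    using add.IH(2) by blast
  have eq: "(\<lambda>b. b $ j * (b $ j * (h j b + h' j b))) =
    (\<lambda>b. b $ j * (b $ j * h j b) + b $ j * (b $ j * h' j b))" for j
    by (simp add: fun_eq_iff algebra_simps)
  show ?case
  proof (intro exI[of _ "c + c'"] exI[of _ "\<lambda>j b. h j b + h' j b"] conjI allI)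
    fix j show "polyn (Suc m) (\<lambda>b. b $ j * (b $ j * (h j b + h' j b)))"
      unfolding eq by (intro polyn.add h h')
    show "polyn m (\<lambda>b. h j b + h' j b)" by (intro polyn.add h h')
  next
    fix b
    have "dderiv (axis j 1) (\<lambda>b. b $ j * (b $ j * (h j b + h' j b))) b =
      dderiv (axis j 1) (\<lambda>b. b $ j * (b $ j * h j b)) b + dderiv (axis j 1) (\<lambda>b. b $ j * (b $ j * h' j b)) b" for j
      unfolding eq by (rule dderiv_add[OF polyn_differentiable[OF h(1)] polyn_differentiable[OF h'(1)]])
    then show "f b + g b = c + c' + (\<Sum>j\<in>UNIV. dderiv (axis j 1) (\<lambda>b. b $ j * (b $ j * (h j b + h' j b))) b)"
      unfolding h(3) h'(3) by (simp add: sum.distrib)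
  qed
qed

text \<open>The \<open>i\<close>-th lift maps \<open>v j\<close> to the \<open>j\<close>-th unit vector for \<open>j \<noteq> i\<close>, and \<open>v i\<close> to minus the sum of the others.
  Written with the derivative in the direction \<open>ones\<close>, the two cases merge into one formula.\<close>
lemma div_classical_lift:
  assumes f: "\<And>j. polyn m (f j)"
  shows "div_classical (\<lambda>y. \<Sum>j\<in>UNIV. f j (lift i y) *\<^sub>R v j) y =
    (\<Sum>j\<in>UNIV. dderiv (axis j 1) (f j) (lift i y)) - dderiv ones (f i) (lift i y)"
proof -
  have d: "(\<lambda>y. f j (lift i y)) differentiable (at y)" for j y
    by (rule polyn_differentiable[OF polyn_lift[OF f]])
  have dir: "(\<chi> k. (n k - n i) \<bullet> v j) = (if j = i then axis j 1 - ones else axis j 1)" for j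
    by (auto simp: vec_eq_iff dual_diff ones_def axis_def)
  have "div_classical (\<lambda>y. \<Sum>j\<in>UNIV. f j (lift i y) *\<^sub>R v j) y =
    (\<Sum>k\<in>UNIV. dderiv (axis k 1) (\<lambda>y. \<Sum>j\<in>UNIV. v j $ k * f j (lift i y)) y)"
    by (simp add: div_classical_def partial_eq_dderiv mult.commute)
  also have "\<dots> = (\<Sum>k\<in>UNIV. \<Sum>j\<in>UNIV. v j $ k * dderiv (axis k 1) (\<lambda>y. f j (lift i y)) y)"
    using d by (subst dderiv_sum) (auto intro!: sum.cong dderiv_cmult)
  also have "\<dots> = (\<Sum>j\<in>UNIV. dderiv (v j) (\<lambda>y. f j (lift i y)) y)"
    by (subst sum.swap) (simp add: dderiv_dir_axis[OF d, of "v _", symmetric])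
  also have "\<dots> = (\<Sum>j\<in>UNIV. dderiv (axis j 1) (f j) (lift i y) - (if j = i then dderiv ones (f i) (lift i y) else 0))"
    by (rule sum.cong)
       (auto simp: dderiv_lift[OF f] dir dderiv_dir_diff[OF polyn_differentiable[OF f]])
  finally show ?thesis by (simp add: sum_subtractf)
qed

text \<open>By \<open>div_classical_lift\<close> one needs polynomials \<open>f j\<close> on \<open>real^4\<close> such that the sum of the \<open>j\<close>-th
  partials of \<open>f j\<close> minus the derivative of \<open>f i\<close> along \<open>ones\<close> equals \<open>q i\<close> where \<open>b_i = 0\<close>. The choice
  \<open>f i = - F i\<close> with \<open>F i\<close> an antiderivative of \<open>q i\<close> along \<open>ones\<close> produces \<open>q i\<close> and an error that is the
  same polynomial for all cells. By \<open>sum_of_partials\<close> that error is removed by terms vanishing to second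
  order on \<open>b_i = 0\<close>, up to a constant, which multiples of the coordinates \<open>b_j\<close> absorb.\<close>
lemma div_onto:
  assumes q: "\<And>k. q k \<in> polys r"
  shows "\<exists>u. (\<forall>k. u k \<in> cube (polys (r + 1))) \<and> conforming u \<and> (\<forall>k y. div_classical (u k) y = q k y)"
proof (cases "r < 0")
  case True
  then have "q k = (\<lambda>_. 0)" for k using q[of k] by (simp add: polys_eq)
  moreover have "conforming (\<lambda>k y. 0 :: real^3)" by (simp add: conforming_def)
  ultimately show ?thesis
    by (intro exI[of _ "\<lambda>k y. 0"]) (simp add: cube_def polys_0 div_classical_def partial_eq_dderiv)
next
  case False
  define m where "m = nat r"
  have pq: "polyn m (q k)" for k unfolding m_def by (rule polys_polyn[OF q])
  have "\<exists>F. polyn (Suc m) F \<and> (\<forall>b. dderiv ones F b = q i (unlift b))" for i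
    by (rule antiderivative_ones[OF polyn_unlift[OF pq]])
  then obtain F where F: "\<And>i. polyn (Suc m) (F i)" "\<And>i b. dderiv ones (F i) b = q i (unlift b)" by metis
  define G where "G = (\<lambda>b. \<Sum>j\<in>UNIV. dderiv (axis j 1) (F j) b)"
  have "polyn m G" unfolding G_def using polyn_dderiv[OF F(1)] by (intro polyn_sum) simp
  from sum_of_partials[OF this] obtain c h where
    h: "\<And>j. polyn (Suc m) (\<lambda>b. b $ j * (b $ j * h j b))" "\<And>j. polyn m (h j)"
    and G: "\<And>b. G b = c + (\<Sum>j\<in>UNIV. dderiv (axis j 1) (\<lambda>b. b $ j * (b $ j * h j b)) b)"
    by blast
  \<comment> \<open>The fields \<open>b_j\<close> contribute 4 to the sum of partials and 1 to the derivative along \<open>ones\<close>, so a third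
    of the constant \<open>c\<close> is needed.\<close>
  define f where "f = (\<lambda>j b. (b $ j * (b $ j * h j b) - F j b) + c/3 * (b $ j :: real))"
  have bl: "polyn (Suc m) (\<lambda>b::real^4. b $ j)" for j using polyn_nth(2) polyn_mono by fastforce
  have pf: "polyn (Suc m) (f j)" for j
    unfolding f_def by (intro polyn.add polyn_diff polyn_cmult h F bl)
  have df: "dderiv w (f j) b = dderiv w (\<lambda>b. b $ j * (b $ j * h j b)) b - dderiv w (F j) b + c/3 * w $ j" for w j b
    unfolding f_def using polyn_differentiable[OF h(1)] polyn_differentiable[OF F(1)] polyn_differentiable[OF bl]
    by (simp only: dderiv_add dderiv_diff dderiv_cmult dderiv_nth differentiable_diff differentiable_mult
        differentiable_const)
  have D0: "dderiv ones (\<lambda>b. b $ j * (b $ j * h j b)) b = 0" if "b $ j = 0" for j b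
  proof -
    have d: "(\<lambda>b::real^4. b $ j) differentiable (at b)" "h j differentiable (at b)"
      by (rule polyn_differentiable[OF polyn_nth(2)], rule polyn_differentiable[OF h(2)])
    show ?thesis
      unfolding dderiv_mult[OF d(1) differentiable_mult[OF d]] dderiv_mult[OF d] using that by simp
  qed
  define u where "u = (\<lambda>i y. \<Sum>j\<in>UNIV. f j (lift i y) *\<^sub>R v j)"
  have "u i \<in> cube (polys (r + 1))" for i
  proof -
    have "polyn (Suc m) (\<lambda>y. \<Sum>j\<in>UNIV. v j $ k * f j (lift i y))" for k
      by (intro polyn_sum polyn_cmult polyn_lift pf)
    then have "polyn (Suc m) (\<lambda>y. u i y $ k)" for k by (simp add: u_def mult.commute)
    moreover have "nat (r + 1) = Suc m" using False by (simp add: m_def)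
    ultimately show ?thesis using False by (simp add: cube_def polys_eq)
  qed
  moreover have "conforming u" unfolding u_def by (rule conforming_lift)
  moreover have "div_classical (u i) y = q i y" for i y
  proof -
    let ?b = "lift i y"
    have 0: "?b $ i = 0" by (rule lift_nth_0) simp
    have "div_classical (u i) y = (\<Sum>j\<in>UNIV. dderiv (axis j 1) (f j) ?b) - dderiv ones (f i) ?b"
      unfolding u_def by (rule div_classical_lift[OF pf])
    also have "(\<Sum>j\<in>UNIV. dderiv (axis j 1) (f j) ?b) = (G ?b - c) - G ?b + 4 * (c/3)"
    proof -
      have "(\<Sum>j\<in>UNIV. dderiv (axis j 1) (\<lambda>b. b $ j * (b $ j * h j b)) ?b) = G ?b - c"
        using G[of ?b] by simp
      moreover have "(\<Sum>j\<in>UNIV. dderiv (axis j 1) (F j) ?b) = G ?b" by (simp add: G_def)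
      ultimately show ?thesis unfolding df sum.distrib sum_subtractf by simp
    qed
    also have "dderiv ones (f i) ?b = - q i y + c/3"
      unfolding df D0[OF 0] F(2) unlift_lift by (simp add: ones_def)
    finally show ?thesis by simp
  qed
  ultimately show ?thesis by blast
qed

subsection \<open>From tangential to full continuity\<close>

text \<open>Inclusion and exclusion over the faces of the orthant in \<open>real^4\<close>: the data on the six
  two-dimensional faces agree on the common edges and at the origin.\<close>
lemma extend_from_faces:
  assumes J: "\<And>a b. polyn m (J a b)" and sym: "\<And>a b. J a b = J b a"
    and edge: "\<And>a b d y. a \<noteq> b \<Longrightarrow> b \<noteq> d \<Longrightarrow> a \<noteq> d \<Longrightarrow> lam a y = lam b y \<Longrightarrow> lam b y = lam d y \<Longrightarrow> J a b y = J a d y"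
  shows "\<exists>Q. polyn m Q \<and> (\<forall>a b y. a \<noteq> b \<longrightarrow> lam a y = lam b y \<longrightarrow> Q (lift a y) = J a b y)"
proof -
  \<comment> \<open>\<open>R b c d\<close> is the point on the face, or for \<open>c = d\<close> on the edge, in which all but the coordinates
    \<open>c\<close> and \<open>d\<close> of \<open>b\<close> are set to zero.\<close>
  define R :: "real^4 \<Rightarrow> 4 \<Rightarrow> 4 \<Rightarrow> real^3" where
    "R = (\<lambda>b c d. unlift (\<chi> j. if j = c \<or> j = d then b $ j else 0))"
  have pR: "polyn m (\<lambda>b. q (R b c d))" if "polyn m q" for q c d
  proof -
    have "bounded_linear (\<lambda>b::real^4. if j = c \<or> j = d then b $ j else 0)" for j
      by (cases "j = c \<or> j = d") (simp_all add: bounded_linear_vec_nth bounded_linear_zero)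
    then have bl: "bounded_linear (\<lambda>b::real^4. \<chi> j. if j = c \<or> j = d then b $ j else 0)"
      by (rule bounded_linear_vec_lambda)
    show ?thesis unfolding R_def using polyn_compose[OF polyn_unlift[OF that] bl, of 0] by simp
  qed
  have R_sym: "R b c d = R b d c" for b c d by (simp add: R_def disj_commute)
  have lamR: "lam a (R b c d) = lam a' (R b c d)" if "a \<noteq> c" "a \<noteq> d" "a' \<noteq> c" "a' \<noteq> d" for a a' b c d
  proof -
    have "(n a - n a') \<bullet> (R b c d - z) = (\<Sum>j\<in>UNIV. (if j = c \<or> j = d then b $ j else 0) * ((n a - n a') \<bullet> v j))"
      by (simp add: R_def unlift_def inner_sum_right)
    also have "\<dots> = 0" using that by (intro sum.neutral) (auto simp: dual_diff)
    finally show ?thesis by (simp add: lam_eq_iff)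
  qed
  have E: "J a b (R w c c) = J a d (R w c c)" if "a \<noteq> b" "b \<noteq> d" "a \<noteq> d" "a \<noteq> c" "b \<noteq> c" "d \<noteq> c" for a b c d w
    using that by (intro edge lamR) auto
  have V: "J a b z = J a d z" if "a \<noteq> b" "b \<noteq> d" "a \<noteq> d" for a b d
    using that by (intro edge) (auto simp: lam_def)
  \<comment> \<open>An edge lies on three faces and the origin on all six; the weights 1, -2 and 3 count each once. The face
    that carries the value on an edge may be chosen freely.\<close>
  define Q where "Q = (\<lambda>b. J 1 2 (R b 3 4) + J 1 3 (R b 2 4) + J 1 4 (R b 2 3) + J 2 3 (R b 1 4)
     + J 2 4 (R b 1 3) + J 3 4 (R b 1 2)
     - 2 * (J 2 3 (R b 1 1) + J 1 3 (R b 2 2) + J 1 2 (R b 3 3) + J 1 2 (R b 4 4)) + 3 * J 1 2 z)"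
  have "polyn m Q" unfolding Q_def
    by (intro polyn.add polyn_diff polyn_cmult pR J polyn.const)
  moreover have "Q (lift a y) = J a b y" if ab: "a \<noteq> b" and y: "lam a y = lam b y" for a b y
  proof -
    let ?w = "lift a y"
    have wa: "?w $ a = 0" by (rule lift_nth_0) simp
    have wb: "?w $ b = 0" by (rule lift_nth_0[OF y])
    have R1: "R w c d = R w c c" if "w $ d = 0" "c \<noteq> d" for w c d
      unfolding R_def using that by (intro arg_cong[of _ _ unlift]) (auto simp: vec_eq_iff)
    have R1': "R w c d = R w d d" if "w $ c = 0" "c \<noteq> d" for w c d
      unfolding R_def using that by (intro arg_cong[of _ _ unlift]) (auto simp: vec_eq_iff)
    have R0: "R w c c = z" if "w $ c = 0" for w c
      unfolding R_def unlift_def using that by (auto intro!: sum.neutral)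
    have full: "R ?w c d = y" if "{a, b, c, d} = UNIV" for c d
    proof -
      have "(\<chi> j. if j = c \<or> j = d then ?w $ j else 0) = ?w"
        using wa wb that by (auto simp: vec_eq_iff)
      then show ?thesis by (simp add: R_def unlift_lift)
    qed
    have U: "(UNIV :: 4 set) = {1,2,3,4}" by (rule UNIV_4)
    have ne: "(1::4) \<noteq> 2" "(1::4) \<noteq> 3" "(1::4) \<noteq> 4" "(2::4) \<noteq> 3" "(2::4) \<noteq> 4" "(3::4) \<noteq> 4"
      by simp_all
    have Es: "J 2 4 (R w 1 1) = J 2 3 (R w 1 1)" "J 3 4 (R w 1 1) = J 2 3 (R w 1 1)"
      "J 1 4 (R w 2 2) = J 1 3 (R w 2 2)" "J 3 4 (R w 2 2) = J 1 3 (R w 2 2)"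
      "J 1 4 (R w 3 3) = J 1 2 (R w 3 3)" "J 2 4 (R w 3 3) = J 1 2 (R w 3 3)"
      "J 1 3 (R w 4 4) = J 1 2 (R w 4 4)" "J 2 3 (R w 4 4) = J 1 2 (R w 4 4)" for w
      using E[of 2 4 3 1 w] E[of 3 4 2 1 w] E[of 1 4 3 2 w] E[of 3 4 1 2 w] E[of 1 4 2 3 w] E[of 2 4 1 3 w]
        E[of 1 3 2 4 w] E[of 2 3 1 4 w] sym[of 3 2] sym[of 3 1] sym[of 2 1] by simp_all
    have Vs: "J 1 3 z = J 1 2 z" "J 1 4 z = J 1 2 z" "J 2 3 z = J 1 2 z" "J 2 4 z = J 1 2 z" "J 3 4 z = J 1 2 z"
      using V[of 1 3 2] V[of 1 4 2] V[of 2 3 1] V[of 2 4 1] V[of 3 4 1] V[of 1 3 2] sym[of 2 1] sym[of 3 1]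
      by simp_all
    have cases: "(a = 1 \<and> b = 2 \<or> a = 2 \<and> b = 1) \<or> (a = 1 \<and> b = 3 \<or> a = 3 \<and> b = 1) \<or> (a = 1 \<and> b = 4 \<or> a = 4 \<and> b = 1)
      \<or> (a = 2 \<and> b = 3 \<or> a = 3 \<and> b = 2) \<or> (a = 2 \<and> b = 4 \<or> a = 4 \<and> b = 2) \<or> (a = 3 \<and> b = 4 \<or> a = 4 \<and> b = 3)"
      using ab exhaust_4[of a] exhaust_4[of b] by auto
    \<comment> \<open>With two coordinates zero, five of the six face terms collapse to edge and vertex terms, which cancel.\<close>
    have main: "Q ?w = J a' b' y" if W: "?w $ a' = 0" "?w $ b' = 0" "{a', b'} = {a, b}"
      "(a', b') \<in> {(1,2),(1,3),(1,4),(2,3),(2,4),(3,4)}" for a' b'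
    proof -
      have full': "R ?w c d = y" if "{a', b', c, d} = UNIV" for c d
        using full[of c d] that W(3) by auto
      consider "a' = 1" "b' = 2" | "a' = 1" "b' = 3" | "a' = 1" "b' = 4" | "a' = 2" "b' = 3" | "a' = 2" "b' = 4" | "a' = 3" "b' = 4"
        using W(4) by auto
      then show ?thesis
      proof cases
        case 1
        then have "?w $ 1 = 0" "?w $ 2 = 0" "R ?w 3 4 = y" using W(1,2) full'[of 3 4] U by auto
        then show ?thesis using 1 by (simp add: Q_def R1 R1' R0 Es Vs)
      next
        case 2
        then have "?w $ 1 = 0" "?w $ 3 = 0" "R ?w 2 4 = y" using W(1,2) full'[of 2 4] U by auto
        then show ?thesis using 2 by (simp add: Q_def R1 R1' R0 Es Vs)
      next
        case 3
        then have "?w $ 1 = 0" "?w $ 4 = 0" "R ?w 2 3 = y" using W(1,2) full'[of 2 3] U by auto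
        then show ?thesis using 3 by (simp add: Q_def R1 R1' R0 Es Vs)
      next
        case 4
        then have "?w $ 2 = 0" "?w $ 3 = 0" "R ?w 1 4 = y" using W(1,2) full'[of 1 4] U by auto
        then show ?thesis using 4 by (simp add: Q_def R1 R1' R0 Es Vs)
      next
        case 5
        then have "?w $ 2 = 0" "?w $ 4 = 0" "R ?w 1 3 = y" using W(1,2) full'[of 1 3] U by auto
        then show ?thesis using 5 by (simp add: Q_def R1 R1' R0 Es Vs)
      next
        case 6
        then have "?w $ 3 = 0" "?w $ 4 = 0" "R ?w 1 2 = y" using W(1,2) full'[of 1 2] U by auto
        then show ?thesis using 6 by (simp add: Q_def R1 R1' R0 Es Vs)
      qed
    qed
    show ?thesis
    proof (cases "(a, b) \<in> {(1,2),(1,3),(1,4),(2,3),(2,4),(3,4)}")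
      case True
      then show ?thesis using main[of a b] wa wb by blast
    next
      case False
      then have "(b, a) \<in> {(1,2),(1,3),(1,4),(2,3),(2,4),(3,4)}" using cases by auto
      then show ?thesis using main[of b a] wa wb sym[of a b] by (auto simp: insert_commute)
    qed
  qed
  ultimately show ?thesis by blast
qed

text \<open>A lifted polynomial \<open>P\<close> is continuous across the common plane of the cells \<open>a\<close> and \<open>b\<close>, and its
  gradient jumps there by \<open>n a - n b\<close> times minus the derivative of \<open>P\<close> along \<open>ones\<close>. So the given normal
  jumps \<open>J a b\<close> are cancelled once \<open>P\<close> is an antiderivative of an extension of all of them to \<open>real^4\<close>. The
  jumps fit together on an edge: the three jumps around it add up to zero, and testing this relation with
  the vector \<open>v a\<close> leaves only the two jumps that involve the cell \<open>a\<close>.\<close>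
lemma tangential_correction:
  assumes om: "\<And>k. om k \<in> cube (polys r)"
    and tang: "\<And>a b y. lam a y = lam b y \<Longrightarrow> \<exists>c. om a y - om b y = c *\<^sub>R (n a - n b)"
  shows "\<exists>ph. (\<forall>k. ph k \<in> polys (r + 1)) \<and> conforming (\<lambda>k y. \<chi> j. om k y $ j + partial j (ph k) y)"
proof (cases "r < 0")
  case True
  then have "om k y $ j = 0" for k y j
    using cube_polysD[OF om, of k j] by (auto simp: polys_eq fun_eq_iff)
  moreover have "conforming (\<lambda>k y. 0 :: real^3)" by (simp add: conforming_def)
  ultimately show ?thesis
    by (intro exI[of _ "\<lambda>k y. 0"]) (auto simp: polys_0 partial_eq_dderiv zero_vec_def)
next
  case False
  define m where "m = nat r"
  have pom: "polyn m (\<lambda>y. om k y $ j)" for k j unfolding m_def by (rule polys_polyn[OF cube_polysD[OF om]])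
  define J where "J = (\<lambda>a b y. inverse ((n a - n b) \<bullet> (n a - n b)) * ((n a - n b) \<bullet> (om a y - om b y)))"
  have pJ: "polyn m (J a b)" for a b
    unfolding J_def inner_vec_def[of _ "om _ _ - om _ _"] inner_real_def vector_minus_component[of "om _ _"]
    by (intro polyn_cmult polyn_sum polyn_diff pom)
  have J: "om a y - om b y = J a b y *\<^sub>R (n a - n b)" if ab: "lam a y = lam b y" for a b y
  proof -
    obtain c where c: "om a y - om b y = c *\<^sub>R (n a - n b)" using tang[OF ab] by blast
    show ?thesis
    proof (cases "n a - n b = 0")
      case True
      then show ?thesis using c by simp
    next
      case False
      then have "J a b y = c" unfolding J_def c by simp
      then show ?thesis using c by simp
    qed
  qed
  have symJ: "J a b = J b a" for a b
    unfolding J_def fun_eq_iff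
    by (simp add: inner_diff_left inner_diff_right algebra_simps inner_commute)
  have edgeJ: "J a b y = J a d y" if "a \<noteq> b" "b \<noteq> d" "a \<noteq> d" "lam a y = lam b y" "lam b y = lam d y" for a b d y
  proof -
    have "J a b y *\<^sub>R (n a - n b) + J b d y *\<^sub>R (n b - n d) = J a d y *\<^sub>R (n a - n d)"
      using that by (simp add: J[symmetric])
    then have "(J a b y *\<^sub>R (n a - n b) + J b d y *\<^sub>R (n b - n d)) \<bullet> v a = (J a d y *\<^sub>R (n a - n d)) \<bullet> v a" by simp
    then show ?thesis using that by (simp add: inner_add_left dual_diff)
  qed
  obtain Q where Q: "polyn m Q" "\<And>a b y. a \<noteq> b \<Longrightarrow> lam a y = lam b y \<Longrightarrow> Q (lift a y) = J a b y"
  proof -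
    have "\<exists>Q. polyn m Q \<and> (\<forall>a b y. a \<noteq> b \<longrightarrow> lam a y = lam b y \<longrightarrow> Q (lift a y) = J a b y)"
      by (rule extend_from_faces[OF pJ symJ]) (rule edgeJ, assumption+)
    then show ?thesis using that by blast
  qed
  obtain P where P: "polyn (Suc m) P" "\<And>b. dderiv ones P b = Q b" using antiderivative_ones[OF Q(1)] by blast
  define ph where "ph = (\<lambda>k y. P (lift k y))"
  have "ph k \<in> polys (r + 1)" for k
  proof -
    have "nat (r + 1) = Suc m" using False by (simp add: m_def)
    then show ?thesis using False polyn_lift[OF P(1)] by (simp add: polys_eq ph_def)
  qed
  moreover have "conforming (\<lambda>k y. \<chi> j. om k y $ j + partial j (ph k) y)"
    unfolding conforming_def
  proof (intro allI impI)
    fix a b y assume y: "lam a y = lam b y"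
    show "(\<chi> j. om a y $ j + partial j (ph a) y) = (\<chi> j. om b y $ j + partial j (ph b) y)"
    proof (cases "a = b")
      case ab: False
      have dP: "P differentiable (at b)" for b by (rule polyn_differentiable[OF P(1)])
      have "partial j (ph a) y - partial j (ph b) y = - ((n a - n b) $ j * J a b y)" for j
      proof -
        have "partial j (ph a) y - partial j (ph b) y =
          dderiv (\<chi> k. (n k - n a) \<bullet> axis j 1) P (lift a y) - dderiv (\<chi> k. (n k - n b) \<bullet> axis j 1) P (lift a y)"
          unfolding partial_eq_dderiv ph_def dderiv_lift[OF P(1)] lift_eq[OF y] ..
        also have "\<dots> = dderiv ((\<chi> k. (n k - n a) \<bullet> axis j 1) - (\<chi> k. (n k - n b) \<bullet> axis j 1)) P (lift a y)"
          by (rule dderiv_dir_diff[OF dP, symmetric])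
        also have "(\<chi> k. (n k - n a) \<bullet> axis j (1::real)) - (\<chi> k. (n k - n b) \<bullet> axis j 1) = (- ((n a - n b) $ j)) *\<^sub>R ones"
          by (simp add: vec_eq_iff ones_def inner_axis)
        finally show ?thesis unfolding dderiv_dir_scaleR[OF dP] P(2) Q(2)[OF ab y] by (simp add: algebra_simps)
      qed
      moreover have "om a y $ j - om b y $ j = (n a - n b) $ j * J a b y" for j
        using arg_cong[OF J[OF y], of "\<lambda>w. w $ j"] by (simp add: mult.commute)
      ultimately have "om a y $ j + partial j (ph a) y = om b y $ j + partial j (ph b) y" for j
        by (simp add: diff_eq_eq)
      then show ?thesis by simp
    qed simp
  qed
  ultimately show ?thesis by blast
qed

lemma continuous_curl_potential:
  assumes u: "\<And>k. u k \<in> cube (polys r)" "\<And>k y. div_classical (u k) y = 0"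
    and jump: "\<And>a b y. lam a y = lam b y \<Longrightarrow> (n a - n b) \<bullet> (u a y - u b y) = 0"
  shows "\<exists>om. (\<forall>k. om k \<in> cube (polys (r + 1))) \<and> conforming om \<and> (\<forall>k y. curl_classical (om k) y = u k y)"
proof -
  obtain om where om: "\<And>k. om k \<in> cube (polys (r + 1))" "\<And>k y. curl_classical (om k) y = u k y"
    "\<And>a b y. lam a y = lam b y \<Longrightarrow> \<exists>c. om a y - om b y = c *\<^sub>R (n a - n b)"
    using curl_potential[OF u jump] by blast
  obtain ph where ph: "\<And>k. ph k \<in> polys (r + 1 + 1)"
    "conforming (\<lambda>k y. \<chi> j. om k y $ j + partial j (ph k) y)"
    using tangential_correction[OF om(1,3)] by blast
  define w :: "4 \<Rightarrow> real^3 \<Rightarrow> real^3" where "w = (\<lambda>k y. \<chi> j. om k y $ j + partial j (ph k) y)"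
  have pp: "partial j (ph k) \<in> polys (r + 1)" for j k
    using polys_partial[OF ph(1), of j k] by (simp add: add.commute)
  have "w k \<in> cube (polys (r + 1))" for k
    unfolding cube_def w_def using polys_add[OF cube_polysD[OF om(1)] pp] by simp
  moreover have "curl_classical (w k) y = u k y" for k y
  proof -
    have p: "partial i (\<lambda>y. w k y $ j) y = partial i (\<lambda>y. om k y $ j) y + partial i (partial j (ph k)) y" for i j
      unfolding w_def partial_eq_dderiv[of i] vec_lambda_beta
      by (intro dderiv_add polys_differentiable[OF cube_polysD[OF om(1)]] polys_differentiable[OF pp])
    have c: "partial i (partial j (ph k)) y = partial j (partial i (ph k)) y" for i j
      by (rule partial_commute[OF ph(1)])
    show ?thesis unfolding om(2)[symmetric] vec_eq_iff forall_3 curl_classical_nth p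
      using c[of 1 2] c[of 1 3] c[of 2 3] by simp
  qed
  ultimately show ?thesis using ph(2) unfolding w_def[symmetric] by blast
qed

subsection \<open>Smoothness along interior edges\<close>

text \<open>The jump of the derivative of \<open>om\<close> across a plane is of the form \<open>w \<mapsto> (N \<bullet> w) q\<close> with \<open>N\<close> the normal,
  because tangential derivatives are continuous. Where the curl is continuous as well, \<open>q\<close> is parallel to
  \<open>N\<close>. Around an edge three such multiples of \<open>N N\<^sup>T\<close>, with pairwise independent normals, add up to zero,
  which forces all of them to vanish.\<close>
lemma C1_on_edge:
  assumes om: "\<And>k. om k \<in> cube (polys r)" "conforming om"
    and e: "lam a y = lam b y" "lam b y = lam d y" "a \<noteq> b" "b \<noteq> d" "a \<noteq> d"
    and curl: "curl_classical (om a) y = curl_classical (om b) y" "curl_classical (om b) y = curl_classical (om d) y"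
  shows "partial i (\<lambda>y. om a y $ j) y = partial i (\<lambda>y. om b y $ j) y"
proof -
  define A :: "4 \<Rightarrow> 3 \<Rightarrow> real^3 \<Rightarrow> real" where "A = (\<lambda>k j w. dderiv w (\<lambda>y. om k y $ j) y)"
  have d: "(\<lambda>y. om k y $ j) differentiable (at y)" for k j y by (rule polys_differentiable[OF cube_polysD[OF om(1)]])
  have lin: "linear (A k j)" for k j unfolding A_def by (rule linear_dderiv[OF d])
  \<comment> \<open>\<open>om k\<close> and \<open>om l\<close> agree along a line in the common plane, hence so do their derivatives.\<close>
  have tangent: "A k j w = A l j w" if kl: "lam k y = lam l y" and w: "(n k - n l) \<bullet> w = 0" for k l j w
  proof -
    have "om k (y + t *\<^sub>R w) $ j - om l (y + t *\<^sub>R w) $ j = 0" for t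
    proof -
      have "lam k (y + t *\<^sub>R w) = lam l (y + t *\<^sub>R w)"
        using kl w by (simp add: lam_def inner_diff_left inner_diff_right inner_add_right)
      then show ?thesis using conformingD[OF om(2)] by (metis diff_self)
    qed
    then have z: "(\<lambda>t. om k (y + t *\<^sub>R w) $ j - om l (y + t *\<^sub>R w) $ j) = (\<lambda>_. 0)" by auto
    have "((\<lambda>t. om k (y + t *\<^sub>R w) $ j) has_derivative (\<lambda>h. dderiv (h *\<^sub>R w) (\<lambda>y. om k y $ j) (y + 0 *\<^sub>R w))) (at 0)" for k
      by (rule has_derivative_compose[OF _ dderiv_works[OF d]]) (auto intro!: derivative_eq_intros)
    then have "((\<lambda>t. om k (y + t *\<^sub>R w) $ j - om l (y + t *\<^sub>R w) $ j) has_derivative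
        (\<lambda>h. dderiv (h *\<^sub>R w) (\<lambda>y. om k y $ j) (y + 0 *\<^sub>R w) - dderiv (h *\<^sub>R w) (\<lambda>y. om l y $ j) (y + 0 *\<^sub>R w))) (at 0)"
      by (intro has_derivative_diff)
    then have "(\<lambda>h. dderiv (h *\<^sub>R w) (\<lambda>y. om k y $ j) (y + 0 *\<^sub>R w) - dderiv (h *\<^sub>R w) (\<lambda>y. om l y $ j) (y + 0 *\<^sub>R w)) = (\<lambda>_. 0)"
      unfolding z by (rule has_derivative_unique) simp
    from fun_cong[OF this, of 1] show ?thesis by (simp add: A_def)
  qed
  have rank1: "\<exists>c. \<forall>j w. A k j w - A l j w = c * (n k - n l) $ j * ((n k - n l) \<bullet> w)"
    if kl: "lam k y = lam l y" "k \<noteq> l" and cu: "curl_classical (om k) y = curl_classical (om l) y" for k l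
  proof -
    define N where "N = n k - n l"
    define q where "q = (\<lambda>j. A k j (v k) - A l j (v k))"
    have Nv: "N \<bullet> v k = 1" using kl by (simp add: N_def dual_diff)
    have 1: "A k j w - A l j w = q j * (N \<bullet> w)" for j w
    proof -
      have "A k j (w - (N \<bullet> w) *\<^sub>R v k) = A l j (w - (N \<bullet> w) *\<^sub>R v k)"
        by (rule tangent[OF kl(1)]) (use Nv in \<open>simp add: N_def[symmetric] inner_diff_right\<close>)
      then show ?thesis using lin by (simp add: linear_diff linear_cmul q_def algebra_simps)
    qed
    have sym: "q j * N $ i = q i * N $ j" for i j
    proof -
      have "A k j (axis i 1) - A l j (axis i 1) = A k i (axis j 1) - A l i (axis j 1)"
        using cu exhaust_3[of i] exhaust_3[of j] unfolding A_def partial_eq_dderiv[symmetric]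
        by (auto simp: vec_eq_iff forall_3 curl_classical_nth partial_eq_dderiv)
      then show ?thesis unfolding 1 by (simp add: inner_axis)
    qed
    have "N \<noteq> 0" using Nv by auto
    then obtain i where i: "N $ i \<noteq> 0" by (auto simp: vec_eq_iff)
    have "q j = q i / N $ i * N $ j" for j using sym[of j i] i by (simp add: field_simps)
    then have "A k j w - A l j w = q i / N $ i * N $ j * (N \<bullet> w)" for j w unfolding 1[of j] by metis
    then show ?thesis unfolding N_def by blast
  qed
  obtain c1 where c1: "\<And>j w. A a j w - A b j w = c1 * (n a - n b) $ j * ((n a - n b) \<bullet> w)"
    using rank1[of a b] e curl by metis
  obtain c2 where c2: "\<And>j w. A b j w - A d j w = c2 * (n b - n d) $ j * ((n b - n d) \<bullet> w)"
    using rank1[of b d] e curl by metis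
  obtain c3 where c3: "\<And>j w. A a j w - A d j w = c3 * (n a - n d) $ j * ((n a - n d) \<bullet> w)"
    using rank1[of a d] e curl by metis
  \<comment> \<open>The jumps from \<open>a\<close> to \<open>b\<close> and from \<open>b\<close> to \<open>d\<close> add up to the jump from \<open>a\<close> to \<open>d\<close>;
    the vector \<open>v a\<close> is tangent to the plane between \<open>b\<close> and \<open>d\<close>.\<close>
  have s: "c1 *\<^sub>R (n a - n b) = c3 *\<^sub>R (n a - n d)"
    using c1[of _ "v a"] c2[of _ "v a"] c3[of _ "v a"] e(3-5)
    by (simp add: vec_eq_iff dual_diff)
  have "(c1 *\<^sub>R (n a - n b)) \<bullet> v b = (c3 *\<^sub>R (n a - n d)) \<bullet> v b" unfolding s ..
  then have "c1 = 0" using e(3-5) by (simp add: dual_diff)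
  then show ?thesis using c1[of j "axis i 1"] by (simp add: A_def partial_eq_dderiv)
qed

end

section \<open>Smooth bump functions\<close>

text \<open>\<open>flat_exp 0\<close> is the standard smooth function that is flat at the origin; the powers of \<open>1/t\<close> close
  the family under differentiation.\<close>
definition flat_exp :: "nat \<Rightarrow> real \<Rightarrow> real" where
  "flat_exp k t = (if t > 0 then exp (- inverse t) * inverse t ^ k else 0)"

lemma flat_exp_nonneg: "flat_exp k t \<ge> 0"
  by (simp add: flat_exp_def)

lemma flat_exp_pos: "t > 0 \<Longrightarrow> flat_exp k t > 0"
  by (simp add: flat_exp_def)

lemma flat_exp_eq_0: "t \<le> 0 \<Longrightarrow> flat_exp k t = 0"
  by (simp add: flat_exp_def)

lemma flat_exp_0_le_1: "flat_exp 0 t \<le> 1"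
  by (simp add: flat_exp_def)

lemma flat_exp_tendsto_0: "(flat_exp k \<longlongrightarrow> 0) (at 0)"
proof (rule filterlim_split_at)
  show "(flat_exp k \<longlongrightarrow> 0) (at_left 0)"
    by (rule tendsto_eventually) (auto simp: flat_exp_def eventually_at_filter)
  have "((\<lambda>t. inverse t ^ k / exp (inverse t)) \<longlongrightarrow> (0::real)) (at_right 0)"
    by (rule filterlim_compose[OF tendsto_power_div_exp_0 filterlim_inverse_at_top_right])
  then show "(flat_exp k \<longlongrightarrow> 0) (at_right 0)"
    by (rule Lim_transform_eventually)
       (auto simp: flat_exp_def eventually_at_filter exp_minus field_simps)
qed

lemma has_field_derivative_flat_exp:
  "(flat_exp k has_field_derivative flat_exp (k + 2) t - k * flat_exp (k + 1) t) (at t)"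
proof (cases t "0::real" rule: linorder_cases)
  case less
  have "((\<lambda>_. 0) has_field_derivative 0) (at t)" by simp
  then have "(flat_exp k has_field_derivative 0) (at t)"
    by (rule has_field_derivative_transform_within_open[where S="{..<0}"]) (use less in \<open>auto simp: flat_exp_def\<close>)
  then show ?thesis using less by (simp add: flat_exp_def)
next
  case equal
  have "(\<lambda>h. (flat_exp k (0 + h) - flat_exp k 0) / h) = flat_exp (k + 1)"
    by (auto simp: flat_exp_def fun_eq_iff field_simps)
  then have "(flat_exp k has_field_derivative 0) (at 0)"
    unfolding DERIV_def using flat_exp_tendsto_0[of "k + 1"] by simp
  then show ?thesis using equal by (simp add: flat_exp_def)
next
  case greater
  have e: "((\<lambda>t. exp (- inverse t)) has_field_derivative exp (- inverse t) * inverse t ^ 2) (at t)"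
    using greater by (auto intro!: derivative_eq_intros simp: power2_eq_square)
  have "(inverse has_field_derivative - (inverse t ^ 2)) (at t)"
    using greater by (auto intro!: derivative_eq_intros simp: power2_eq_square)
  from DERIV_power[OF this, of k]
  have p: "((\<lambda>t. inverse t ^ k) has_field_derivative k * (- (inverse t ^ 2) * inverse t ^ (k - 1))) (at t)"
    by simp
  have "((\<lambda>t. exp (- inverse t) * inverse t ^ k) has_field_derivative
     flat_exp (k + 2) t - k * flat_exp (k + 1) t) (at t)"
    by (rule DERIV_cong[OF DERIV_mult[OF e p]])
       (use greater in \<open>cases k; simp add: flat_exp_def power2_eq_square algebra_simps\<close>)
  then show ?thesis
    by (rule has_field_derivative_transform_within_open[where S="{0<..}"]) (use greater in \<open>auto simp: flat_exp_def\<close>)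
qed

text \<open>A class of functions that is closed under partial derivatives and consists of differentiable
  functions, hence of smooth ones; it contains all bump functions needed below.\<close>
inductive elem_smooth :: "(real^3 \<Rightarrow> real) \<Rightarrow> bool" where
  poly: "polyn m p \<Longrightarrow> elem_smooth p"
| flat_exp: "polyn m p \<Longrightarrow> elem_smooth (\<lambda>y. flat_exp k (p y))"
| add: "elem_smooth f \<Longrightarrow> elem_smooth g \<Longrightarrow> elem_smooth (\<lambda>y. f y + g y)"
| mult: "elem_smooth f \<Longrightarrow> elem_smooth g \<Longrightarrow> elem_smooth (\<lambda>y. f y * g y)"

lemma has_derivative_flat_exp_poly:
  assumes "polyn m p"
  shows "((\<lambda>y. flat_exp k (p y)) has_derivative
    (\<lambda>v. dderiv v p y * (flat_exp (k + 2) (p y) - k * flat_exp (k + 1) (p y)))) (at y)"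
  by (rule has_derivative_eq_rhs[OF has_derivative_compose[OF dderiv_works[OF polyn_differentiable[OF assms]]
      has_field_derivative_imp_has_derivative[OF has_field_derivative_flat_exp]]])
     (simp add: fun_eq_iff mult.commute)

lemma elem_smooth_differentiable: "elem_smooth f \<Longrightarrow> f differentiable (at y)"
proof (induction rule: elem_smooth.induct)
  case (flat_exp m p k)
  then show ?case using has_derivative_flat_exp_poly differentiableI by blast
qed (auto intro: polyn_differentiable)

lemma elem_smooth_dderiv: "elem_smooth f \<Longrightarrow> elem_smooth (dderiv v f)"
proof (induction rule: elem_smooth.induct)
  case (poly m p)
  then show ?case by (meson elem_smooth.poly polyn_dderiv)
next
  case (flat_exp m p k)
  have "dderiv v (\<lambda>y. flat_exp k (p y)) = (\<lambda>y. dderiv v p y * (flat_exp (k + 2) (p y) + (- real k) * flat_exp (k + 1) (p y)))"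
    using dderiv_eqI[OF has_derivative_flat_exp_poly[OF flat_exp]] by (simp add: fun_eq_iff)
  then show ?case using flat_exp
    by (simp only:) (intro elem_smooth.mult elem_smooth.add elem_smooth.flat_exp[of m] elem_smooth.poly[of m] polyn_dderiv' polyn.const)
next
  case (add f g)
  have "dderiv v (\<lambda>y. f y + g y) = (\<lambda>y. dderiv v f y + dderiv v g y)"
    using add by (simp add: fun_eq_iff dderiv_add elem_smooth_differentiable)
  then show ?case using add by (simp add: elem_smooth.add)
next
  case (mult f g)
  have "dderiv v (\<lambda>y. f y * g y) = (\<lambda>y. dderiv v f y * g y + f y * dderiv v g y)"
    using mult by (simp add: fun_eq_iff dderiv_mult elem_smooth_differentiable)
  then show ?case using mult by (simp add: elem_smooth.add elem_smooth.mult)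
qed

lemma elem_smooth_smooth: "elem_smooth f \<Longrightarrow> smooth f"
proof -
  assume f: "elem_smooth f"
  have "elem_smooth (foldr partial ks f)" for ks
    by (induction ks) (auto simp: f partial_eq_dderiv elem_smooth_dderiv)
  then show ?thesis unfolding smooth_def using elem_smooth_differentiable by blast
qed

section \<open>Test functions\<close>

lemma smooth_partial: "smooth f \<Longrightarrow> smooth (partial k f)"
  unfolding smooth_def
proof (intro allI)
  fix ks y assume a: "\<forall>ks y. foldr partial ks f differentiable (at y)"
  show "foldr partial ks (partial k f) differentiable (at y)"
    using a[rule_format, of "ks @ [k]" y] by simp
qed

lemma smooth_differentiable: "smooth f \<Longrightarrow> f differentiable (at y)"
  unfolding smooth_def by (metis foldr.simps(1) id_apply)

text \<open>Continuously differentiable with bounded support: the common setting for products of polynomials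
  and test functions.\<close>
definition C1c :: "(real^3 \<Rightarrow> real) \<Rightarrow> bool" where
  "C1c g \<longleftrightarrow> (\<forall>y. g differentiable (at y)) \<and> (\<forall>e. continuous_on UNIV (dderiv e g)) \<and>
     (\<exists>R. \<forall>y. R < norm y \<longrightarrow> g y = 0)"

lemma C1c_differentiable: "C1c g \<Longrightarrow> g differentiable (at y)"
  by (simp add: C1c_def)

lemma C1c_continuous: "C1c g \<Longrightarrow> continuous_on S g"
  by (meson C1c_def continuous_at_imp_continuous_on differentiable_imp_continuous_within)

lemma C1c_dderiv_continuous: "C1c g \<Longrightarrow> continuous_on S (dderiv e g)"
  unfolding C1c_def using continuous_on_subset by blast

lemma dderiv_eq_0_open:
  assumes "open S" "y \<in> S" "\<And>w. w \<in> S \<Longrightarrow> g w = 0"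
  shows "dderiv e g y = 0"
proof -
  have "((\<lambda>_. 0) has_derivative (\<lambda>_. 0)) (at y)" by simp
  then have "(g has_derivative (\<lambda>_. 0)) (at y)"
    by (rule has_derivative_transform_within_open[OF _ assms(1,2)]) (simp add: assms(3))
  from dderiv_eqI[OF this, of e] show ?thesis by simp
qed

lemma C1c_poly_mult: "polyn m p \<Longrightarrow> C1c g \<Longrightarrow> C1c (\<lambda>y. p y * g y)"
proof -
  assume p: "polyn m p" and g: "C1c g"
  have "dderiv e (\<lambda>y. p y * g y) = (\<lambda>y. dderiv e p y * g y + p y * dderiv e g y)" for e
    using p g by (simp add: fun_eq_iff dderiv_mult polyn_differentiable C1c_differentiable)
  moreover have "continuous_on UNIV (\<lambda>y. dderiv e p y * g y + p y * dderiv e g y)" for e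
    using p g by (intro continuous_intros polyn_continuous_on[OF polyn_dderiv'] polyn_continuous_on
        C1c_continuous C1c_dderiv_continuous)
  moreover have "(\<lambda>y. p y * g y) differentiable (at y)" for y
    using p g by (intro differentiable_mult polyn_differentiable C1c_differentiable)
  moreover obtain R where "\<And>y. R < norm y \<Longrightarrow> g y = 0" using g C1c_def by metis
  ultimately show ?thesis unfolding C1c_def by (metis mult_zero_right)
qed

lemma smooth_C1c:
  assumes "smooth g" "bounded {y. g y \<noteq> 0}"
  shows "C1c g"
proof -
  obtain R where R: "\<And>y. g y \<noteq> 0 \<Longrightarrow> norm y \<le> R" using assms(2) by (auto simp: bounded_iff)
  have d: "g differentiable (at y)" "partial k g differentiable (at y)" for k y
    using assms smooth_differentiable smooth_partial by blast+
  have "continuous_on UNIV (partial k g)" for k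
    by (simp add: continuous_at_imp_continuous_on d(2) differentiable_imp_continuous_within)
  then have "continuous_on UNIV (\<lambda>y. \<Sum>k\<in>UNIV. e $ k * partial k g y)" for e
    by (intro continuous_intros)
  moreover have "dderiv e g = (\<lambda>y. \<Sum>k\<in>UNIV. e $ k * partial k g y)" for e
    unfolding partial_eq_dderiv by (rule ext) (rule dderiv_dir_axis[OF d(1)])
  ultimately show ?thesis unfolding C1c_def using d(1) R by (metis leD)
qed

lemma test_C1c: "\<phi> \<in> test_functions S \<Longrightarrow> C1c \<phi>"
  unfolding test_functions_def
  by (rule smooth_C1c) (auto intro: bounded_subset[OF compact_imp_bounded closure_subset])

lemma test_vanish:
  assumes "\<phi> \<in> test_functions S" "y \<notin> interior S"
  shows "\<phi> y = 0" "dderiv e \<phi> y = 0"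
proof -
  have y: "y \<in> - closure {y. \<phi> y \<noteq> 0}" using assms by (auto simp: test_functions_def)
  have 0: "\<phi> w = 0" if "w \<in> - closure {y. \<phi> y \<noteq> 0}" for w
    using that closure_subset[of "{y. \<phi> y \<noteq> 0}"] by auto
  show "\<phi> y = 0" by (rule 0[OF y])
  show "dderiv e \<phi> y = 0" by (rule dderiv_eq_0_open[OF _ y 0]) auto
qed

lemma test_functions_mono: "interior S \<subseteq> interior T \<Longrightarrow> test_functions S \<subseteq> test_functions T"
  by (auto simp: test_functions_def)

lemma elem_smooth_test:
  assumes "elem_smooth g" "compact K" "K \<subseteq> interior S" "\<And>y. g y \<noteq> 0 \<Longrightarrow> y \<in> K"
  shows "g \<in> test_functions S"
proof -
  have c: "closure {y. g y \<noteq> 0} \<subseteq> K"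
    using assms by (intro closure_minimal) (auto intro: compact_imp_closed)
  then have "compact (closure {y. g y \<noteq> 0})"
    using assms(2) by (metis Int_absorb1 closed_closure compact_Int_closed)
  then show ?thesis using assms c elem_smooth_smooth by (auto simp: test_functions_def)
qed

section \<open>Integration by parts\<close>

text \<open>The integral of a difference quotient vanishes by translation invariance, and
  the Lipschitz bound in the direction \<open>e\<close> dominates the passage to the limit. Only the behaviour along
  \<open>e\<close> matters, so \<open>f\<close> may jump on surfaces that contain this direction.\<close>
lemma integral_directional_derivative:
  fixes f h :: "real^3 \<Rightarrow> real"
  assumes f: "integrable lborel f" and h: "h \<in> borel_measurable lebesgue"
    and lip: "\<And>y t. \<bar>f (y + t *\<^sub>R e) - f y\<bar> \<le> L * \<bar>t\<bar>"
    and supp: "\<And>y. R < norm y \<Longrightarrow> f y = 0"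
    and deriv: "AE y in lebesgue. (\<lambda>m. (f (y + inverse (real (Suc m)) *\<^sub>R e) - f y) * real (Suc m)) \<longlonglongrightarrow> h y"
  shows "integral\<^sup>L lebesgue h = 0"
proof -
  define D where "D = (\<lambda>m y. (f (y + inverse (real (Suc m)) *\<^sub>R e) - f y) * real (Suc m))"
  have fm [measurable]: "f \<in> borel_measurable borel" using f by auto
  have shift: "integrable lborel (\<lambda>y. f (y + c))" "(\<integral>y. f (y + c) \<partial>lborel) = integral\<^sup>L lborel f" for c
  proof -
    have "integrable (distr lborel borel ((+) c)) f" using f by (simp add: lborel_distr_plus)
    then have "integrable lborel (\<lambda>y. f (c + y))" by (rule integrable_distr[rotated]) auto
    then show "integrable lborel (\<lambda>y. f (y + c))" by (simp add: add.commute)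
    have "integral\<^sup>L (distr lborel borel ((+) c)) f = (\<integral>y. f (c + y) \<partial>lborel)"
      by (rule integral_distr) auto
    then show "(\<integral>y. f (y + c) \<partial>lborel) = integral\<^sup>L lborel f"
      by (simp add: lborel_distr_plus add.commute)
  qed
  have Dm [measurable]: "D m \<in> borel_measurable borel" for m unfolding D_def by measurable
  have D0: "integral\<^sup>L lebesgue (D m) = 0" for m
  proof -
    have "integral\<^sup>L lebesgue (D m) = integral\<^sup>L lborel (D m)"
      by (rule integral_completion) (auto intro: Dm)
    also have "\<dots> = 0" unfolding D_def using shift f by simp
    finally show ?thesis .
  qed
  define w :: "real^3 \<Rightarrow> real" where "w = (\<lambda>y. L * indicator (cball 0 (\<bar>R\<bar> + norm e)) y)"
  have "(\<lambda>m. integral\<^sup>L lebesgue (D m)) \<longlonglongrightarrow> integral\<^sup>L lebesgue h"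
  proof (rule integral_dominated_convergence[where w=w])
    show "h \<in> borel_measurable lebesgue" by fact
    show "D m \<in> borel_measurable lebesgue" for m by (rule measurable_completion) (simp add: Dm)
    have "integrable lborel (\<lambda>y::real^3. indicator (cball 0 (\<bar>R\<bar> + norm e)) y :: real)"
      using emeasure_bounded_finite[OF bounded_cball, of 0 "\<bar>R\<bar> + norm e"]
      by (intro integrable_real_indicator) (auto simp: infinity_ennreal_def)
    then have "integrable lborel w" unfolding w_def by simp
    then show "integrable lebesgue w" by (subst integrable_completion) auto
    show "AE y in lebesgue. (\<lambda>m. D m y) \<longlonglongrightarrow> h y" using deriv by (simp add: D_def)
    show "AE y in lebesgue. norm (D m y) \<le> w y" for m
    proof (rule AE_I2)
      fix y
      let ?t = "inverse (real (Suc m))"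
      show "norm (D m y) \<le> w y"
      proof (cases "norm y \<le> \<bar>R\<bar> + norm e")
        case True
        have "norm (D m y) = \<bar>f (y + ?t *\<^sub>R e) - f y\<bar> * real (Suc m)" by (simp add: D_def abs_mult)
        also have "\<dots> \<le> (L * \<bar>?t\<bar>) * real (Suc m)" by (rule mult_right_mono[OF lip]) simp
        also have "\<dots> = L" by (simp add: abs_inverse)
        finally show ?thesis using True by (simp add: w_def)
      next
        case False
        have t1: "?t \<le> 1" by (simp add: inverse_le_1_iff)
        have "norm y \<le> norm (y + ?t *\<^sub>R e) + norm (?t *\<^sub>R e)"
          by (metis add_diff_cancel_right' norm_triangle_ineq4)
        moreover have "norm (?t *\<^sub>R e) \<le> norm e" using t1 by (simp add: mult_left_le_one_le del: of_nat_Suc)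
        ultimately have "R < norm (y + ?t *\<^sub>R e)" "R < norm y" using False norm_ge_zero[of e] by linarith+
        then have "D m y = 0" by (simp add: D_def supp)
        then show ?thesis using False by (simp add: w_def)
      qed
    qed
  qed
  then show ?thesis by (simp add: D0 LIMSEQ_const_iff)
qed

lemma C1c_line:
  assumes "C1c g"
  shows "((\<lambda>s. g (y + s *\<^sub>R e)) has_field_derivative dderiv e g (y + s *\<^sub>R e)) (at s)"
proof -
  have "((\<lambda>s. g (y + s *\<^sub>R e)) has_derivative (\<lambda>h. dderiv (h *\<^sub>R e) g (y + s *\<^sub>R e))) (at s)"
    by (rule has_derivative_compose[OF _ dderiv_works[OF C1c_differentiable[OF assms]]])
       (auto intro!: derivative_eq_intros)
  then show ?thesis unfolding has_field_derivative_def
    by (rule has_derivative_eq_rhs)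
       (simp add: fun_eq_iff dderiv_dir_scaleR C1c_differentiable[OF assms] mult.commute)
qed

lemma C1c_lipschitz:
  assumes "C1c g"
  shows "\<exists>L\<ge>0. \<forall>y s t. \<bar>g (y + s *\<^sub>R e) - g (y + t *\<^sub>R e)\<bar> \<le> L * \<bar>s - t\<bar>"
proof -
  obtain R where R: "\<And>y. R < norm y \<Longrightarrow> g y = 0" using assms C1c_def by metis
  have "compact ((\<lambda>y. \<bar>dderiv e g y\<bar>) ` cball 0 R)"
    by (intro compact_continuous_image continuous_intros C1c_dderiv_continuous assms) auto
  then obtain B where B: "\<And>y. y \<in> cball 0 R \<Longrightarrow> \<bar>dderiv e g y\<bar> \<le> B"
    by (meson bounded_imp_bdd_above bdd_above.unfold compact_imp_bounded image_eqI)
  have "\<bar>dderiv e g y\<bar> \<le> \<bar>B\<bar>" for y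
  proof (cases "norm y \<le> R")
    case True
    then show ?thesis using B[of y] by (simp add: abs_le_iff)
  next
    case False
    have "open {y. R < norm (y::real^3)}" by (intro open_Collect_less continuous_intros)
    then have "dderiv e g y = 0" by (rule dderiv_eq_0_open) (use False R in auto)
    then show ?thesis by simp
  qed
  then have "norm (g (y + s *\<^sub>R e) - g (y + t *\<^sub>R e)) \<le> \<bar>B\<bar> * norm (s - t)" for y s t
    by (intro field_differentiable_bound[where S=UNIV and f'="\<lambda>s. dderiv e g (y + s *\<^sub>R e)"])
       (auto intro: C1c_line[OF assms] has_field_derivative_at_within)
  then show ?thesis by (intro exI[of _ "\<bar>B\<bar>"]) auto
qed

lemma integrable_bounded_support:
  assumes "continuous_on UNIV g" "\<And>y. R < norm y \<Longrightarrow> g y = 0" "A \<in> sets borel"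
  shows "integrable lborel (\<lambda>y::real^3. indicator A y * g y :: real)"
proof -
  have [measurable]: "g \<in> borel_measurable borel" using assms by (simp add: borel_measurable_continuous_onI)
  have "integrable lborel (\<lambda>y. indicator (cball 0 R) y *\<^sub>R g y)"
    by (rule borel_integrable_compact) (auto intro: continuous_on_subset[OF assms(1)])
  then show ?thesis
    by (rule Bochner_Integration.integrable_bound)
       (use assms in \<open>auto simp: indicator_def\<close>)
qed

lemma difference_quotient_limit:
  assumes "C1c g"
  shows "(\<lambda>m. (g (y + inverse (real (Suc m)) *\<^sub>R e) - g y) * real (Suc m)) \<longlonglongrightarrow> dderiv e g y"
proof -
  have "((\<lambda>h. (g (y + (0 + h) *\<^sub>R e) - g (y + 0 *\<^sub>R e)) / h) \<longlongrightarrow> dderiv e g (y + 0 *\<^sub>R e)) (at 0)"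
    using C1c_line[OF assms, of y e 0] unfolding DERIV_def .
  then have "((\<lambda>h. (g (y + h *\<^sub>R e) - g y) / h) \<longlongrightarrow> dderiv e g y) (at 0)" by simp
  moreover have "filterlim (\<lambda>m. inverse (real (Suc m))) (at 0) sequentially"
    unfolding filterlim_at using LIMSEQ_inverse_real_of_nat by auto
  ultimately have "(\<lambda>m. (g (y + inverse (real (Suc m)) *\<^sub>R e) - g y) / inverse (real (Suc m))) \<longlonglongrightarrow> dderiv e g y"
    by (rule filterlim_compose)
  then show ?thesis by (simp add: divide_inverse)
qed

text \<open>The cut-off by \<open>A\<close> does not disturb difference quotients along \<open>e\<close>. With a half-space for \<open>A\<close> this
  is the vanishing of tangential derivatives that the study of jumps across a plane needs.\<close>
lemma integral_dderiv_invariant: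
  assumes g: "C1c g" and A: "A \<in> sets borel" and inv: "\<And>y t. y + t *\<^sub>R e \<in> A \<longleftrightarrow> y \<in> A"
  shows "(\<integral>y. indicator A y * dderiv e g y \<partial>lebesgue) = 0"
proof -
  obtain R where R: "\<And>y. R < norm y \<Longrightarrow> g y = 0" using g C1c_def by metis
  obtain L where L: "L \<ge> 0" "\<And>y s t. \<bar>g (y + s *\<^sub>R e) - g (y + t *\<^sub>R e)\<bar> \<le> L * \<bar>s - t\<bar>"
    using C1c_lipschitz[OF g] by blast
  have ind: "indicator A (y + t *\<^sub>R e) = (indicator A y :: real)" for y t
    by (simp add: indicator_def inv)
  show ?thesis
  proof (rule integral_directional_derivative[where f="\<lambda>y. indicator A y * g y" and e=e and L=L and R=R])
    show "integrable lborel (\<lambda>y. indicator A y * g y)"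
      by (rule integrable_bounded_support[OF C1c_continuous[OF g] R A])
    have [measurable]: "dderiv e g \<in> borel_measurable borel" "A \<in> sets borel"
      using A by (auto intro: borel_measurable_continuous_onI C1c_dderiv_continuous[OF g])
    show "(\<lambda>y. indicator A y * dderiv e g y) \<in> borel_measurable lebesgue"
      by (rule measurable_completion) measurable
    fix y t
    have "\<bar>indicator A y * (g (y + t *\<^sub>R e) - g y)\<bar> \<le> \<bar>g (y + t *\<^sub>R e) - g y\<bar>"
      by (auto simp: indicator_def)
    also have "\<dots> \<le> L * \<bar>t\<bar>" using L(2)[of y t 0] by simp
    finally show "\<bar>indicator A (y + t *\<^sub>R e) * g (y + t *\<^sub>R e) - indicator A y * g y\<bar> \<le> L * \<bar>t\<bar>"
      by (simp add: ind right_diff_distrib)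
  next
    fix y show "R < norm y \<Longrightarrow> indicator A y * g y = 0" by (simp add: R)
  next
    have "(\<lambda>m. indicator A y * ((g (y + inverse (real (Suc m)) *\<^sub>R e) - g y) * real (Suc m)))
        \<longlonglongrightarrow> indicator A y * dderiv e g y" for y
      by (intro tendsto_intros difference_quotient_limit g)
    then show "AE y in lebesgue. (\<lambda>m. (indicator A (y + inverse (real (Suc m)) *\<^sub>R e) * g (y + inverse (real (Suc m)) *\<^sub>R e) -
         indicator A y * g y) * real (Suc m)) \<longlonglongrightarrow> indicator A y * dderiv e g y"
      by (intro AE_I2) (simp add: ind right_diff_distrib left_diff_distrib mult.assoc)
  qed
qed

section \<open>The fundamental lemma of the calculus of variations\<close>

definition box_bump :: "real \<Rightarrow> real^3 \<Rightarrow> real^3 \<Rightarrow> real^3 \<Rightarrow> real" where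
  "box_bump s a b y = (\<Prod>k\<in>UNIV. flat_exp 0 (s * (y $ k - a $ k)) * flat_exp 0 (s * (b $ k - y $ k)))"

lemma elem_smooth_box_bump: "elem_smooth (box_bump s a b)"
proof -
  have p: "polyn 1 (\<lambda>y. s * (y $ k - a $ k))" "polyn 1 (\<lambda>y. s * (b $ k - y $ k))" for k
    using polyn_nth(2) by (auto intro!: polyn_cmult polyn_diff polyn.const)
  have "elem_smooth (\<lambda>y. (flat_exp 0 (s * (y $ 1 - a $ 1)) * flat_exp 0 (s * (b $ 1 - y $ 1))) *
     (flat_exp 0 (s * (y $ 2 - a $ 2)) * flat_exp 0 (s * (b $ 2 - y $ 2))) *
     (flat_exp 0 (s * (y $ 3 - a $ 3)) * flat_exp 0 (s * (b $ 3 - y $ 3))))"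
    by (intro elem_smooth.mult elem_smooth.flat_exp[OF p(1)] elem_smooth.flat_exp[OF p(2)])
  moreover have "(\<Prod>k\<in>(UNIV::3 set). f k) = f 1 * f 2 * f 3" for f :: "3 \<Rightarrow> real"
    unfolding UNIV_3 by (simp add: mult.assoc)
  ultimately show ?thesis unfolding box_bump_def[abs_def] by simp
qed

lemma box_bump_bounds: "0 \<le> box_bump s a b y" "box_bump s a b y \<le> 1"
  unfolding box_bump_def by (auto intro!: prod_nonneg prod_le_1 mult_nonneg_nonneg mult_le_one flat_exp_nonneg flat_exp_0_le_1)

lemma box_bump_zero: "s > 0 \<Longrightarrow> y \<notin> box a b \<Longrightarrow> box_bump s a b y = 0"
proof -
  assume "s > 0" "y \<notin> box a b"
  then obtain k where "y $ k \<le> a $ k \<or> b $ k \<le> y $ k" by (auto simp: mem_box_cart not_less)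
  then have "s * (y $ k - a $ k) \<le> 0 \<or> s * (b $ k - y $ k) \<le> 0" using \<open>s > 0\<close> by (auto simp: mult_le_0_iff)
  then have "flat_exp 0 (s * (y $ k - a $ k)) * flat_exp 0 (s * (b $ k - y $ k)) = 0" by (auto simp: flat_exp_eq_0)
  then show ?thesis unfolding box_bump_def by (intro prod_zero) auto
qed

lemma box_bump_limit: "(\<lambda>m. box_bump (real (Suc m)) a b y) \<longlonglongrightarrow> indicator (box a b) y"
proof (cases "y \<in> box a b")
  case True
  have t: "(\<lambda>m. flat_exp 0 (real (Suc m) * c)) \<longlonglongrightarrow> 1" if "c > 0" for c
  proof -
    have "(\<lambda>m. exp (- (inverse (real (Suc m)) * inverse c))) \<longlonglongrightarrow> exp (- (0 * inverse c))"
      by (intro tendsto_intros LIMSEQ_inverse_real_of_nat)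
    then show ?thesis using that by (simp add: flat_exp_def mult.commute)
  qed
  have "(\<lambda>m. box_bump (real (Suc m)) a b y) \<longlonglongrightarrow> (\<Prod>k\<in>(UNIV::3 set). 1 * 1)"
    unfolding box_bump_def using True
    by (intro tendsto_prod tendsto_mult t) (auto simp: mem_box_cart)
  then show ?thesis using True by simp
next
  case False
  then show ?thesis by (simp add: box_bump_zero)
qed

text \<open>Boxes are stable under intersection and generate the Borel sets, so the integral vanishes over every
  Borel set.\<close>
lemma AE_zero_if_box_integrals_zero:
  fixes H :: "real^3 \<Rightarrow> real"
  assumes H: "integrable lborel H" and total: "integral\<^sup>L lborel H = 0"
    and box: "\<And>a b. (\<integral>y. indicator (box a b) y * H y \<partial>lborel) = 0"
  shows "AE y in lborel. H y = 0"
proof (rule sigma_finite_measure.density_zero[OF lborel.sigma_finite_measure_axioms H])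
  fix A :: "(real^3) set" assume "A \<in> sets lborel"
  then have A: "A \<in> sigma_sets UNIV (range (\<lambda>(a, b). box a b :: (real^3) set))"
    by (simp add: borel_eq_box)
  have sets: "B \<in> sets lborel" if "B \<in> sigma_sets UNIV (range (\<lambda>(a, b). box a b :: (real^3) set))" for B
    using that by (simp add: borel_eq_box)
  have int: "integrable lborel (\<lambda>y. indicator B y * H y)" if "B \<in> sets lborel" for B
    using integrable_mult_indicator[OF that H] by simp
  have IS: "Int_stable (range (\<lambda>(a, b). box a b :: (real^3) set))"
    by (auto simp: Int_stable_def box_Int_box)
  have P: "range (\<lambda>(a, b). box a b :: (real^3) set) \<subseteq> Pow UNIV" by auto
  show "set_lebesgue_integral lborel A H = 0" using IS P A
  proof (induction A rule: sigma_sets_induct_disjoint)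
    case (basic B)
    then show ?case using box by (auto simp: set_lebesgue_integral_def)
  next
    case (compl B)
    have "(\<integral>y. indicator (UNIV - B) y * H y \<partial>lborel) = (\<integral>y. H y - indicator B y * H y \<partial>lborel)"
      by (rule Bochner_Integration.integral_cong) (auto simp: indicator_def)
    also have "\<dots> = 0" using compl int[OF sets[OF compl(1)]] H total
      by (simp add: set_lebesgue_integral_def)
    finally show ?case by (simp add: set_lebesgue_integral_def)
  next
    case (union B)
    have s: "B i \<in> sets lborel" for i using union(2) sets by blast
    have "set_integrable lborel (\<Union>i. B i) H"
      unfolding set_integrable_def using int[of "\<Union>i. B i"] s by auto
    then have "set_lebesgue_integral lborel (\<Union>i. B i) H = (\<Sum>i. set_lebesgue_integral lborel (B i) H)"
      using union(1) s by (intro lebesgue_integral_countable_add) (auto simp: disjoint_family_on_def)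
    then show ?case using union by simp
  qed (auto simp: set_lebesgue_integral_def)
qed

text \<open>Scaled bump functions converge boundedly to the indicator of a box, so integrals over all boxes
  inside \<open>S\<close> vanish; the interior of \<open>S\<close> is a countable union of closed boxes.\<close>
lemma fundamental_lemma:
  assumes S: "S \<in> sets lebesgue" "negligible (frontier S)"
    and g: "integrable (lebesgue_on S) g"
    and 0: "\<And>\<phi>. \<phi> \<in> test_functions S \<Longrightarrow> (LINT y|lebesgue_on S. g y * \<phi> y) = 0"
  shows "AE y in lebesgue_on S. g y = 0"
proof -
  have SI: "S \<inter> space lebesgue \<in> sets lebesgue" using S by simp
  define G where "G = (\<lambda>y. indicator S y * g y)"
  have G: "integrable lebesgue G" using g unfolding integrable_restrict_space[OF SI] G_def by simp
  have GLINT: "(LINT y|lebesgue_on S. g y * f y) = (\<integral>y. G y * f y \<partial>lebesgue)" for f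
    unfolding integral_restrict_space[OF SI] G_def by (simp add: mult.assoc)
  have box0: "(\<integral>y. indicator (box a b) y * G y \<partial>lebesgue) = 0" if ab: "cbox a b \<subseteq> interior S" for a b
  proof -
    have t: "box_bump (real (Suc m)) a b \<in> test_functions S" for m
    proof (rule elem_smooth_test[OF elem_smooth_box_bump compact_cbox ab])
      fix y assume "box_bump (real (Suc m)) a b y \<noteq> 0"
      then have "y \<in> box a b" using box_bump_zero[of "real (Suc m)"] by auto
      then show "y \<in> cbox a b" using box_subset_cbox by blast
    qed
    have [measurable]: "box_bump s a b \<in> borel_measurable borel" for s
      by (intro borel_measurable_continuous_onI continuous_at_imp_continuous_on)
         (auto intro: differentiable_imp_continuous_within elem_smooth_differentiable elem_smooth_box_bump)
    have "(\<lambda>m. \<integral>y. G y * box_bump (real (Suc m)) a b y \<partial>lebesgue) \<longlonglongrightarrow> (\<integral>y. G y * indicator (box a b) y \<partial>lebesgue)"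
    proof (rule integral_dominated_convergence[where w="\<lambda>y. \<bar>G y\<bar>"])
      have m: "f \<in> borel_measurable lebesgue" if "f \<in> borel_measurable borel" for f :: "real^3 \<Rightarrow> real"
        using that by (intro measurable_completion) simp
      have [measurable]: "G \<in> borel_measurable lebesgue" using G by auto
      have [measurable]: "box_bump s a b \<in> borel_measurable lebesgue" for s by (rule m) measurable
      have [measurable]: "(indicator (box a b) :: real^3 \<Rightarrow> real) \<in> borel_measurable lebesgue" by (rule m) measurable
      show "(\<lambda>y. G y * indicator (box a b) y) \<in> borel_measurable lebesgue" by measurable
      show "(\<lambda>y. G y * box_bump (real (Suc m)) a b y) \<in> borel_measurable lebesgue" for m by measurable
      show "integrable lebesgue (\<lambda>y. \<bar>G y\<bar>)" using G by simp
      show "AE y in lebesgue. (\<lambda>m. G y * box_bump (real (Suc m)) a b y) \<longlonglongrightarrow> G y * indicator (box a b) y"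
        by (intro AE_I2 tendsto_intros box_bump_limit)
      show "AE y in lebesgue. norm (G y * box_bump (real (Suc m)) a b y) \<le> \<bar>G y\<bar>" for m
        using box_bump_bounds by (intro AE_I2) (simp add: abs_mult mult_left_le)
    qed
    moreover have "(\<integral>y. G y * box_bump (real (Suc m)) a b y \<partial>lebesgue) = 0" for m
      using 0[OF t] GLINT by metis
    ultimately show ?thesis by (simp add: LIMSEQ_const_iff mult.commute)
  qed
  obtain G' where G': "G' \<in> borel_measurable lborel" "AE y in lborel. G y = G' y"
    using completion_ex_borel_measurable_real[of G lborel] G by auto
  have G'm [measurable]: "G' \<in> borel_measurable borel" using G' by simp
  have aeG: "AE y in lebesgue. G y = G' y" using G'(2) by (rule AE_completion)
  have "integrable lebesgue G'"
    using integrable_cong_AE_imp[OF G measurable_completion[OF G'(1)]] aeG by (simp add: eq_commute)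
  then have intG': "integrable lborel G'" using integrable_completion[OF G'(1)] by simp
  have cboxAE: "AE y in lborel. y \<in> box c d \<longrightarrow> G' y = 0" if cd: "cbox c d \<subseteq> interior S" for c d
  proof -
    define H where "H = (\<lambda>y. indicator (box c d) y * G' y)"
    have Hm [measurable]: "H \<in> borel_measurable borel" unfolding H_def by measurable
    have intH: "integrable lborel H" unfolding H_def
      using integrable_mult_indicator[OF _ intG', of "box c d"] by simp
    have b: "(\<integral>y. indicator (box a b) y * G' y \<partial>lborel) = 0" if "cbox a b \<subseteq> interior S" for a b
    proof -
      have "(\<integral>y. indicator (box a b) y * G' y \<partial>lborel) = (\<integral>y. indicator (box a b) y * G' y \<partial>lebesgue)"
        by (rule integral_completion[symmetric]) measurable
      also have "\<dots> = (\<integral>y. indicator (box a b) y * G y \<partial>lebesgue)"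
      proof (rule integral_cong_AE)
        have [measurable]: "G \<in> borel_measurable lebesgue" "G' \<in> borel_measurable lebesgue"
          "(indicator (box a b) :: real^3 \<Rightarrow> real) \<in> borel_measurable lebesgue"
          using G G' by (auto intro: measurable_completion)
        show "(\<lambda>y. indicator (box a b) y * G' y) \<in> borel_measurable lebesgue"
          "(\<lambda>y. indicator (box a b) y * G y) \<in> borel_measurable lebesgue" by measurable
      qed (use aeG in auto)
      also have "\<dots> = 0" by (rule box0[OF that])
      finally show ?thesis .
    qed
    have "AE y in lborel. H y = 0"
    proof (rule AE_zero_if_box_integrals_zero[OF intH])
      show "integral\<^sup>L lborel H = 0" unfolding H_def by (rule b[OF cd])
      fix a b :: "real^3"
      obtain a' b' where ab': "box a b \<inter> box c d = box a' b'" by (simp add: box_Int_box)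
      have "(\<integral>y. indicator (box a b) y * H y \<partial>lborel) = (\<integral>y. indicator (box a' b') y * G' y \<partial>lborel)"
        unfolding H_def mult.assoc[symmetric] indicator_inter_arith[symmetric] ab' ..
      also have "\<dots> = 0"
      proof (cases "box a' b' = {}")
        case False
        then have "cbox a' b' = closure (box a' b')" by (simp add: closure_box)
        also have "\<dots> \<subseteq> closure (box c d)" using ab' by (intro closure_mono) blast
        also have "\<dots> \<subseteq> cbox c d" by (rule closure_minimal[OF box_subset_cbox closed_cbox])
        finally show ?thesis using b cd by blast
      qed simp
      finally show "(\<integral>y. indicator (box a b) y * H y \<partial>lborel) = 0" .
    qed
    then show ?thesis by eventually_elim (auto simp: H_def)
  qed
  have "open (interior S)" by simp
  then obtain \<D> where \<D>: "countable \<D>" "\<D> \<subseteq> Pow (interior S)" "\<And>X. X \<in> \<D> \<Longrightarrow> \<exists>a b. X = cbox a b" "\<Union>\<D> = interior S"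
    by (rule open_countable_Union_open_cbox) blast
  have "AE y in lebesgue. y \<in> X \<longrightarrow> G' y = 0" if X: "X \<in> \<D>" for X
  proof -
    obtain a b where ab: "X = cbox a b" using \<D>(3)[OF X] by blast
    have "AE y in lebesgue. y \<notin> cbox a b - box a b"
      using negligible_frontier_interval negligible_iff_null_sets AE_not_in by blast
    moreover have "AE y in lebesgue. y \<in> box a b \<longrightarrow> G' y = 0"
      using cboxAE[of a b] \<D>(2) X ab by (intro AE_completion) auto
    ultimately show ?thesis by eventually_elim (auto simp: ab)
  qed
  then have "AE y in lebesgue. \<forall>X\<in>\<D>. y \<in> X \<longrightarrow> G' y = 0"
    unfolding AE_ball_countable[OF \<D>(1)] by blast
  moreover have "AE y in lebesgue. y \<notin> frontier S"
    using S(2) negligible_iff_null_sets AE_not_in by blast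
  ultimately have "AE y in lebesgue. y \<in> S \<longrightarrow> g y = 0" using aeG
  proof eventually_elim
    case (elim y)
    show ?case
    proof
      assume "y \<in> S"
      then have "y \<in> interior S" using elim(2) closure_subset[of S] by (auto simp: frontier_def)
      then have "G' y = 0" using elim(1) \<D>(4) by blast
      then show "g y = 0" using elim(3) \<open>y \<in> S\<close> by (simp add: G_def)
    qed
  qed
  then show ?thesis using AE_restrict_space_iff[OF SI] by blast
qed

section \<open>Second derivatives of smooth functions\<close>

text \<open>The mean value theorem turns the mixed second difference into a difference of first derivatives,
  to which differentiability at \<open>a\<close> applies.\<close>
lemma second_difference:
  fixes f :: "'a::euclidean_space \<Rightarrow> real"
  assumes f: "\<And>y. f differentiable (at y)" and fi: "dderiv v f differentiable (at a)" and "\<epsilon> > 0"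
  shows "\<exists>d>0. \<forall>h. 0 < h \<and> h < d \<longrightarrow>
    \<bar>f (a + h *\<^sub>R v + h *\<^sub>R w) - f (a + h *\<^sub>R v) - f (a + h *\<^sub>R w) + f a - h\<^sup>2 * dderiv w (dderiv v f) a\<bar> \<le> \<epsilon> * h\<^sup>2"
proof -
  define K where "K = 2 * norm v + norm w + 1"
  have K: "K > 0" unfolding K_def by (simp add: add_nonneg_pos)
  let ?D = "\<lambda>u. dderiv u (dderiv v f) a"
  have "(dderiv v f has_derivative ?D) (at a)" by (rule dderiv_works[OF fi])
  moreover have "\<epsilon> / K > 0" using assms K by simp
  ultimately obtain d where d: "d > 0"
    "\<And>y. norm (y - a) < d \<Longrightarrow> norm (dderiv v f y - dderiv v f a - ?D (y - a)) \<le> \<epsilon> / K * norm (y - a)"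
    unfolding has_derivative_at_alt by metis
  show ?thesis
  proof (intro exI[of _ "d / K"] conjI allI impI)
    show "d / K > 0" using d K by simp
    fix h assume h: "0 < h \<and> h < d / K"
    have "((\<lambda>s. f (a + s *\<^sub>R v + h *\<^sub>R w) - f (a + s *\<^sub>R v)) has_field_derivative
        dderiv v f (a + s *\<^sub>R v + h *\<^sub>R w) - dderiv v f (a + s *\<^sub>R v)) (at s)" for s
    proof -
      have "((\<lambda>s. f (b + s *\<^sub>R v)) has_derivative (\<lambda>e. dderiv (e *\<^sub>R v) f (b + s *\<^sub>R v))) (at s)" for b
        by (rule has_derivative_compose[OF _ dderiv_works[OF f]]) (auto intro!: derivative_eq_intros)
      then have "((\<lambda>s. f (b + s *\<^sub>R v)) has_field_derivative dderiv v f (b + s *\<^sub>R v)) (at s)" for b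
        unfolding has_field_derivative_def
        by (rule has_derivative_eq_rhs) (simp add: fun_eq_iff dderiv_dir_scaleR f mult.commute)
      from DERIV_diff[OF this[of "a + h *\<^sub>R w"] this[of a]] show ?thesis
        by (simp add: add_ac)
    qed
    from MVT2[OF _ this, of 0 h] h obtain \<xi> where xi: "0 < \<xi>" "\<xi> < h" and
      eq: "f (a + h *\<^sub>R v + h *\<^sub>R w) - f (a + h *\<^sub>R v) - (f (a + h *\<^sub>R w) - f a) =
        h * (dderiv v f (a + \<xi> *\<^sub>R v + h *\<^sub>R w) - dderiv v f (a + \<xi> *\<^sub>R v))"
      by auto
    have n1: "norm (\<xi> *\<^sub>R v) \<le> h * norm v" using xi by (simp add: mult_right_mono)
    have "norm (\<xi> *\<^sub>R v + h *\<^sub>R w) \<le> norm (\<xi> *\<^sub>R v) + norm (h *\<^sub>R w)" by (rule norm_triangle_ineq)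
    then have n2: "norm (\<xi> *\<^sub>R v + h *\<^sub>R w) \<le> h * norm v + h * norm w" using n1 h by simp
    have hK: "h * K < d" using h K by (simp add: pos_less_divide_eq)
    have hv: "0 \<le> h * norm v" "0 \<le> h * norm w" using h by simp_all
    have hKe: "h * K = 2 * (h * norm v) + h * norm w + h" by (simp add: K_def algebra_simps)
    have b1: "norm (\<xi> *\<^sub>R v) < d" "norm (\<xi> *\<^sub>R v + h *\<^sub>R w) < d" using n1 n2 hK hKe hv h by linarith+
    have D: "?D (\<xi> *\<^sub>R v + h *\<^sub>R w) = ?D (\<xi> *\<^sub>R v) + h * ?D w"
      by (simp add: dderiv_dir_add[OF fi] dderiv_dir_scaleR[OF fi])
    let ?A = "dderiv v f (a + \<xi> *\<^sub>R v + h *\<^sub>R w)" and ?B = "dderiv v f (a + \<xi> *\<^sub>R v)"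
    have e1: "\<bar>?A - dderiv v f a - ?D (\<xi> *\<^sub>R v + h *\<^sub>R w)\<bar> \<le> \<epsilon> / K * (h * norm v + h * norm w)"
    proof -
      have "\<bar>?A - dderiv v f a - ?D (\<xi> *\<^sub>R v + h *\<^sub>R w)\<bar> \<le> \<epsilon> / K * norm (\<xi> *\<^sub>R v + h *\<^sub>R w)"
        using d(2)[of "a + \<xi> *\<^sub>R v + h *\<^sub>R w"] b1 by (simp add: add.assoc)
      also have "\<dots> \<le> \<epsilon> / K * (h * norm v + h * norm w)"
        using n2 \<open>\<epsilon> / K > 0\<close> by (intro mult_left_mono) auto
      finally show ?thesis .
    qed
    have e2: "\<bar>?B - dderiv v f a - ?D (\<xi> *\<^sub>R v)\<bar> \<le> \<epsilon> / K * (h * norm v)"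
    proof -
      have "\<bar>?B - dderiv v f a - ?D (\<xi> *\<^sub>R v)\<bar> \<le> \<epsilon> / K * norm (\<xi> *\<^sub>R v)"
        using d(2)[of "a + \<xi> *\<^sub>R v"] b1 by simp
      also have "\<dots> \<le> \<epsilon> / K * (h * norm v)"
        using n1 \<open>\<epsilon> / K > 0\<close> by (intro mult_left_mono) auto
      finally show ?thesis .
    qed
    have "\<bar>?A - ?B - h * ?D w\<bar> \<le> \<epsilon> / K * (h * norm v + h * norm w) + \<epsilon> / K * (h * norm v)"
      using e1 e2 D by linarith
    also have "\<dots> = \<epsilon> / K * (2 * (h * norm v) + h * norm w)" by (simp add: algebra_simps)
    also have "\<dots> \<le> \<epsilon> / K * (h * K)" using \<open>\<epsilon> / K > 0\<close> h hKe by (intro mult_left_mono) auto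
    also have "\<dots> = \<epsilon> * h" using K by simp
    finally have "h * \<bar>?A - ?B - h * ?D w\<bar> \<le> h * (\<epsilon> * h)" using h by (intro mult_left_mono) auto
    moreover have "h * \<bar>?A - ?B - h * ?D w\<bar> = \<bar>h * (?A - ?B) - h\<^sup>2 * ?D w\<bar>"
    proof -
      have "h * (?A - ?B) - h\<^sup>2 * ?D w = h * (?A - ?B - h * ?D w)" by (simp add: algebra_simps power2_eq_square)
      then show ?thesis using h by (simp add: abs_mult)
    qed
    moreover have "f (a + h *\<^sub>R v + h *\<^sub>R w) - f (a + h *\<^sub>R v) - f (a + h *\<^sub>R w) + f a = h * (?A - ?B)"
      using eq by simp
    ultimately show "\<bar>f (a + h *\<^sub>R v + h *\<^sub>R w) - f (a + h *\<^sub>R v) - f (a + h *\<^sub>R w) + f a - h\<^sup>2 * ?D w\<bar> \<le> \<epsilon> * h\<^sup>2"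
      by (simp add: power2_eq_square mult_ac)
  qed
qed

text \<open>The second difference is symmetric in the two directions.\<close>
lemma dderiv_symmetric:
  fixes f :: "'a::euclidean_space \<Rightarrow> real"
  assumes f: "\<And>y. f differentiable (at y)"
    and d: "dderiv v f differentiable (at a)" "dderiv w f differentiable (at a)"
  shows "dderiv w (dderiv v f) a = dderiv v (dderiv w f) a"
proof (rule ccontr)
  let ?p = "dderiv w (dderiv v f) a" and ?q = "dderiv v (dderiv w f) a"
  assume "?p \<noteq> ?q"
  define \<epsilon> where "\<epsilon> = \<bar>?p - ?q\<bar> / 3"
  have e: "\<epsilon> > 0" using \<open>?p \<noteq> ?q\<close> by (simp add: \<epsilon>_def)
  obtain d1 where d1: "d1 > 0" "\<And>h. 0 < h \<and> h < d1 \<Longrightarrow>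
    \<bar>f (a + h *\<^sub>R v + h *\<^sub>R w) - f (a + h *\<^sub>R v) - f (a + h *\<^sub>R w) + f a - h\<^sup>2 * ?p\<bar> \<le> \<epsilon> * h\<^sup>2"
    using second_difference[OF f d(1) e, of w] by blast
  obtain d2 where d2: "d2 > 0" "\<And>h. 0 < h \<and> h < d2 \<Longrightarrow>
    \<bar>f (a + h *\<^sub>R w + h *\<^sub>R v) - f (a + h *\<^sub>R w) - f (a + h *\<^sub>R v) + f a - h\<^sup>2 * ?q\<bar> \<le> \<epsilon> * h\<^sup>2"
    using second_difference[OF f d(2) e, of v] by blast
  define h where "h = min d1 d2 / 2"
  have h: "0 < h" "h < d1" "h < d2" using d1 d2 by (auto simp: h_def)
  have c: "a + h *\<^sub>R w + h *\<^sub>R v = a + h *\<^sub>R v + h *\<^sub>R w" by (simp add: add_ac)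
  have "\<bar>h\<^sup>2 * ?p - h\<^sup>2 * ?q\<bar> \<le> 2 * (\<epsilon> * h\<^sup>2)"
    using d1(2)[of h] d2(2)[of h] h unfolding c by linarith
  then have "h\<^sup>2 * \<bar>?p - ?q\<bar> \<le> h\<^sup>2 * (2 * \<epsilon>)"
    by (simp add: right_diff_distrib[symmetric] abs_mult mult_ac)
  then have "\<bar>?p - ?q\<bar> \<le> 2 * \<epsilon>" using h by simp
  then show False using e by (simp add: \<epsilon>_def)
qed

lemma smooth_partial_commute: "smooth f \<Longrightarrow> partial i (partial j f) y = partial j (partial i f) y"
  unfolding partial_eq_dderiv
  by (rule dderiv_symmetric) (auto intro: smooth_differentiable smooth_partial simp: partial_eq_dderiv[symmetric])

section \<open>Vanishing of normal jumps\<close>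

lemma indicator_dderiv_integrable:
  assumes "C1c g" "A \<in> sets borel"
  shows "integrable lebesgue (\<lambda>y. indicator A y * dderiv e g y)"
proof -
  obtain R where R: "\<And>y. R < norm y \<Longrightarrow> g y = 0" using assms(1) C1c_def by metis
  have o: "open {y. R < norm (y::real^3)}" by (intro open_Collect_less continuous_intros)
  have "integrable lborel (\<lambda>y. indicator A y * dderiv e g y)"
    by (rule integrable_bounded_support[OF C1c_dderiv_continuous[OF assms(1)] _ assms(2)])
       (use dderiv_eq_0_open[OF o] R in auto)
  moreover have "(\<lambda>y. indicator A y * dderiv e g y) \<in> borel_measurable lborel"
    using calculation by auto
  ultimately show ?thesis by (simp add: integrable_completion)
qed

text \<open>Splitting each coordinate direction into a part tangential to the plane and a multiple of \<open>N\<close>, the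
  tangential parts integrate to zero over the half-space.\<close>
lemma divergence_halfspace:
  fixes F :: "real^3 \<Rightarrow> real^3" and N y0 :: "real^3"
  assumes F: "\<And>k. C1c (\<lambda>y. F y $ k)" and N: "norm N = 1"
  defines "A \<equiv> {y::real^3. 0 < N \<bullet> (y - y0)}"
  shows "(\<integral>y. indicator A y * div_classical F y \<partial>lebesgue) = (\<integral>y. indicator A y * dderiv N (\<lambda>y. N \<bullet> F y) y \<partial>lebesgue)"
proof -
  have "open A" unfolding A_def by (intro open_Collect_less continuous_intros)
  then have A: "A \<in> sets borel" by simp
  have NN: "N \<bullet> N = 1" using N by (simp add: dot_square_norm)
  define G where "G = (\<lambda>y. N \<bullet> F y)"
  have G_eq: "G = (\<lambda>y. \<Sum>k\<in>UNIV. N $ k * F y $ k)" by (simp add: G_def inner_vec_def fun_eq_iff)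
  have dF: "(\<lambda>y. F y $ k) differentiable (at y)" for k y by (rule C1c_differentiable[OF F])
  define \<tau> :: "3 \<Rightarrow> real^3" where "\<tau> = (\<lambda>k. axis k 1 - N $ k *\<^sub>R N)"
  have tauN: "N \<bullet> \<tau> k = 0" for k by (simp add: \<tau>_def inner_diff_right inner_axis NN)
  have "div_classical F y = (\<Sum>k\<in>UNIV. dderiv (\<tau> k) (\<lambda>y. F y $ k) y) + dderiv N G y" for y
  proof -
    have "dderiv N G y = (\<Sum>k\<in>UNIV. N $ k * dderiv N (\<lambda>y. F y $ k) y)"
      unfolding G_eq using dF by (simp add: dderiv_sum dderiv_cmult)
    moreover have "dderiv (\<tau> k) (\<lambda>y. F y $ k) y = partial k (\<lambda>y. F y $ k) y - N $ k * dderiv N (\<lambda>y. F y $ k) y" for k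
      unfolding \<tau>_def partial_eq_dderiv by (simp only: dderiv_dir_diff[OF dF] dderiv_dir_scaleR[OF dF])
    ultimately show ?thesis by (simp add: div_classical_def sum_subtractf)
  qed
  then have "(\<integral>y. indicator A y * div_classical F y \<partial>lebesgue) =
    (\<integral>y. (\<Sum>k\<in>UNIV. indicator A y * dderiv (\<tau> k) (\<lambda>y. F y $ k) y) + indicator A y * dderiv N G y \<partial>lebesgue)"
    by (simp add: distrib_left sum_distrib_left)
  also have "\<dots> = (\<Sum>k\<in>UNIV. \<integral>y. indicator A y * dderiv (\<tau> k) (\<lambda>y. F y $ k) y \<partial>lebesgue) + (\<integral>y. indicator A y * dderiv N G y \<partial>lebesgue)"
  proof -
    have i: "integrable lebesgue (\<lambda>y. indicator A y * dderiv (\<tau> k) (\<lambda>y. F y $ k) y)" for k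
      by (rule indicator_dderiv_integrable[OF F A])
    have "dderiv N G = (\<lambda>y. \<Sum>k\<in>UNIV. N $ k * dderiv N (\<lambda>y. F y $ k) y)"
      unfolding G_eq using dF by (simp add: fun_eq_iff dderiv_sum dderiv_cmult)
    then have "(\<lambda>y. indicator A y * dderiv N G y) = (\<lambda>y. \<Sum>k\<in>UNIV. N $ k * (indicator A y * dderiv N (\<lambda>y. F y $ k) y))"
      by (simp add: fun_eq_iff sum_distrib_left mult_ac)
    then have "integrable lebesgue (\<lambda>y. indicator A y * dderiv N G y)"
      using indicator_dderiv_integrable[OF F A] by simp
    then show ?thesis
      by (subst Bochner_Integration.integral_add[OF Bochner_Integration.integrable_sum[OF i]])
         (simp_all only: Bochner_Integration.integral_sum[OF i])
  qed
  also have "\<dots> = (\<integral>y. indicator A y * dderiv N G y \<partial>lebesgue)"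
  proof -
    have "(\<integral>y. indicator A y * dderiv (\<tau> k) (\<lambda>y. F y $ k) y \<partial>lebesgue) = 0" for k
      by (rule integral_dderiv_invariant[OF F A]) (simp add: A_def inner_diff_right inner_add_right tauN)
    then show ?thesis by simp
  qed
  finally show ?thesis by (simp add: G_def)
qed

text \<open>This replaces a boundary integral. If \<open>h = N \<bullet> U\<close> were nonzero at \<open>y0\<close>, take the test
  function \<open>h \<beta>\<close> with \<open>\<beta>\<close> a bump of radius \<open>\<rho>\<close> whose centre lies \<open>\<rho> / 2\<close> below the plane. Above the plane
  \<open>\<beta>\<close> decreases in the direction \<open>N\<close> at a relative rate of at least \<open>1 / \<rho>\<close>, which for small \<open>\<rho>\<close> beats
  any growth of \<open>h^2\<close>. So \<open>h^2 \<beta>\<close> has a negative derivative along \<open>N\<close>, whose integral over the half-space is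
  zero by \<open>divergence_halfspace\<close>.\<close>
lemma normal_component_vanishes:
  fixes U :: "real^3 \<Rightarrow> real^3"
  assumes U: "\<And>k. polyn m (\<lambda>y. U y $ k)" and N: "norm N = 1" and "r > 0"
    and 0: "\<And>\<phi>. \<phi> \<in> test_functions (ball y0 r) \<Longrightarrow>
      (\<integral>y. indicator {y. 0 < N \<bullet> (y - y0)} y * div_classical (\<lambda>y. \<phi> y *\<^sub>R U y) y \<partial>lebesgue) = 0"
  shows "N \<bullet> U y0 = 0"
proof (rule ccontr)
  define h where "h = (\<lambda>y. \<Sum>k\<in>UNIV. N $ k * U y $ k)"
  have h_eq: "h y = N \<bullet> U y" for y by (simp add: h_def inner_vec_def)
  have ph: "polyn m h" unfolding h_def by (intro polyn_sum polyn_cmult U)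
  assume "N \<bullet> U y0 \<noteq> 0"
  then have h0: "h y0 \<noteq> 0" by (simp add: h_eq)
  define q where "q = (\<lambda>y. h y * h y)"
  have pq: "polyn (m + m) q" unfolding q_def by (rule polyn_mult[OF ph ph])
  have q0: "q y0 > 0" using h0 by (simp add: q_def power2_eq_square[symmetric])
  define c where "c = q y0 / 2"
  define C where "C = \<bar>dderiv N q y0\<bar> + 1"
  have c: "c > 0" and C: "C > 0" using q0 by (auto simp: c_def C_def)
  have "open {y. c < q y \<and> dderiv N q y < C}"
    by (intro open_Collect_conj open_Collect_less polyn_continuous_on[OF pq] polyn_continuous_on[OF polyn_dderiv'[OF pq]] continuous_intros)
  moreover have "y0 \<in> {y. c < q y \<and> dderiv N q y < C}" using q0 by (auto simp: c_def C_def)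
  ultimately obtain r1 where r1: "r1 > 0" "ball y0 r1 \<subseteq> {y. c < q y \<and> dderiv N q y < C}"
    using open_contains_ball by blast
  \<comment> \<open>With centre at distance \<open>\<rho> / 2\<close> from \<open>y0\<close>, the bump stays in the ball of radius \<open>3 \<rho> / 2\<close> about \<open>y0\<close>;
    \<open>\<rho> \<le> c / (2 C)\<close> makes the decay rate \<open>1 / \<rho>\<close> of the bump dominate.\<close>
  define \<rho> where "\<rho> = min (min r r1 / 2) (min 1 (c / (2 * C)))"
  have rho: "\<rho> > 0" "\<rho> \<le> r / 2" "\<rho> \<le> r1 / 2" "\<rho> \<le> 1" "\<rho> \<le> c / (2 * C)"
    using assms(3) r1 c C by (auto simp: \<rho>_def)
  define x0 where "x0 = y0 - (\<rho> / 2) *\<^sub>R N"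
  define s where "s = (\<lambda>y. \<rho>\<^sup>2 - (\<Sum>k\<in>UNIV. (y - x0) $ k * (y - x0) $ k))"
  have s_eq: "s y = \<rho>\<^sup>2 - (norm (y - x0))\<^sup>2" for y
    by (simp add: s_def power2_norm_eq_inner inner_vec_def)
  have ps: "polyn 2 s" unfolding s_def
    using polyn_mult[OF polyn_nth(1) polyn_nth(1)] by (intro polyn_diff polyn.const polyn_sum) (simp add: numeral_2_eq_2)
  have ds: "dderiv N s y = - 2 * (N \<bullet> (y - x0))" for y
  proof -
    have n: "(\<lambda>y. (y - x0) $ k) differentiable (at y)" for k y
      using polyn_differentiable[OF polyn_nth(1)] by blast
    have dn: "dderiv N (\<lambda>y. (y - x0) $ k) y = N $ k" for k y
      using dderiv_nth(2)[of N k "x0 $ k" y] by simp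
    have nn: "(\<lambda>y. (y - x0) $ k * (y - x0) $ k) differentiable (at y)" for k y
      by (rule differentiable_mult[OF n n])
    have sn: "(\<lambda>y. \<Sum>k\<in>UNIV. (y - x0) $ k * (y - x0) $ k) differentiable (at y)" for y
      using nn by (intro differentiable_sum) auto
    have "dderiv N s y = - (\<Sum>k\<in>UNIV. N $ k * (y - x0) $ k + (y - x0) $ k * N $ k)"
      unfolding s_def dderiv_diff[OF differentiable_const sn] dderiv_sum[OF nn] dderiv_mult[OF n n] dn dderiv_const by simp
    also have "\<dots> = - 2 * (N \<bullet> (y - x0))"
      by (simp add: inner_vec_def sum_distrib_left sum_negf[symmetric])
    finally show ?thesis .
  qed
  define \<beta> where "\<beta> = (\<lambda>y. flat_exp 0 (s y))"
  have bump: "elem_smooth \<beta>" unfolding \<beta>_def by (rule elem_smooth.flat_exp[OF ps])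
  have b_supp: "norm (y - x0) < \<rho>" if "\<beta> y \<noteq> 0" for y
  proof -
    have "s y > 0" using that flat_exp_eq_0 unfolding \<beta>_def by (meson not_le)
    then have "(norm (y - x0))\<^sup>2 < \<rho>\<^sup>2" by (simp add: s_eq)
    then show ?thesis using rho(1) power2_less_imp_less by (meson less_imp_le)
  qed
  have dist0: "dist y0 x0 = \<rho> / 2" using N rho by (simp add: x0_def dist_norm)
  have cb: "cball x0 \<rho> \<subseteq> ball y0 (min r r1)"
  proof
    fix y assume "y \<in> cball x0 \<rho>"
    then have "dist y0 y \<le> \<rho> / 2 + \<rho>" using dist_triangle[of y0 y x0] dist0 by (simp add: dist_commute)
    then show "y \<in> ball y0 (min r r1)" using rho by (auto simp: min_def)
  qed
  define \<phi> where "\<phi> = (\<lambda>y. h y * \<beta> y)"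
  have phi: "\<phi> \<in> test_functions (ball y0 r)"
  proof (rule elem_smooth_test)
    show "elem_smooth \<phi>" unfolding \<phi>_def by (intro elem_smooth.mult elem_smooth.poly[OF ph] bump)
    show "compact (cball x0 \<rho>)" by simp
    show "cball x0 \<rho> \<subseteq> interior (ball y0 r)" using cb by (auto simp: subset_iff)
    fix y assume "\<phi> y \<noteq> 0"
    then show "y \<in> cball x0 \<rho>" using b_supp[of y] by (auto simp: \<phi>_def dist_norm norm_minus_commute)
  qed
  define A where "A = {y. 0 < N \<bullet> (y - y0)}"
  define G where "G = (\<lambda>y. N \<bullet> (\<phi> y *\<^sub>R U y))"
  have G_eq: "G = (\<lambda>y. q y * \<beta> y)"
    by (simp add: G_def fun_eq_iff q_def \<phi>_def h_eq)
  have b1: "C1c \<beta>" by (rule smooth_C1c[OF elem_smooth_smooth[OF bump]])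
      (rule bounded_subset[of "cball x0 \<rho>"], use b_supp in \<open>auto simp: dist_norm norm_minus_commute less_imp_le\<close>)
  have G1: "C1c G" unfolding G_eq by (rule C1c_poly_mult[OF pq b1])
  have "(\<integral>y. indicator A y * dderiv N G y \<partial>lebesgue) = 0"
    using divergence_halfspace[of "\<lambda>y. \<phi> y *\<^sub>R U y" N y0] 0[OF phi] N
      C1c_poly_mult[OF U test_C1c[OF phi]]
    unfolding A_def G_def by (simp add: mult.commute)
  have neg: "dderiv N G y < 0" if y: "y \<in> A" "\<beta> y \<noteq> 0" for y
  proof -
    have nb: "norm (y - x0) < \<rho>" by (rule b_supp[OF y(2)])
    then have "y \<in> cball x0 \<rho>" by (simp add: dist_norm norm_minus_commute)
    then have "y \<in> ball y0 r1" using cb by (auto simp del: mem_cball)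
    then have qy: "c < q y" "dderiv N q y < C" using r1 by auto
    have sy: "s y > 0" "s y \<le> \<rho>\<^sup>2" using nb rho by (auto simp: s_eq power_strict_mono)
    have "N \<bullet> (y - x0) = N \<bullet> (y - y0) + \<rho> / 2"
      using N by (simp add: x0_def inner_diff_right inner_add_right algebra_simps dot_square_norm)
    then have sN: "dderiv N s y \<le> - \<rho>" using y by (simp add: ds A_def)
    have db: "dderiv N \<beta> y = dderiv N s y * flat_exp 2 (s y)"
      using dderiv_eqI[OF has_derivative_flat_exp_poly[OF ps, of 0 y], of N] by (simp add: \<beta>_def numeral_2_eq_2)
    have th: "flat_exp 2 (s y) = \<beta> y * inverse (s y) ^ 2" using sy by (simp add: flat_exp_def \<beta>_def)
    have bpos: "\<beta> y > 0" using sy by (simp add: \<beta>_def flat_exp_pos)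
    have i1: "inverse (s y) \<ge> 1"
    proof -
      have "\<rho>\<^sup>2 \<le> 1" using rho by (simp add: power_le_one)
      then show ?thesis using sy by (simp add: one_le_inverse)
    qed
    have "inverse (s y) \<ge> inverse (\<rho>\<^sup>2)" using sy by (intro le_imp_inverse_le) auto
    then have "inverse (s y) ^ 2 \<ge> inverse (\<rho>\<^sup>2)" using i1
      by (smt (verit, best) power2_eq_square mult_left_le mult_le_cancel_left1 mult_mono)
    then have "flat_exp 2 (s y) \<ge> \<beta> y * inverse (\<rho>\<^sup>2)" unfolding th using bpos by simp
    then have "\<rho> * flat_exp 2 (s y) \<ge> \<rho> * (\<beta> y * inverse (\<rho>\<^sup>2))" using rho by simp
    moreover have "\<rho> * (\<beta> y * inverse (\<rho>\<^sup>2)) = \<beta> y / \<rho>" using rho by (simp add: power2_eq_square field_simps)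
    moreover have "dderiv N s y * flat_exp 2 (s y) \<le> - \<rho> * flat_exp 2 (s y)"
      using sN flat_exp_nonneg by (intro mult_right_mono)
    ultimately have "dderiv N \<beta> y \<le> - (\<beta> y / \<rho>)" unfolding db by simp
    then have "q y * dderiv N \<beta> y \<le> q y * (- (\<beta> y / \<rho>))" using qy c by (intro mult_left_mono) auto
    also have "\<dots> \<le> c * (- (\<beta> y / \<rho>))" using qy bpos rho by (intro mult_right_mono_neg) auto
    also have "\<dots> \<le> - (2 * C) * \<beta> y"
    proof -
      have "2 * C * \<rho> \<le> c" using rho(5) C by (simp add: pos_le_divide_eq mult_ac)
      then have "2 * C \<le> c / \<rho>" using rho(1) by (simp add: pos_le_divide_eq)
      then have "2 * C * \<beta> y \<le> c / \<rho> * \<beta> y" using bpos by (intro mult_right_mono) auto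
      then show ?thesis by simp
    qed
    finally have "q y * dderiv N \<beta> y \<le> - (2 * C) * \<beta> y" .
    moreover have "dderiv N q y * \<beta> y \<le> C * \<beta> y" using qy bpos by (intro mult_right_mono) auto
    moreover have "dderiv N G y = dderiv N q y * \<beta> y + q y * dderiv N \<beta> y"
      unfolding G_eq by (rule dderiv_mult[OF polyn_differentiable[OF pq] C1c_differentiable[OF b1]])
    moreover have "C * \<beta> y > 0" using C bpos by simp
    ultimately show ?thesis by linarith
  qed
  have nonpos: "0 \<le> - (indicator A y * dderiv N G y)" for y
  proof (cases "y \<in> A \<and> \<beta> y \<noteq> 0")
    case True
    then show ?thesis using neg[of y] by simp
  next
    case False
    have "dderiv N \<beta> y = 0" if b: "\<beta> y = 0"
    proof -
      have "s y \<le> 0" using b flat_exp_pos unfolding \<beta>_def by (metis less_irrefl not_le)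
      then show ?thesis
        using dderiv_eqI[OF has_derivative_flat_exp_poly[OF ps, of 0 y], of N] by (simp add: \<beta>_def flat_exp_eq_0)
    qed
    then have "dderiv N G y = 0" if b: "\<beta> y = 0"
      unfolding G_eq dderiv_mult[OF polyn_differentiable[OF pq] C1c_differentiable[OF b1]] using b by simp
    then show ?thesis using False by (cases "y \<in> A") auto
  qed
  have oA: "open A" unfolding A_def by (intro open_Collect_less continuous_intros)
  then have int: "integrable lebesgue (\<lambda>y. - (indicator A y * dderiv N G y))"
    using indicator_dderiv_integrable[OF G1, of A N] by simp
  have "AE y in lebesgue. - (indicator A y * dderiv N G y) = 0"
    using integral_nonneg_eq_0_iff_AE[OF int] nonpos \<open>(\<integral>y. indicator A y * dderiv N G y \<partial>lebesgue) = 0\<close> by simp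
  then have "AE y in lebesgue. y \<notin> A \<inter> ball x0 \<rho>"
  proof eventually_elim
    case (elim y)
    show ?case
    proof
      assume y: "y \<in> A \<inter> ball x0 \<rho>"
      then have "(norm (y - x0))\<^sup>2 < \<rho>\<^sup>2"
        using rho by (intro power_strict_mono) (auto simp: dist_norm norm_minus_commute)
      then have "\<beta> y \<noteq> 0" using flat_exp_pos[of "s y" 0] by (auto simp: \<beta>_def s_eq)
      then show False using neg[of y] y elim by auto
    qed
  qed
  then have "negligible (A \<inter> ball x0 \<rho>)"
    using oA by (simp add: negligible_iff_null_sets completion.null_sets_iff_AE)
  moreover have "y0 + (\<rho> / 4) *\<^sub>R N \<in> A \<inter> ball x0 \<rho>"
  proof -
    have "x0 - (y0 + (\<rho> / 4) *\<^sub>R N) = - ((3 * \<rho> / 4) *\<^sub>R N)"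
      by (simp add: x0_def scaleR_add_left[symmetric] algebra_simps)
    then show ?thesis using N rho by (simp add: A_def dist_norm dot_square_norm)
  qed
  moreover have "open (A \<inter> ball x0 \<rho>)" using oA by auto
  ultimately show False using open_not_negligible by blast
qed

section \<open>Weak derivatives of piecewise polynomials\<close>

lemma ae_eq_iff: "S \<in> sets lebesgue \<Longrightarrow> ae_eq S u v \<longleftrightarrow> (AE y in lebesgue. y \<in> S \<longrightarrow> u y = v y)"
  unfolding ae_eq_def by (subst AE_restrict_space_iff) auto

context alfeld_fan begin

definition tetra :: "(real^3) set" where "tetra = {y. \<forall>k. 0 \<le> lam k y}"
definition wedge :: "4 \<Rightarrow> (real^3) set" where "wedge k = {y. \<forall>j. lam k y \<le> lam j y}"
definition cell :: "4 \<Rightarrow> (real^3) set" where "cell k = tetra \<inter> wedge k"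
definition open_wedge :: "4 \<Rightarrow> (real^3) set" where "open_wedge k = {y. \<forall>j. j \<noteq> k \<longrightarrow> lam k y < lam j y}"

lemma continuous_lam [continuous_intros]: "continuous_on S (lam k)"
  unfolding lam_def[abs_def] by (intro continuous_intros)

lemma sum_lam: "(\<Sum>k\<in>UNIV. lam k y) = 1"
  using sum_n by (simp add: lam_def sum.distrib inner_sum_left[symmetric])

lemma lam_affine: "s + t = 1 \<Longrightarrow> lam k (s *\<^sub>R a + t *\<^sub>R b) = s * lam k a + t * lam k b"
proof -
  assume st: "s + t = 1"
  then have t: "t = 1 - s" by simp
  show ?thesis unfolding t lam_def by (simp add: inner_diff_right inner_add_right field_simps)
qed

lemma lam_z: "lam k z = 1/4"
  by (simp add: lam_def)

lemma closed_tetra: "closed tetra"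
proof -
  have "tetra = (\<Inter>k. {y. 0 \<le> lam k y})" by (auto simp: tetra_def)
  then show ?thesis by (auto intro!: closed_INT closed_Collect_le continuous_intros)
qed

lemma closed_wedge: "closed (wedge k)"
proof -
  have "wedge k = (\<Inter>j. {y. lam k y \<le> lam j y})" by (auto simp: wedge_def)
  then show ?thesis by (auto intro!: closed_INT closed_Collect_le continuous_intros)
qed

lemma open_open_wedge: "open (open_wedge k)"
proof -
  have "open_wedge k = (\<Inter>j\<in>UNIV - {k}. {y. lam k y < lam j y})" by (auto simp: open_wedge_def)
  then show ?thesis by (auto intro!: open_INT open_Collect_less continuous_intros)
qed

lemma bounded_tetra: "bounded tetra"
proof -
  have "norm (y - z) \<le> (\<Sum>j\<in>UNIV. norm (v j))" if y: "y \<in> tetra" for y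
  proof -
    have "\<bar>n j \<bullet> (y - z)\<bar> \<le> 1" for j
    proof -
      have "lam j y \<le> (\<Sum>k\<in>UNIV. lam k y)"
        using y by (intro member_le_sum) (auto simp: tetra_def)
      then have "lam j y \<le> 1" by (simp add: sum_lam)
      moreover have "0 \<le> lam j y" using y by (simp add: tetra_def)
      ultimately show ?thesis by (simp add: lam_def)
    qed
    then have "norm ((n j \<bullet> (y - z)) *\<^sub>R v j) \<le> norm (v j)" for j
      by (simp add: mult_left_le_one_le)
    then have "norm (\<Sum>j\<in>UNIV. (n j \<bullet> (y - z)) *\<^sub>R v j) \<le> (\<Sum>j\<in>UNIV. norm (v j))"
      by (intro sum_norm_le)
    then show ?thesis by (simp only: expand)
  qed
  then show ?thesis unfolding bounded_def dist_norm
    by (intro exI[of _ z] exI[of _ "\<Sum>j\<in>UNIV. norm (v j)"]) (simp add: norm_minus_commute)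
qed

lemma compact_tetra: "compact tetra"
  using closed_tetra bounded_tetra by (simp add: compact_eq_bounded_closed)

lemma convex_tetra: "convex tetra"
  unfolding tetra_def by (rule convexI) (auto simp: lam_affine)

lemma convex_wedge: "convex (wedge k)"
  unfolding wedge_def by (rule convexI) (auto simp: lam_affine intro!: add_mono mult_left_mono)

lemma sets_cells [simp]: "tetra \<in> sets lebesgue" "cell k \<in> sets lebesgue" "wedge k \<in> sets lebesgue"
proof -
  have "tetra \<in> sets borel" "wedge k \<in> sets borel" using closed_tetra closed_wedge by auto
  then show "tetra \<in> sets lebesgue" "cell k \<in> sets lebesgue" "wedge k \<in> sets lebesgue"
    unfolding cell_def by (auto intro: sets_completionI_sets)
qed

text \<open>The sets are convex.\<close>
lemma frontier_null: "negligible (frontier tetra)" "negligible (frontier (cell k))"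
  unfolding cell_def by (intro negligible_convex_frontier convex_tetra convex_Int convex_wedge)+

lemma wedge_cover: "\<exists>k. y \<in> wedge k"
proof -
  have "Min (range (\<lambda>k. lam k y)) \<in> range (\<lambda>k. lam k y)" by (rule Min_in) auto
  then obtain k where k: "Min (range (\<lambda>k. lam k y)) = lam k y" by (rule rangeE)
  have "lam k y \<le> lam j y" for j unfolding k[symmetric] by (rule Min_le) auto
  then show ?thesis by (auto simp: wedge_def)
qed

lemma tetra_eq: "tetra = (\<Union>k. cell k)"
  using wedge_cover by (auto simp: cell_def)

text \<open>The six planes through \<open>z\<close> are null sets.\<close>
lemma AE_open_wedge: "AE y in lebesgue. \<exists>k. y \<in> open_wedge k"
proof -
  have "AE y in lebesgue. lam a y \<noteq> lam b y" if "a \<noteq> b" for a b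
  proof -
    have "n a - n b \<noteq> 0" using that n_eq_iff by simp
    then have "negligible {y. (n a - n b) \<bullet> y = (n a - n b) \<bullet> z}" by (intro negligible_hyperplane) simp
    then have "AE y in lebesgue. y \<notin> {y. (n a - n b) \<bullet> y = (n a - n b) \<bullet> z}"
      using negligible_iff_null_sets AE_not_in by blast
    then show ?thesis by eventually_elim (simp add: lam_eq_iff inner_diff_right)
  qed
  then have "AE y in lebesgue. a \<noteq> b \<longrightarrow> lam a y \<noteq> lam b y" for a b by (cases "a = b") auto
  then have "AE y in lebesgue. \<forall>b\<in>UNIV. a \<noteq> b \<longrightarrow> lam a y \<noteq> lam b y" for a
    by (rule AE_finite_allI[OF finite])
  then have "AE y in lebesgue. \<forall>a\<in>UNIV. \<forall>b\<in>UNIV. a \<noteq> b \<longrightarrow> lam a y \<noteq> lam b y"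
    by (rule AE_finite_allI[OF finite])
  then show ?thesis
  proof eventually_elim
    case (elim y)
    obtain k where "y \<in> wedge k" using wedge_cover by blast
    then have "y \<in> open_wedge k" unfolding open_wedge_def wedge_def using elim by (auto simp: less_le)
    then show ?case by blast
  qed
qed

lemma open_wedge_wedge: "open_wedge k \<subseteq> wedge k"
  unfolding open_wedge_def wedge_def by (auto simp: less_imp_le)

lemma open_wedge_unique: "y \<in> open_wedge k \<Longrightarrow> y \<in> open_wedge j \<longleftrightarrow> j = k"
  unfolding open_wedge_def using less_asym by fastforce

subsection \<open>Representation by polynomials on the cells\<close>

text \<open>The family \<open>p\<close> describes the class of \<open>u\<close>; by \<open>rep_unique\<close> a family of polynomials is determined
  by it.\<close>
definition rep :: "(4 \<Rightarrow> real^3 \<Rightarrow> 'b) \<Rightarrow> (real^3 \<Rightarrow> 'b) \<Rightarrow> bool" where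
  "rep p u \<longleftrightarrow> (\<forall>k. ae_eq (cell k) u (p k))"

lemma rep_iff_AE: "rep p u \<longleftrightarrow> (AE y in lebesgue. \<forall>k. y \<in> cell k \<longrightarrow> u y = p k y)"
proof -
  have "rep p u \<longleftrightarrow> (\<forall>k\<in>UNIV. AE y in lebesgue. y \<in> cell k \<longrightarrow> u y = p k y)"
    by (simp add: rep_def ae_eq_iff)
  also have "\<dots> \<longleftrightarrow> (AE y in lebesgue. \<forall>k\<in>UNIV. y \<in> cell k \<longrightarrow> u y = p k y)"
    by (rule AE_ball_countable[symmetric]) simp
  finally show ?thesis by simp
qed

text \<open>A measurable representative. Its value zero on the planes between the cells is arbitrary.\<close>
definition pw :: "(4 \<Rightarrow> real^3 \<Rightarrow> real) \<Rightarrow> real^3 \<Rightarrow> real" where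
  "pw p y = (\<Sum>k\<in>UNIV. indicator (open_wedge k) y * p k y)"

lemma pw_eq: "y \<in> open_wedge k \<Longrightarrow> pw p y = p k y"
proof -
  assume y: "y \<in> open_wedge k"
  have "pw p y = (\<Sum>j\<in>UNIV. if j = k then p k y else 0)"
    unfolding pw_def by (rule sum.cong) (auto simp: open_wedge_unique[OF y] indicator_def)
  then show ?thesis by simp
qed

lemma rep_pw: "rep p (pw p)"
  unfolding rep_iff_AE using AE_open_wedge
proof eventually_elim
  case (elim y)
  then obtain k where k: "y \<in> open_wedge k" by blast
  have "j = k" if "y \<in> cell j" for j
    using that k unfolding cell_def wedge_def open_wedge_def by (auto simp: not_less[symmetric])
  then show ?case using pw_eq[OF k] by auto
qed

lemma rep_AE_eq:
  assumes "rep p u" "rep p u'"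
  shows "AE y in lebesgue. y \<in> tetra \<longrightarrow> u y = u' y"
  using assms[unfolded rep_iff_AE] by eventually_elim (auto simp: tetra_eq)

lemma rep_cong_AE:
  assumes "rep p u" "AE y in lebesgue. y \<in> tetra \<longrightarrow> u y = u' y"
  shows "rep p u'"
  unfolding rep_iff_AE using assms(1)[unfolded rep_iff_AE] assms(2)
  by eventually_elim (auto simp: cell_def)

lemma rep_comp2:
  assumes "rep p u" "rep q w"
  shows "rep (\<lambda>k y. f (p k y) (q k y)) (\<lambda>y. f (u y) (w y))"
  unfolding rep_iff_AE using assms[unfolded rep_iff_AE] by eventually_elim auto

lemma rep_nth_iff:
  fixes p :: "4 \<Rightarrow> real^3 \<Rightarrow> real^3"
  shows "rep p u \<longleftrightarrow> (\<forall>j. rep (\<lambda>k y. p k y $ j) (\<lambda>y. u y $ j))"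
proof -
  have "(\<forall>j. rep (\<lambda>k y. p k y $ j) (\<lambda>y. u y $ j)) \<longleftrightarrow>
    (\<forall>j\<in>UNIV. AE y in lebesgue. \<forall>k. y \<in> cell k \<longrightarrow> u y $ j = p k y $ j)"
    by (simp add: rep_iff_AE)
  also have "\<dots> \<longleftrightarrow> (AE y in lebesgue. \<forall>j\<in>UNIV. \<forall>k. y \<in> cell k \<longrightarrow> u y $ j = p k y $ j)"
    by (rule AE_ball_countable[symmetric]) simp
  also have "\<dots> \<longleftrightarrow> rep p u" unfolding rep_iff_AE vec_eq_iff by (rule AE_cong) auto
  finally show ?thesis ..
qed

lemma rep_measurable:
  fixes p :: "4 \<Rightarrow> real^3 \<Rightarrow> real"
  assumes p: "\<And>k. continuous_on UNIV (p k)" and u: "rep p u"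
  shows "u \<in> borel_measurable (lebesgue_on tetra)"
proof -
  have [measurable]: "p k \<in> borel_measurable borel" "open_wedge k \<in> sets borel" "tetra \<in> sets borel" for k
    using p open_open_wedge closed_tetra by (auto intro: borel_measurable_continuous_onI)
  have "(\<lambda>y. indicator tetra y * pw p y) \<in> borel_measurable borel"
    unfolding pw_def by measurable
  then have "(\<lambda>y. indicator tetra y * pw p y) \<in> borel_measurable lebesgue"
    by (intro measurable_completion) simp
  moreover have "AE y in lebesgue. indicator tetra y * pw p y = indicator tetra y * u y"
    using rep_AE_eq[OF u rep_pw] by eventually_elim (auto simp: indicator_def)
  ultimately have "(\<lambda>y. indicator tetra y * u y) \<in> borel_measurable lebesgue"
    by (rule borel_measurable_AE)
  then show ?thesis by (subst borel_measurable_restrict_space_iff) (auto simp: mult.commute)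
qed

lemma finite_measure_tetra: "finite_measure (lebesgue_on tetra)"
proof
  have "emeasure lebesgue tetra < \<infinity>"
    using bounded_set_imp_lmeasurable[OF bounded_tetra] by (simp add: fmeasurable_def)
  then show "emeasure (lebesgue_on tetra) (space (lebesgue_on tetra)) \<noteq> \<infinity>"
    by (simp add: emeasure_restrict_space space_restrict_space)
qed

lemma rep_bounded:
  fixes p :: "4 \<Rightarrow> real^3 \<Rightarrow> real"
  assumes p: "\<And>k. continuous_on UNIV (p k)" and u: "rep p u"
  shows "\<exists>B. AE y in lebesgue_on tetra. norm (u y :: real) \<le> B"
proof -
  have "bounded (\<Union>k. p k ` tetra)"
    using p compact_tetra
    by (intro bounded_UN ballI compact_imp_bounded compact_continuous_image) (auto intro: continuous_on_subset)
  then obtain B where "\<forall>w\<in>(\<Union>k. p k ` tetra). norm w \<le> B" unfolding bounded_iff by (rule exE)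
  then have B: "norm (p k y) \<le> B" if "y \<in> tetra" for k y using that by auto
  have "AE y in lebesgue. y \<in> tetra \<longrightarrow> norm (u y) \<le> B"
    using u[unfolded rep_iff_AE]
  proof eventually_elim
    case (elim y)
    show ?case
    proof
      assume y: "y \<in> tetra"
      then obtain k where "y \<in> cell k" using tetra_eq by blast
      then show "norm (u y) \<le> B" using elim B[OF y, of k] by simp
    qed
  qed
  then show ?thesis by (subst AE_restrict_space_iff) auto
qed

lemma rep_integrable:
  fixes p :: "4 \<Rightarrow> real^3 \<Rightarrow> real"
  assumes p: "\<And>k. continuous_on UNIV (p k)" and u: "rep p u"
  shows "integrable (lebesgue_on tetra) u"
proof -
  obtain B where "AE y in lebesgue_on tetra. norm (u y) \<le> B" using rep_bounded[OF p u] by blast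
  then show ?thesis using rep_measurable[OF p u]
    by (intro finite_measure.integrable_const_bound[OF finite_measure_tetra]) auto
qed

lemma rep_integrable_mult:
  fixes p :: "4 \<Rightarrow> real^3 \<Rightarrow> real"
  assumes p: "\<And>k. continuous_on UNIV (p k)" and u: "rep p u" and f: "continuous_on UNIV f"
  shows "integrable (lebesgue_on tetra) (\<lambda>y. u y * f y :: real)"
proof (rule rep_integrable)
  show "continuous_on UNIV (\<lambda>y. p k y * f y)" for k by (intro continuous_intros p f)
  show "rep (\<lambda>k y. p k y * f y) (\<lambda>y. u y * f y)"
    unfolding rep_iff_AE using u[unfolded rep_iff_AE] by eventually_elim auto
qed

lemma rep_L2:
  fixes p :: "4 \<Rightarrow> real^3 \<Rightarrow> real"
  assumes p: "\<And>k. continuous_on UNIV (p k)" and u: "rep p u"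
  shows "u \<in> L2 tetra"
proof -
  have "integrable (lebesgue_on tetra) (\<lambda>y. (u y)\<^sup>2)"
  proof (rule rep_integrable)
    show "continuous_on UNIV (\<lambda>y. (p k y)\<^sup>2)" for k by (intro continuous_intros p)
    show "rep (\<lambda>k y. (p k y)\<^sup>2) (\<lambda>y. (u y)\<^sup>2)"
      unfolding rep_iff_AE using u[unfolded rep_iff_AE] by eventually_elim auto
  qed
  then show ?thesis using rep_measurable[OF p u] by (simp add: L2_def)
qed

lemma L2_integrable_mult:
  assumes g: "g \<in> L2 tetra" and f: "continuous_on UNIV f"
  shows "integrable (lebesgue_on tetra) (\<lambda>y. g y * f y)"
proof -
  have gm [measurable]: "g \<in> borel_measurable (lebesgue_on tetra)"
    and g2: "integrable (lebesgue_on tetra) (\<lambda>y. (g y)\<^sup>2)"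
    using g by (auto simp: L2_def)
  have 1: "rep (\<lambda>_. f) f" by (simp add: rep_iff_AE)
  have fm [measurable]: "f \<in> borel_measurable (lebesgue_on tetra)" by (rule rep_measurable[OF f 1])
  have "integrable (lebesgue_on tetra) (\<lambda>y. (f y)\<^sup>2)"
    using rep_L2[OF f 1] by (simp add: L2_def)
  with g2 have "integrable (lebesgue_on tetra) (\<lambda>y. (g y)\<^sup>2 + (f y)\<^sup>2)" by simp
  then show ?thesis
  proof (rule Bochner_Integration.integrable_bound)
    show "(\<lambda>y. g y * f y) \<in> borel_measurable (lebesgue_on tetra)" by measurable
    have "\<bar>a * b\<bar> \<le> a\<^sup>2 + b\<^sup>2" for a b :: real
    proof -
      have "2 * (\<bar>a\<bar> * \<bar>b\<bar>) \<le> a\<^sup>2 + b\<^sup>2" using sum_squares_bound[of "\<bar>a\<bar>" "\<bar>b\<bar>"] by (simp add: mult.assoc)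
      moreover have "0 \<le> \<bar>a\<bar> * \<bar>b\<bar>" by simp
      ultimately show ?thesis unfolding abs_mult by linarith
    qed
    then show "AE y in lebesgue_on tetra. norm (g y * f y) \<le> norm ((g y)\<^sup>2 + (f y)\<^sup>2)"
      by (intro AE_I2) simp
  qed
qed

subsection \<open>Integration by parts on the fan\<close>

text \<open>For conforming families the choice of the cell is immaterial, and the result is continuous on the
  whole space, not only on the tetrahedron.\<close>
definition glue :: "(4 \<Rightarrow> real^3 \<Rightarrow> 'b) \<Rightarrow> real^3 \<Rightarrow> 'b" where
  "glue p y = p (SOME k. y \<in> wedge k) y"

lemma glue_eq: "conforming p \<Longrightarrow> y \<in> wedge k \<Longrightarrow> glue p y = p k y"
proof -
  assume p: "conforming p" and k: "y \<in> wedge k"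
  have "y \<in> wedge (SOME k. y \<in> wedge k)" using k by (rule someI)
  then have "lam (SOME k. y \<in> wedge k) y = lam k y" using k by (auto simp: wedge_def intro: antisym)
  then show ?thesis unfolding glue_def by (rule conformingD[OF p])
qed

lemma glue_continuous:
  assumes "conforming p" "\<And>k. continuous_on UNIV (p k)"
  shows "continuous_on UNIV (glue p)"
proof -
  have "continuous_on (\<Union>k\<in>UNIV. wedge k) (glue p)"
  proof (rule continuous_on_closed_Union)
    fix k
    have "continuous_on (wedge k) (p k)" by (rule continuous_on_subset[OF assms(2)]) simp
    then show "continuous_on (wedge k) (glue p)"
      by (rule continuous_on_eq) (simp add: glue_eq[OF assms(1)])
  qed (auto intro: closed_wedge)
  moreover have "(\<Union>k\<in>UNIV. wedge k) = UNIV" using wedge_cover by auto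
  ultimately show ?thesis by simp
qed

lemma rep_glue: "conforming p \<Longrightarrow> rep p (glue p)"
  unfolding rep_iff_AE cell_def by (auto simp: glue_eq)

text \<open>The product of the glued function with \<open>\<phi>\<close> is Lipschitz along every line, because a line meets the
  fan in finitely many segments on which the product is one of four Lipschitz functions. Its derivative exists
  off the planes between the cells, so \<open>integral_directional_derivative\<close> applies.\<close>
lemma weak_dderiv:
  assumes p: "\<And>k. polyn m (p k)" "conforming p" and u: "rep p u"
    and g: "rep (\<lambda>k. dderiv e (p k)) g" and phi: "\<phi> \<in> test_functions tetra"
  shows "(LINT y|lebesgue_on tetra. u y * dderiv e \<phi> y) = - (LINT y|lebesgue_on tetra. g y * \<phi> y)"
proof -
  have c1: "C1c \<phi>" by (rule test_C1c[OF phi])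
  have pc1: "C1c (\<lambda>y. p k y * \<phi> y)" for k by (rule C1c_poly_mult[OF p(1) c1])
  obtain R where R: "\<And>y. R < norm y \<Longrightarrow> \<phi> y = 0" using c1 C1c_def by metis
  have pcont: "continuous_on UNIV (p k)" "continuous_on UNIV (dderiv e (p k))" for k
    using polyn_continuous_on[OF p(1)] polyn_continuous_on[OF polyn_dderiv'[OF p(1)]] by auto
  have phicont: "continuous_on UNIV \<phi>" "continuous_on UNIV (dderiv e \<phi>)"
    using C1c_continuous[OF c1] C1c_dderiv_continuous[OF c1] by auto
  define f where "f = (\<lambda>y. glue p y * \<phi> y)"
  define h where "h = (\<lambda>y. indicator tetra y * (u y * dderiv e \<phi> y + g y * \<phi> y))"
  have f_eq: "f y = p k y * \<phi> y" if "y \<in> wedge k" for y k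
    by (simp add: f_def glue_eq[OF p(2) that])
  have "\<forall>k. \<exists>L\<ge>0. \<forall>y s t. \<bar>p k (y + s *\<^sub>R e) * \<phi> (y + s *\<^sub>R e) - p k (y + t *\<^sub>R e) * \<phi> (y + t *\<^sub>R e)\<bar> \<le> L * \<bar>s - t\<bar>"
    using C1c_lipschitz[OF pc1] by blast
  then obtain L where L: "\<And>k. 0 \<le> L k"
    "\<And>k y s t. \<bar>p k (y + s *\<^sub>R e) * \<phi> (y + s *\<^sub>R e) - p k (y + t *\<^sub>R e) * \<phi> (y + t *\<^sub>R e)\<bar> \<le> L k * \<bar>s - t\<bar>"
    by metis
  define M where "M = (\<Sum>k\<in>UNIV. L k)"
  have LM: "L k \<le> M" for k unfolding M_def by (rule member_le_sum) (auto simp: L)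
  have M0: "0 \<le> M" unfolding M_def by (rule sum_nonneg) (auto simp: L)
  have lip: "\<bar>f (y + t *\<^sub>R e) - f y\<bar> \<le> M * \<bar>t\<bar>" for y t
  proof -
    let ?U = "\<lambda>k. {s. y + s *\<^sub>R e \<in> wedge k}"
    have "M-lipschitz_on {min 0 t..max 0 t} (\<lambda>s. f (y + s *\<^sub>R e))"
    proof (rule lipschitz_on_closed_Union[where U="?U" and I=UNIV])
      fix k
      show "closed (?U k)"
        using closed_vimage[OF closed_wedge, of "\<lambda>s. y + s *\<^sub>R e" k] by (simp add: vimage_def continuous_intros)
      show "M-lipschitz_on (?U k) (\<lambda>s. f (y + s *\<^sub>R e))"
      proof (rule lipschitz_onI[OF _ M0])
        fix s t assume "s \<in> ?U k" "t \<in> ?U k"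
        then have "dist (f (y + s *\<^sub>R e)) (f (y + t *\<^sub>R e)) \<le> L k * \<bar>s - t\<bar>"
          using L(2)[of k y s t] f_eq by (simp add: dist_real_def)
        also have "\<dots> \<le> M * \<bar>s - t\<bar>" using LM by (intro mult_right_mono) auto
        finally show "dist (f (y + s *\<^sub>R e)) (f (y + t *\<^sub>R e)) \<le> M * dist s t" by (simp add: dist_real_def)
      qed
    next
      show "{min 0 t..max 0 t} \<subseteq> (\<Union>k\<in>UNIV. ?U k)" using wedge_cover by auto
    qed (auto simp: M0)
    from lipschitz_onD[OF this, of t 0] show ?thesis by (simp add: dist_real_def)
  qed
  have gcont: "continuous_on UNIV (glue p)" by (rule glue_continuous[OF p(2) pcont(1)])
  have "integral\<^sup>L lebesgue h = 0"
  proof (rule integral_directional_derivative[OF _ _ lip])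
    show "integrable lborel f"
      using integrable_bounded_support[of f R UNIV] R gcont phicont by (simp add: f_def continuous_on_mult)
    show "f y = 0" if "R < norm y" for y using R[OF that] by (simp add: f_def)
    have "integrable (lebesgue_on tetra) (\<lambda>y. u y * dderiv e \<phi> y + g y * \<phi> y)"
      by (intro Bochner_Integration.integrable_add rep_integrable_mult[OF pcont(1) u phicont(2)]
          rep_integrable_mult[OF pcont(2) g phicont(1)])
    then have "integrable lebesgue h"
      by (simp add: integrable_restrict_space h_def)
    then show "h \<in> borel_measurable lebesgue" by simp
    show "AE y in lebesgue. (\<lambda>m. (f (y + inverse (real (Suc m)) *\<^sub>R e) - f y) * real (Suc m)) \<longlonglongrightarrow> h y"
      using AE_open_wedge u[unfolded rep_iff_AE] g[unfolded rep_iff_AE]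
    proof eventually_elim
      case (elim y)
      then obtain k where k: "y \<in> open_wedge k" by blast
      have yk: "y \<in> wedge k" using k open_wedge_wedge by blast
      have "dderiv e (\<lambda>y. p k y * \<phi> y) y = dderiv e (p k) y * \<phi> y + p k y * dderiv e \<phi> y"
        by (rule dderiv_mult[OF polyn_differentiable[OF p(1)] C1c_differentiable[OF c1]])
      moreover have "h y = p k y * dderiv e \<phi> y + dderiv e (p k) y * \<phi> y"
      proof (cases "y \<in> tetra")
        case True
        then have "y \<in> cell k" using yk by (simp add: cell_def)
        then show ?thesis using elim True by (simp add: h_def)
      next
        case False
        then have "y \<notin> interior tetra" using interior_subset by blast
        then show ?thesis using test_vanish[OF phi] False by (simp add: h_def)
      qed
      ultimately have hy: "h y = dderiv e (\<lambda>y. p k y * \<phi> y) y" by simp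
      have "(\<lambda>m. y + inverse (real (Suc m)) *\<^sub>R e) \<longlonglongrightarrow> y + 0 *\<^sub>R e"
        by (intro tendsto_intros LIMSEQ_inverse_real_of_nat)
      then have "eventually (\<lambda>m. y + inverse (real (Suc m)) *\<^sub>R e \<in> open_wedge k) sequentially"
        using open_open_wedge k by (intro topological_tendstoD) auto
      then have "eventually (\<lambda>m. (p k (y + inverse (real (Suc m)) *\<^sub>R e) * \<phi> (y + inverse (real (Suc m)) *\<^sub>R e) - p k y * \<phi> y) * real (Suc m)
         = (f (y + inverse (real (Suc m)) *\<^sub>R e) - f y) * real (Suc m)) sequentially"
        by eventually_elim (use f_eq[of _ k] open_wedge_wedge[of k] yk in auto)
      with difference_quotient_limit[OF pc1[of k], of y e] show ?case
        unfolding hy by (rule Lim_transform_eventually)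
    qed
  qed
  then have "(LINT y|lebesgue_on tetra. u y * dderiv e \<phi> y + g y * \<phi> y) = 0"
    by (simp add: integral_restrict_space h_def)
  moreover have "(LINT y|lebesgue_on tetra. u y * dderiv e \<phi> y + g y * \<phi> y) =
    (LINT y|lebesgue_on tetra. u y * dderiv e \<phi> y) + (LINT y|lebesgue_on tetra. g y * \<phi> y)"
    by (intro Bochner_Integration.integral_add rep_integrable_mult[OF pcont(1) u phicont(2)]
          rep_integrable_mult[OF pcont(2) g phicont(1)])
  ultimately show ?thesis by simp
qed

lemma rep_if_tested:
  assumes g: "g \<in> L2 tetra" and p: "\<And>k. continuous_on UNIV (p k)" and w: "rep p w"
    and eq: "\<And>\<phi>. \<phi> \<in> test_functions tetra \<Longrightarrow>
      (LINT y|lebesgue_on tetra. g y * \<phi> y) = (LINT y|lebesgue_on tetra. w y * \<phi> y)"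
  shows "rep p g"
proof -
  have i: "integrable (lebesgue_on tetra) (\<lambda>y. g y * f y)" "integrable (lebesgue_on tetra) (\<lambda>y. w y * f y)"
    if "continuous_on UNIV f" for f
    using L2_integrable_mult[OF g that] rep_integrable_mult[OF p w that] by auto
  have "AE y in lebesgue_on tetra. g y - w y = 0"
  proof (rule fundamental_lemma[OF sets_cells(1) frontier_null(1)])
    show "integrable (lebesgue_on tetra) (\<lambda>y. g y - w y)" using i[of "\<lambda>_. 1"] by simp
    fix \<phi> assume phi: "\<phi> \<in> test_functions tetra"
    have "continuous_on UNIV \<phi>" using C1c_continuous test_C1c[OF phi] by blast
    from i[OF this] show "(LINT y|lebesgue_on tetra. (g y - w y) * \<phi> y) = 0"
      using eq[OF phi] by (simp add: left_diff_distrib)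
  qed
  then have "AE y in lebesgue. y \<in> tetra \<longrightarrow> w y = g y"
    by (subst (asm) AE_restrict_space_iff) auto
  then show ?thesis by (rule rep_cong_AE[OF w])
qed

end

section \<open>Weak operators on piecewise polynomials\<close>

lemma zero_test: "(\<lambda>_. 0) \<in> test_functions S"
  by (rule elem_smooth_test[where K="{}"]) (auto intro: elem_smooth.poly polyn.const)

lemma open_AE_eq:
  fixes f g :: "real^3 \<Rightarrow> real"
  assumes S: "open S" and f: "continuous_on S f" "continuous_on S g"
    and ae: "AE y in lebesgue. y \<in> S \<longrightarrow> f y = g y" and y: "y \<in> S"
  shows "f y = g y"
proof -
  have "open (S \<inter> (\<lambda>y. f y - g y) -` (- {0}))"
    by (rule continuous_open_preimage[OF _ S]) (auto intro!: continuous_intros f)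
  moreover have "AE y in lebesgue. y \<notin> S \<inter> (\<lambda>y. f y - g y) -` (- {0})"
    using ae by eventually_elim auto
  then have "negligible (S \<inter> (\<lambda>y. f y - g y) -` (- {0}))"
    by (simp add: negligible_iff_null_sets completion.null_sets_iff_AE)
  ultimately have "S \<inter> (\<lambda>y. f y - g y) -` (- {0}) = {}" using open_not_negligible by blast
  then show ?thesis using y by auto
qed

lemma div_classical_scaleR:
  assumes "\<phi> differentiable (at y)" "\<And>k. (\<lambda>y. U y $ k) differentiable (at y)"
  shows "div_classical (\<lambda>y. \<phi> y *\<^sub>R U y) y = (\<Sum>k\<in>UNIV. U y $ k * partial k \<phi> y) + div_classical U y * \<phi> y"
  unfolding div_classical_def partial_eq_dderiv
  using assms by (simp add: dderiv_mult sum.distrib sum_distrib_left sum_distrib_right mult.commute)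

lemma partial_continuous: "C1c f \<Longrightarrow> continuous_on UNIV (partial k f)"
  unfolding partial_eq_dderiv by (rule C1c_dderiv_continuous)

lemma polys_continuous: "p \<in> polys r \<Longrightarrow> continuous_on S p"
  using polyn_continuous_on polys_polyn by blast

context alfeld_fan begin

lemma rep_LINT_eq:
  fixes p :: "4 \<Rightarrow> real^3 \<Rightarrow> real"
  assumes p: "\<And>k. continuous_on UNIV (p k)" and u: "rep p u" "rep p u'" and f: "continuous_on UNIV f"
  shows "(LINT y|lebesgue_on tetra. u y * f y) = (LINT y|lebesgue_on tetra. u' y * f y)"
proof (rule integral_cong_AE)
  show "(\<lambda>y. u y * f y) \<in> borel_measurable (lebesgue_on tetra)" "(\<lambda>y. u' y * f y) \<in> borel_measurable (lebesgue_on tetra)"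
    using rep_integrable_mult[OF p u(1) f] rep_integrable_mult[OF p u(2) f] by auto
  have "AE y in lebesgue. y \<in> tetra \<longrightarrow> u y * f y = u' y * f y"
    using rep_AE_eq[OF u] by eventually_elim auto
  then show "AE y in lebesgue_on tetra. u y * f y = u' y * f y"
    by (subst AE_restrict_space_iff) auto
qed

lemma rep_nth:
  fixes p :: "4 \<Rightarrow> real^3 \<Rightarrow> real^3"
  shows "rep p u \<Longrightarrow> rep (\<lambda>k y. p k y $ j) (\<lambda>y. u y $ j)"
  using rep_nth_iff by blast

lemma weak_partial:
  assumes p: "\<And>k. p k \<in> polys r" "conforming p" and u: "rep p u"
    and g: "rep (\<lambda>k. partial j (p k)) g" and phi: "\<phi> \<in> test_functions tetra"
  shows "(LINT y|lebesgue_on tetra. u y * partial j \<phi> y) = - (LINT y|lebesgue_on tetra. g y * \<phi> y)"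
  unfolding partial_eq_dderiv
  by (rule weak_dderiv[OF polys_polyn[OF p(1)] p(2) u _ phi]) (use g in \<open>simp add: partial_eq_dderiv\<close>)

lemma weak_grad_iff:
  assumes p: "\<And>k. p k \<in> polys r" "conforming p" and u: "rep p u"
  shows "(u, g) \<in> weak_grad tetra \<longleftrightarrow> (\<forall>j. rep (\<lambda>k. partial j (p k)) (\<lambda>y. g y $ j))"
proof -
  have c: "continuous_on UNIV (p k)" "continuous_on UNIV (partial j (p k))" for k j
    using polys_continuous[OF p(1)] polys_continuous[OF polys_partial[OF p(1)]] by auto
  show ?thesis
  proof
    assume g: "(u, g) \<in> weak_grad tetra"
    show "\<forall>j. rep (\<lambda>k. partial j (p k)) (\<lambda>y. g y $ j)"
    proof
      fix j
      show "rep (\<lambda>k. partial j (p k)) (\<lambda>y. g y $ j)"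
      proof (rule rep_if_tested[OF _ c(2) rep_pw])
        show "(\<lambda>y. g y $ j) \<in> L2 tetra" using g by (auto simp: weak_grad_def cube_def)
        fix \<phi> assume phi: "\<phi> \<in> test_functions tetra"
        have "(LINT y|lebesgue_on tetra. u y * partial j \<phi> y) = - (LINT y|lebesgue_on tetra. g y $ j * \<phi> y)"
          using g phi by (simp add: weak_grad_def)
        then show "(LINT y|lebesgue_on tetra. g y $ j * \<phi> y) = (LINT y|lebesgue_on tetra. pw (\<lambda>k. partial j (p k)) y * \<phi> y)"
          using weak_partial[OF p u rep_pw phi, of j] by simp
      qed
    qed
  next
    assume g: "\<forall>j. rep (\<lambda>k. partial j (p k)) (\<lambda>y. g y $ j)"
    have "u \<in> L2 tetra" by (rule rep_L2[OF c(1) u])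
    moreover have "(\<lambda>y. g y $ j) \<in> L2 tetra" for j
      by (rule rep_L2[where p="\<lambda>k. partial j (p k)"]) (use c(2) g in auto)
    moreover have "(LINT y|lebesgue_on tetra. u y * partial j \<phi> y) = - (LINT y|lebesgue_on tetra. g y $ j * \<phi> y)"
      if "\<phi> \<in> test_functions tetra" for \<phi> j using weak_partial[OF p u g[rule_format] that] .
    ultimately show "(u, g) \<in> weak_grad tetra" by (simp add: weak_grad_def cube_def)
  qed
qed

lemma curl_by_parts:
  assumes p: "\<And>k. p k \<in> cube (polys r)" "conforming p" and u: "rep p u"
    and w: "rep (\<lambda>k. curl_classical (p k)) w" and Phi: "\<Phi> \<in> cube (test_functions tetra)"
  shows "(LINT y|lebesgue_on tetra. u y \<bullet> curl_classical \<Phi> y) = (LINT y|lebesgue_on tetra. w y \<bullet> \<Phi> y)"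
proof -
  have pc: "(\<lambda>y. p k y $ a) \<in> polys r" for k a by (rule cube_polysD[OF p(1)])
  have c: "continuous_on UNIV (\<lambda>y. p k y $ a)" "continuous_on UNIV (partial b (\<lambda>y. p k y $ a))" for k a b
    using polys_continuous[OF pc] polys_continuous[OF polys_partial[OF pc]] by auto
  have uc: "rep (\<lambda>k y. p k y $ a) (\<lambda>y. u y $ a)" for a using u rep_nth_iff by blast
  have cf: "conforming (\<lambda>k y. p k y $ a)" for a by (rule conforming_nth[OF p(2)])
  have phi: "(\<lambda>y. \<Phi> y $ a) \<in> test_functions tetra" for a using Phi by (simp add: cube_def)
  have phic: "continuous_on UNIV (\<lambda>y. \<Phi> y $ a)" "continuous_on UNIV (partial b (\<lambda>y. \<Phi> y $ a))" for a b
    using C1c_continuous[OF test_C1c[OF phi]] partial_continuous[OF test_C1c[OF phi]] by auto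
  define W where "W = (\<lambda>a b. pw (\<lambda>k. partial b (\<lambda>y. p k y $ a)))"
  have W: "rep (\<lambda>k. partial b (\<lambda>y. p k y $ a)) (W a b)" for a b unfolding W_def by (rule rep_pw)
  define I where "I = (\<lambda>a b c. LINT y|lebesgue_on tetra. u y $ a * partial b (\<lambda>y. \<Phi> y $ c) y)"
  have I: "I a b c = - (LINT y|lebesgue_on tetra. W a b y * \<Phi> y $ c)" for a b c
    unfolding I_def by (rule weak_partial[OF pc cf uc W phi])
  have i1: "integrable (lebesgue_on tetra) (\<lambda>y. u y $ a * partial b (\<lambda>y. \<Phi> y $ c) y)" for a b c
    by (rule rep_integrable_mult[OF c(1) uc phic(2)])
  have i2: "integrable (lebesgue_on tetra) (\<lambda>y. W a b y * \<Phi> y $ c)" for a b c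
    by (rule rep_integrable_mult[OF c(2) W phic(1)])
  have wc: "rep (\<lambda>k y. curl_classical (p k) y $ j) (\<lambda>y. w y $ j)" for j by (rule rep_nth[OF w])
  have curlc: "continuous_on UNIV (\<lambda>y. curl_classical (p k) y $ j)" for k j
    by (rule polys_continuous[OF cube_polysD[OF curl_classical_polys[OF p(1)]]])
  have i3: "integrable (lebesgue_on tetra) (\<lambda>y. w y $ j * \<Phi> y $ j)" for j
    by (rule rep_integrable_mult[OF curlc wc phic(1)])
  have Wrep: "rep (\<lambda>k y. partial b (\<lambda>y. p k y $ a) y - partial b' (\<lambda>y. p k y $ a') y) (\<lambda>y. W a b y - W a' b' y)" for a b a' b'
    by (rule rep_comp2[OF W W])
  have part: "(LINT y|lebesgue_on tetra. w y $ j * \<Phi> y $ j) = I a' b' j - I a b j"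
    if j: "\<And>k y. curl_classical (p k) y $ j = partial b (\<lambda>y. p k y $ a) y - partial b' (\<lambda>y. p k y $ a') y" for j a b a' b'
  proof -
    have "rep (\<lambda>k y. curl_classical (p k) y $ j) (\<lambda>y. W a b y - W a' b' y)" unfolding j by (rule Wrep)
    from rep_LINT_eq[OF curlc wc this phic(1)]
    have "(LINT y|lebesgue_on tetra. w y $ j * \<Phi> y $ j) = (LINT y|lebesgue_on tetra. W a b y * \<Phi> y $ j - W a' b' y * \<Phi> y $ j)"
      by (simp add: left_diff_distrib)
    also have "\<dots> = I a' b' j - I a b j" using i2 by (simp add: I)
    finally show ?thesis .
  qed
  have "(LINT y|lebesgue_on tetra. w y \<bullet> \<Phi> y) = (LINT y|lebesgue_on tetra. (\<Sum>j\<in>UNIV. w y $ j * \<Phi> y $ j))"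
    by (simp add: inner_vec_def)
  also have "\<dots> = (\<Sum>j\<in>UNIV. LINT y|lebesgue_on tetra. w y $ j * \<Phi> y $ j)"
    by (rule Bochner_Integration.integral_sum[OF i3])
  also have "\<dots> = (I 2 3 1 - I 3 2 1) + (I 3 1 2 - I 1 3 2) + (I 1 2 3 - I 2 1 3)"
    unfolding sum_3 using part[of 1 2 3 3 2] part[of 2 3 1 1 3] part[of 3 1 2 2 1]
    by (simp add: curl_classical_nth)
  also have "\<dots> = (LINT y|lebesgue_on tetra. u y \<bullet> curl_classical \<Phi> y)"
    using i1 unfolding I_def inner_vec_def sum_3 curl_classical_nth inner_real_def right_diff_distrib
    by simp
  finally show ?thesis by simp
qed

lemma weak_curl_iff:
  assumes p: "\<And>k. p k \<in> cube (polys r)" "conforming p" and u: "rep p u"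
  shows "(u, g) \<in> weak_curl tetra \<longleftrightarrow> rep (\<lambda>k. curl_classical (p k)) g"
proof -
  have uc: "rep (\<lambda>k y. p k y $ a) (\<lambda>y. u y $ a)" for a using u rep_nth_iff by blast
  have c: "continuous_on UNIV (\<lambda>y. p k y $ a)" for k a by (rule polys_continuous[OF cube_polysD[OF p(1)]])
  have curlc: "continuous_on UNIV (\<lambda>y. curl_classical (p k) y $ j)" for k j
    by (rule polys_continuous[OF cube_polysD[OF curl_classical_polys[OF p(1)]]])
  show ?thesis
  proof
    assume g: "(u, g) \<in> weak_curl tetra"
    define w where "w = (\<lambda>y. \<chi> j. pw (\<lambda>k y. curl_classical (p k) y $ j) y)"
    have w: "rep (\<lambda>k. curl_classical (p k)) w" unfolding rep_nth_iff w_def vec_lambda_beta by (intro allI rep_pw)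
    have "rep (\<lambda>k y. curl_classical (p k) y $ j) (\<lambda>y. g y $ j)" for j
    proof (rule rep_if_tested[OF _ curlc rep_pw])
      show "(\<lambda>y. g y $ j) \<in> L2 tetra" using g by (auto simp: weak_curl_def cube_def)
      fix \<phi> assume phi: "\<phi> \<in> test_functions tetra"
      define \<Phi> :: "real^3 \<Rightarrow> real^3" where "\<Phi> = (\<lambda>y. axis j (\<phi> y))"
      have "\<Phi> \<in> cube (test_functions tetra)"
      proof -
        have "(\<lambda>y. \<Phi> y $ i) = (if i = j then \<phi> else (\<lambda>_. 0))" for i by (auto simp: \<Phi>_def axis_def)
        then show ?thesis using phi zero_test by (simp add: cube_def)
      qed
      moreover have "(LINT y|lebesgue_on tetra. u y \<bullet> curl_classical \<Phi> y) = (LINT y|lebesgue_on tetra. g y \<bullet> \<Phi> y)"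
        using g calculation by (simp add: weak_curl_def)
      ultimately show "(LINT y|lebesgue_on tetra. g y $ j * \<phi> y) = (LINT y|lebesgue_on tetra. pw (\<lambda>k y. curl_classical (p k) y $ j) y * \<phi> y)"
        using curl_by_parts[OF p u w] by (simp add: \<Phi>_def inner_axis w_def)
    qed
    then show "rep (\<lambda>k. curl_classical (p k)) g" using rep_nth_iff by blast
  next
    assume g: "rep (\<lambda>k. curl_classical (p k)) g"
    then have gc: "rep (\<lambda>k y. curl_classical (p k) y $ j) (\<lambda>y. g y $ j)" for j by (rule rep_nth)
    show "(u, g) \<in> weak_curl tetra"
      unfolding weak_curl_def cube_def
      using rep_L2[OF c uc] rep_L2[OF curlc gc] curl_by_parts[OF p u g] by (simp add: cube_def)
  qed
qed

lemma div_by_parts: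
  assumes p: "\<And>k. p k \<in> cube (polys r)" "conforming p" and u: "rep p u"
    and w: "rep (\<lambda>k. div_classical (p k)) w" and phi: "\<phi> \<in> test_functions tetra"
  shows "(LINT y|lebesgue_on tetra. (\<Sum>k\<in>UNIV. u y $ k * partial k \<phi> y)) = - (LINT y|lebesgue_on tetra. w y * \<phi> y)"
proof -
  have pc: "(\<lambda>y. p k y $ a) \<in> polys r" for k a by (rule cube_polysD[OF p(1)])
  have c: "continuous_on UNIV (\<lambda>y. p k y $ a)" "continuous_on UNIV (partial b (\<lambda>y. p k y $ a))" for k a b
    using polys_continuous[OF pc] polys_continuous[OF polys_partial[OF pc]] by auto
  have uc: "rep (\<lambda>k y. p k y $ a) (\<lambda>y. u y $ a)" for a using u rep_nth_iff by blast
  have cf: "conforming (\<lambda>k y. p k y $ a)" for a by (rule conforming_nth[OF p(2)])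
  have phic: "continuous_on UNIV \<phi>" "continuous_on UNIV (partial b \<phi>)" for b
    using C1c_continuous[OF test_C1c[OF phi]] partial_continuous[OF test_C1c[OF phi]] by auto
  define W where "W = (\<lambda>a. pw (\<lambda>k. partial a (\<lambda>y. p k y $ a)))"
  have W: "rep (\<lambda>k. partial a (\<lambda>y. p k y $ a)) (W a)" for a unfolding W_def by (rule rep_pw)
  have divc: "continuous_on UNIV (div_classical (p k))" for k by (rule polys_continuous[OF div_classical_polys[OF p(1)]])
  have "rep (\<lambda>k. div_classical (p k)) (\<lambda>y. \<Sum>a\<in>UNIV. W a y)"
    unfolding rep_iff_AE
    using W[of 1, unfolded rep_iff_AE] W[of 2, unfolded rep_iff_AE] W[of 3, unfolded rep_iff_AE]
    by eventually_elim (simp add: div_classical_def sum_3)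
  from rep_LINT_eq[OF divc w this phic(1)]
  have "(LINT y|lebesgue_on tetra. w y * \<phi> y) = (LINT y|lebesgue_on tetra. (\<Sum>a\<in>UNIV. W a y * \<phi> y))"
    by (simp add: sum_distrib_right)
  also have "\<dots> = (\<Sum>a\<in>UNIV. LINT y|lebesgue_on tetra. W a y * \<phi> y)"
    by (rule Bochner_Integration.integral_sum[OF rep_integrable_mult[OF c(2) W phic(1)]])
  also have "\<dots> = (\<Sum>a\<in>UNIV. - (LINT y|lebesgue_on tetra. u y $ a * partial a \<phi> y))"
    using weak_partial[OF pc cf uc W phi] by simp
  also have "\<dots> = - (LINT y|lebesgue_on tetra. (\<Sum>k\<in>UNIV. u y $ k * partial k \<phi> y))"
    unfolding sum_negf Bochner_Integration.integral_sum[OF rep_integrable_mult[OF c(1) uc phic(2)]] ..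
  finally show ?thesis by simp
qed

lemma weak_div_iff:
  assumes p: "\<And>k. p k \<in> cube (polys r)" "conforming p" and u: "rep p u"
  shows "(u, d) \<in> weak_div tetra \<longleftrightarrow> rep (\<lambda>k. div_classical (p k)) d"
proof -
  have uc: "rep (\<lambda>k y. p k y $ a) (\<lambda>y. u y $ a)" for a using u rep_nth_iff by blast
  have c: "continuous_on UNIV (\<lambda>y. p k y $ a)" for k a by (rule polys_continuous[OF cube_polysD[OF p(1)]])
  have divc: "continuous_on UNIV (div_classical (p k))" for k by (rule polys_continuous[OF div_classical_polys[OF p(1)]])
  show ?thesis
  proof
    assume d: "(u, d) \<in> weak_div tetra"
    show "rep (\<lambda>k. div_classical (p k)) d"
    proof (rule rep_if_tested[OF _ divc rep_pw])
      show "d \<in> L2 tetra" using d by (auto simp: weak_div_def)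
      fix \<phi> assume phi: "\<phi> \<in> test_functions tetra"
      then have "(LINT y|lebesgue_on tetra. (\<Sum>k\<in>UNIV. u y $ k * partial k \<phi> y)) = - (LINT y|lebesgue_on tetra. d y * \<phi> y)"
        using d by (simp add: weak_div_def)
      then show "(LINT y|lebesgue_on tetra. d y * \<phi> y) = (LINT y|lebesgue_on tetra. pw (\<lambda>k. div_classical (p k)) y * \<phi> y)"
        using div_by_parts[OF p u rep_pw phi] by simp
    qed
  next
    assume d: "rep (\<lambda>k. div_classical (p k)) d"
    show "(u, d) \<in> weak_div tetra"
      unfolding weak_div_def cube_def
      using rep_L2[OF c uc] rep_L2[OF divc d] div_by_parts[OF p u d] by simp
  qed
qed

subsection \<open>Weakly differentiable divergence without continuity\<close>

lemma conforming_const: "conforming (\<lambda>_. p)"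
  by (simp add: conforming_def)

lemma rep_const: "rep (\<lambda>_. p) p"
  by (simp add: rep_iff_AE)

lemma weak_div_single:
  assumes p: "p \<in> cube (polys r)" and phi: "\<phi> \<in> test_functions tetra"
  shows "(LINT y|lebesgue_on tetra. (\<Sum>k\<in>UNIV. p y $ k * partial k \<phi> y)) = - (LINT y|lebesgue_on tetra. div_classical p y * \<phi> y)"
  by (rule div_by_parts[OF p conforming_const rep_const rep_const phi])

text \<open>Comparison of \<open>u\<close> with the polynomial field of one cell, extended to the whole tetrahedron; for a
  single polynomial field integration by parts is already available.\<close>
lemma weak_div_difference:
  assumes p: "\<And>k. p k \<in> cube (polys r)" and u: "rep p u" and d: "(u, d) \<in> weak_div tetra"
    and phi: "\<phi> \<in> test_functions tetra"
  shows "(LINT y|lebesgue_on tetra. (\<Sum>k\<in>UNIV. (u y $ k - p b y $ k) * partial k \<phi> y) + (d y - div_classical (p b) y) * \<phi> y) = 0"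
proof -
  have uc: "rep (\<lambda>k y. p k y $ a) (\<lambda>y. u y $ a)" for a using u rep_nth_iff by blast
  have c: "continuous_on UNIV (\<lambda>y. p k y $ a)" for k a by (rule polys_continuous[OF cube_polysD[OF p(1)]])
  have divc: "continuous_on UNIV (div_classical (p k))" for k by (rule polys_continuous[OF div_classical_polys[OF p(1)]])
  have phic: "continuous_on UNIV \<phi>" "continuous_on UNIV (partial b \<phi>)" for b
    using C1c_continuous[OF test_C1c[OF phi]] partial_continuous[OF test_C1c[OF phi]] by auto
  have dL: "d \<in> L2 tetra" using d by (auto simp: weak_div_def)
  have i1: "integrable (lebesgue_on tetra) (\<lambda>y. \<Sum>k\<in>UNIV. u y $ k * partial k \<phi> y)"
    by (intro Bochner_Integration.integrable_sum rep_integrable_mult[OF c uc phic(2)])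
  have i2: "integrable (lebesgue_on tetra) (\<lambda>y. \<Sum>k\<in>UNIV. p b y $ k * partial k \<phi> y)"
    by (intro Bochner_Integration.integrable_sum rep_integrable_mult[OF c rep_const phic(2)])
  have i3: "integrable (lebesgue_on tetra) (\<lambda>y. d y * \<phi> y)"
    by (rule L2_integrable_mult[OF dL phic(1)])
  have i4: "integrable (lebesgue_on tetra) (\<lambda>y. div_classical (p b) y * \<phi> y)"
    by (rule rep_integrable_mult[OF divc rep_const phic(1)])
  have "(LINT y|lebesgue_on tetra. (\<Sum>k\<in>UNIV. (u y $ k - p b y $ k) * partial k \<phi> y) + (d y - div_classical (p b) y) * \<phi> y) =
    (LINT y|lebesgue_on tetra. ((\<Sum>k\<in>UNIV. u y $ k * partial k \<phi> y) - (\<Sum>k\<in>UNIV. p b y $ k * partial k \<phi> y)) + (d y * \<phi> y - div_classical (p b) y * \<phi> y))"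
    by (simp only: left_diff_distrib sum_subtractf)
  also have "\<dots> = ((LINT y|lebesgue_on tetra. (\<Sum>k\<in>UNIV. u y $ k * partial k \<phi> y)) - (LINT y|lebesgue_on tetra. (\<Sum>k\<in>UNIV. p b y $ k * partial k \<phi> y)))
     + ((LINT y|lebesgue_on tetra. d y * \<phi> y) - (LINT y|lebesgue_on tetra. div_classical (p b) y * \<phi> y))"
    by (simp only: Bochner_Integration.integral_add Bochner_Integration.integral_diff
        Bochner_Integration.integrable_diff i1 i2 i3 i4)
  also have "\<dots> = 0"
    using weak_div_single[OF p phi, of b] d phi by (simp add: weak_div_def)
  finally show ?thesis .
qed

text \<open>A test function supported in one cell sees the polynomial of that cell only.\<close>
lemma weak_div_local:
  assumes p: "\<And>k. p k \<in> cube (polys r)" and u: "rep p u" and d: "(u, d) \<in> weak_div tetra"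
  shows "rep (\<lambda>k. div_classical (p k)) d"
  unfolding rep_def
proof
  fix k
  have sub: "interior (cell k) \<subseteq> interior tetra" by (rule interior_mono) (simp add: cell_def)
  have dL: "d \<in> L2 tetra" using d by (auto simp: weak_div_def)
  have divc: "continuous_on UNIV (div_classical (p k))" for k by (rule polys_continuous[OF div_classical_polys[OF p(1)]])
  have "integrable (lebesgue_on tetra) (\<lambda>y. d y - div_classical (p k) y)"
    using L2_integrable_mult[OF dL, of "\<lambda>_. 1"] rep_integrable[OF divc rep_const] by simp
  then have i: "integrable lebesgue (\<lambda>y. indicator tetra y * (d y - div_classical (p k) y))"
    by (simp add: integrable_restrict_space)
  have ind: "indicator (cell k) y * (indicator tetra y * a) = indicator (cell k) y * (a::real)" for y a
    by (auto simp: cell_def indicator_def)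
  have "AE y in lebesgue_on (cell k). d y - div_classical (p k) y = 0"
  proof (rule fundamental_lemma[OF sets_cells(2) frontier_null(2)])
    show "integrable (lebesgue_on (cell k)) (\<lambda>y. d y - div_classical (p k) y)"
      using integrable_mult_indicator[OF sets_cells(2) i, of k] by (simp add: integrable_restrict_space ind)
    fix \<phi> assume phi: "\<phi> \<in> test_functions (cell k)"
    then have phi': "\<phi> \<in> test_functions tetra" using test_functions_mono[OF sub] by blast
    have "(LINT y|lebesgue_on (cell k). (d y - div_classical (p k) y) * \<phi> y) =
      (\<integral>y. indicator (cell k) y * ((d y - div_classical (p k) y) * \<phi> y) \<partial>lebesgue)"
      by (simp add: integral_restrict_space)
    also have "\<dots> = (\<integral>y. indicator tetra y * ((d y - div_classical (p k) y) * \<phi> y) \<partial>lebesgue)"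
    proof (rule Bochner_Integration.integral_cong[OF refl])
      fix y
      show "indicator (cell k) y * ((d y - div_classical (p k) y) * \<phi> y) = indicator tetra y * ((d y - div_classical (p k) y) * \<phi> y)"
        using test_vanish(1)[OF phi, of y] interior_subset[of "cell k"]
        by (cases "y \<in> interior (cell k)") (auto simp: cell_def indicator_def)
    qed
    also have "\<dots> = (LINT y|lebesgue_on tetra. (d y - div_classical (p k) y) * \<phi> y)"
      by (simp add: integral_restrict_space)
    also have "\<dots> = (LINT y|lebesgue_on tetra. (\<Sum>j\<in>UNIV. (u y $ j - p k y $ j) * partial j \<phi> y) + (d y - div_classical (p k) y) * \<phi> y)"
    proof (rule integral_cong_AE)
      have phic: "continuous_on UNIV \<phi>" "continuous_on UNIV (partial b \<phi>)" for b
        using C1c_continuous[OF test_C1c[OF phi']] partial_continuous[OF test_C1c[OF phi']] by auto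
      have c: "continuous_on UNIV (\<lambda>y. p k y $ a)" for k a by (rule polys_continuous[OF cube_polysD[OF p(1)]])
      have uc: "rep (\<lambda>k y. p k y $ a) (\<lambda>y. u y $ a)" for a using u rep_nth_iff by blast
      have m: "(\<lambda>y. u y $ a) \<in> borel_measurable (lebesgue_on tetra)" "(\<lambda>y. p k y $ a) \<in> borel_measurable (lebesgue_on tetra)"
        "\<phi> \<in> borel_measurable (lebesgue_on tetra)" "partial a \<phi> \<in> borel_measurable (lebesgue_on tetra)"
        "div_classical (p k) \<in> borel_measurable (lebesgue_on tetra)" "d \<in> borel_measurable (lebesgue_on tetra)" for a
        using rep_measurable[OF c uc] rep_measurable[OF c rep_const] rep_measurable[OF phic(1) rep_const]
          rep_measurable[OF phic(2) rep_const] rep_measurable[OF divc rep_const] dL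
        by (auto simp: L2_def)
      show "(\<lambda>y. (d y - div_classical (p k) y) * \<phi> y) \<in> borel_measurable (lebesgue_on tetra)"
        by (intro borel_measurable_times borel_measurable_diff m)
      show "(\<lambda>y. (\<Sum>j\<in>UNIV. (u y $ j - p k y $ j) * partial j \<phi> y) + (d y - div_classical (p k) y) * \<phi> y) \<in> borel_measurable (lebesgue_on tetra)"
        by (intro borel_measurable_add borel_measurable_sum borel_measurable_times borel_measurable_diff m)
      have "AE y in lebesgue. y \<in> tetra \<longrightarrow> (d y - div_classical (p k) y) * \<phi> y =
         (\<Sum>j\<in>UNIV. (u y $ j - p k y $ j) * partial j \<phi> y) + (d y - div_classical (p k) y) * \<phi> y"
        using u[unfolded rep_iff_AE]
      proof eventually_elim
        case (elim y)
        show ?case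
        proof (cases "y \<in> interior (cell k)")
          case True
          then have "y \<in> cell k" using interior_subset by blast
          then show ?thesis using elim by simp
        next
          case False
          then show ?thesis using test_vanish[OF phi] by (simp add: partial_eq_dderiv)
        qed
      qed
      then show "AE y in lebesgue_on tetra. (d y - div_classical (p k) y) * \<phi> y =
         (\<Sum>j\<in>UNIV. (u y $ j - p k y $ j) * partial j \<phi> y) + (d y - div_classical (p k) y) * \<phi> y"
        by (subst AE_restrict_space_iff) auto
    qed
    also have "\<dots> = 0" by (rule weak_div_difference[OF p u d phi'])
    finally show "(LINT y|lebesgue_on (cell k). (d y - div_classical (p k) y) * \<phi> y) = 0" .
  qed
  then show "ae_eq (cell k) d (div_classical (p k))" unfolding ae_eq_def by eventually_elim simp
qed

subsection \<open>Interior faces\<close>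

text \<open>An open set inside the tetrahedron that meets no cells but \<open>a\<close> and \<open>b\<close> and contains the relative
  interior of their common face.\<close>
definition face_nbhd :: "4 \<Rightarrow> 4 \<Rightarrow> (real^3) set" where
  "face_nbhd a b = {y. 0 < lam a y \<and> 0 < lam b y \<and> (\<forall>c. c \<noteq> a \<longrightarrow> c \<noteq> b \<longrightarrow> lam a y < lam c y \<and> lam b y < lam c y)}"

lemma open_face_nbhd: "open (face_nbhd a b)"
proof -
  have "face_nbhd a b = {y. 0 < lam a y} \<inter> {y. 0 < lam b y} \<inter>
    (\<Inter>c\<in>UNIV - {a, b}. {y. lam a y < lam c y} \<inter> {y. lam b y < lam c y})"
    by (auto simp: face_nbhd_def)
  then show ?thesis by (auto intro!: open_Int open_INT open_Collect_less continuous_intros)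
qed

lemma face_nbhd_tetra: "face_nbhd a b \<subseteq> interior tetra"
proof -
  have "0 \<le> lam c y" if "y \<in> face_nbhd a b" for c y
  proof (cases "c = a \<or> c = b")
    case False
    then have "0 < lam a y" "lam a y < lam c y" using that by (auto simp: face_nbhd_def)
    then show ?thesis by linarith
  qed (use that in \<open>auto simp: face_nbhd_def\<close>)
  then have "face_nbhd a b \<subseteq> tetra" by (auto simp: tetra_def)
  then show ?thesis using open_face_nbhd interior_maximal by blast
qed

lemma face_nbhd_cell: "y \<in> face_nbhd a b \<Longrightarrow> lam a y \<le> lam b y \<Longrightarrow> y \<in> cell a"
  using face_nbhd_tetra interior_subset[of tetra]
  unfolding cell_def wedge_def face_nbhd_def by (auto intro: less_imp_le) (metis less_imp_le order_refl)

lemma lam_vertex: "lam j (z + s *\<^sub>R v k) = 1/4 + s * ((if j = k then 1 else 0) - 1/4)"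
  by (simp add: lam_def dual)

text \<open>Start a ray to \<open>y\<close> at an inner point \<open>c\<close> of the common face; the polynomial vanishes on an initial
  piece of the ray.\<close>
lemma vanish_on_plane:
  assumes q: "polyn m q" and 0: "\<And>y. y \<in> face_nbhd a b \<Longrightarrow> lam a y = lam b y \<Longrightarrow> q y = 0"
    and y: "lam a y = lam b y" and ab: "a \<noteq> b"
  shows "q y = 0"
proof -
  \<comment> \<open>Its barycentric coordinates are 1/8, 1/8, 3/8, 3/8, the smaller two belonging to \<open>a\<close> and \<open>b\<close>.\<close>
  define c where "c = z - (1/4) *\<^sub>R (v a + v b)"
  have lc: "lam j c = 1/4 - ((if j = a then 1 else 0) + (if j = b then 1 else 0) - 1/2) / 4" for j
    by (simp add: c_def lam_def inner_diff_right inner_add_right dual)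
  have "c \<in> face_nbhd a b" using ab by (auto simp: face_nbhd_def lc)
  moreover have "((\<lambda>t. c + t *\<^sub>R (y - c)) \<longlongrightarrow> c + 0 *\<^sub>R (y - c)) (at_right 0)"
    by (intro tendsto_intros)
  ultimately have "eventually (\<lambda>t. c + t *\<^sub>R (y - c) \<in> face_nbhd a b) (at_right 0)"
    using open_face_nbhd by (intro topological_tendstoD) auto
  then obtain \<delta> where d: "\<delta> > 0" "\<And>t. 0 < t \<Longrightarrow> t < \<delta> \<Longrightarrow> c + t *\<^sub>R (y - c) \<in> face_nbhd a b"
    unfolding eventually_at_right_field by blast
  have lin: "lam a (c + t *\<^sub>R (y - c)) = lam b (c + t *\<^sub>R (y - c))" for t
  proof -
    have "c + t *\<^sub>R (y - c) = (1 - t) *\<^sub>R c + t *\<^sub>R y" by (simp add: algebra_simps)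
    then show ?thesis using lam_affine[of "1 - t" t _ c y] lc[of a] lc[of b] y ab by simp
  qed
  show ?thesis by (rule polyn_eq_0_ray[OF q d(1)]) (use 0 d(2) lin in blast)
qed

text \<open>Near an inner point of the common face, subtracting the field \<open>p b\<close> leaves the field \<open>p a - p b\<close> cut
  off to a half-space. As the weak divergence has no part concentrated on the face,
  \<open>normal_component_vanishes\<close> applies.\<close>
lemma weak_div_jump:
  assumes p: "\<And>k. p k \<in> cube (polys r)" and u: "rep p u" and d: "(u, d) \<in> weak_div tetra"
    and y: "lam a y = lam b y"
  shows "(n a - n b) \<bullet> (p a y - p b y) = 0"
proof (cases "a = b")
  case ab: False
  have pc: "polyn (nat r) (\<lambda>y. p k y $ j)" for k j by (rule polys_polyn[OF cube_polysD[OF p]])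
  \<comment> \<open>\<open>M\<close> points from the cell \<open>b\<close> into the cell \<open>a\<close>, where \<open>lam a < lam b\<close>.\<close>
  define M where "M = n b - n a"
  have M0: "M \<noteq> 0" using ab n_eq_iff by (auto simp: M_def)
  define N where "N = (1 / norm M) *\<^sub>R M"
  have N1: "norm N = 1" using M0 by (simp add: N_def)
  define U where "U = (\<lambda>y. p a y - p b y)"
  have pU: "polyn (nat r) (\<lambda>y. U y $ j)" for j unfolding U_def using pc by (simp add: polyn_diff)
  have dU: "(\<lambda>y. U y $ j) differentiable (at y)" for j y by (rule polyn_differentiable[OF pU])
  have diveU: "div_classical U y = div_classical (p a) y - div_classical (p b) y" for y
    unfolding div_classical_def partial_eq_dderiv U_def vector_minus_component
    by (simp add: dderiv_diff polyn_differentiable[OF pc] sum_subtractf)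
  have rd: "rep (\<lambda>k. div_classical (p k)) d" by (rule weak_div_local[OF p u d])
  have at_face: "N \<bullet> U y0 = 0" if y0: "y0 \<in> face_nbhd a b" "lam a y0 = lam b y0" for y0
  proof -
    obtain s where s: "s > 0" "ball y0 s \<subseteq> face_nbhd a b"
      using y0 open_face_nbhd open_contains_ball by blast
    define A where "A = {y. 0 < N \<bullet> (y - y0)}"
    have A_iff: "y \<in> A \<longleftrightarrow> lam a y < lam b y" for y
    proof -
      have "M \<bullet> (y - y0) = (lam b y - lam a y) - (lam b y0 - lam a y0)"
        by (simp add: M_def lam_def inner_diff_left inner_diff_right)
      then have "M \<bullet> (y - y0) = lam b y - lam a y" using y0 by simp
      then show ?thesis using M0 by (simp add: A_def N_def zero_less_divide_iff)
    qed
    show ?thesis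
    proof (rule normal_component_vanishes[OF pU N1 s(1)])
      fix \<phi> assume phi: "\<phi> \<in> test_functions (ball y0 s)"
      have "ball y0 s \<subseteq> interior tetra" using s face_nbhd_tetra by blast
      then have phi': "\<phi> \<in> test_functions tetra" using phi test_functions_mono[of "ball y0 s" tetra] by auto
      have van: "\<phi> y = 0" "partial j \<phi> y = 0" if "y \<notin> ball y0 s" for y j
        using test_vanish[OF phi] that by (auto simp: partial_eq_dderiv)
      have dv: "div_classical (\<lambda>y. \<phi> y *\<^sub>R U y) y = (\<Sum>k\<in>UNIV. U y $ k * partial k \<phi> y) + div_classical U y * \<phi> y" for y
        by (rule div_classical_scaleR[OF C1c_differentiable[OF test_C1c[OF phi]] dU])
      have m: "(\<lambda>y. indicator A y * div_classical (\<lambda>y. \<phi> y *\<^sub>R U y) y) \<in> borel_measurable lebesgue"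
      proof -
        have "open A" unfolding A_def by (intro open_Collect_less continuous_intros)
        then have [measurable]: "A \<in> sets borel" by simp
        have "div_classical U = (\<lambda>y. div_classical (p a) y - div_classical (p b) y)" using diveU by blast
        then have dUc: "continuous_on UNIV (div_classical U)"
          using continuous_on_diff[OF polys_continuous[OF div_classical_polys[OF p]] polys_continuous[OF div_classical_polys[OF p]]] by simp
        then have "continuous_on UNIV (\<lambda>y. (\<Sum>k\<in>UNIV. U y $ k * partial k \<phi> y) + div_classical U y * \<phi> y)"
          by (intro continuous_on_add continuous_on_sum continuous_on_mult polyn_continuous_on[OF pU] dUc
              partial_continuous[OF test_C1c[OF phi]] C1c_continuous[OF test_C1c[OF phi]])
        then have "div_classical (\<lambda>y. \<phi> y *\<^sub>R U y) \<in> borel_measurable borel"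
          using dv by (simp add: borel_measurable_continuous_onI fun_eq_iff[symmetric])
        then have "(\<lambda>y. indicator A y * div_classical (\<lambda>y. \<phi> y *\<^sub>R U y) y) \<in> borel_measurable borel"
          by measurable
        then show ?thesis by (intro measurable_completion) simp
      qed
      let ?f = "\<lambda>y. (\<Sum>k\<in>UNIV. (u y $ k - p b y $ k) * partial k \<phi> y) + (d y - div_classical (p b) y) * \<phi> y"
      have ae: "AE y in lebesgue. indicator A y * div_classical (\<lambda>y. \<phi> y *\<^sub>R U y) y = indicator tetra y * ?f y"
        using AE_open_wedge u[unfolded rep_iff_AE] rd[unfolded rep_iff_AE]
      proof eventually_elim
        case (elim y)
        show ?case
        proof (cases "y \<in> ball y0 s")
          case False
          then show ?thesis using van by (simp add: dv)
        next
          case True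
          then have fy: "y \<in> face_nbhd a b" using s by blast
          then have ty: "y \<in> tetra" using face_nbhd_tetra interior_subset by blast
          have "lam a y \<noteq> lam b y"
          proof
            assume e: "lam a y = lam b y"
            obtain k where k: "y \<in> open_wedge k" using elim by blast
            have "k = a \<or> k = b"
            proof (rule ccontr)
              assume "\<not> (k = a \<or> k = b)"
              then have "lam a y < lam k y" "lam k y < lam a y" using fy k by (auto simp: face_nbhd_def open_wedge_def)
              then show False by simp
            qed
            then show False using k e ab by (auto simp: open_wedge_def)
          qed
          then consider "lam a y < lam b y" | "lam b y < lam a y" by linarith
          then show ?thesis
          proof cases
            case 1
            then have "y \<in> cell a" using face_nbhd_cell[OF fy] by simp
            then have "u y = p a y" "d y = div_classical (p a) y" using elim by auto
            then show ?thesis unfolding dv diveU using 1 ty A_iff by (simp add: U_def)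
          next
            case 2
            have "y \<in> face_nbhd b a" using fy by (auto simp: face_nbhd_def)
            then have "y \<in> cell b" using face_nbhd_cell[of y b a] 2 by simp
            then have "u y = p b y" "d y = div_classical (p b) y" using elim by auto
            then show ?thesis using 2 A_iff by simp
          qed
        qed
      qed
      have "(\<integral>y. indicator A y * div_classical (\<lambda>y. \<phi> y *\<^sub>R U y) y \<partial>lebesgue) = (\<integral>y. indicator tetra y * ?f y \<partial>lebesgue)"
        by (rule integral_cong_AE[OF m borel_measurable_AE[OF m ae] ae])
      also have "\<dots> = (LINT y|lebesgue_on tetra. ?f y)" by (simp add: integral_restrict_space)
      also have "\<dots> = 0" by (rule weak_div_difference[OF p u d phi'])
      finally show "(\<integral>y. indicator {y. 0 < N \<bullet> (y - y0)} y * div_classical (\<lambda>y. \<phi> y *\<^sub>R U y) y \<partial>lebesgue) = 0"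
        by (simp add: A_def)
    qed
  qed
  have "(\<Sum>j\<in>UNIV. N $ j * U y $ j) = 0"
  proof (rule vanish_on_plane[OF _ _ y ab])
    show "polyn (nat r) (\<lambda>y. \<Sum>j\<in>UNIV. N $ j * U y $ j)" by (intro polyn_sum polyn_cmult pU)
    show "y \<in> face_nbhd a b \<Longrightarrow> lam a y = lam b y \<Longrightarrow> (\<Sum>j\<in>UNIV. N $ j * U y $ j) = 0" for y
      using at_face[of y] by (simp add: inner_vec_def)
  qed
  then have "N \<bullet> U y = 0" by (simp add: inner_vec_def)
  then have "M \<bullet> U y = 0" using M0 by (simp add: N_def)
  then show ?thesis by (simp add: M_def U_def inner_diff_left)
qed simp

subsection \<open>Continuity and conformity\<close>

lemma interior_cell: "z - (1/6) *\<^sub>R v k \<in> interior (cell k)"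
proof -
  let ?c = "z + (- 1/6) *\<^sub>R v k"
  have "open (open_wedge k \<inter> {y. 0 < lam k y})" by (intro open_Int open_open_wedge open_Collect_less continuous_intros)
  moreover have "open_wedge k \<inter> {y. 0 < lam k y} \<subseteq> cell k"
  proof
    fix y assume y: "y \<in> open_wedge k \<inter> {y. 0 < lam k y}"
    then have "y \<in> wedge k" using open_wedge_wedge by blast
    moreover have "0 \<le> lam j y" for j
    proof -
      have "lam k y \<le> lam j y" using calculation by (simp add: wedge_def)
      then show ?thesis using y by auto
    qed
    ultimately show "y \<in> cell k" by (simp add: cell_def tetra_def)
  qed
  moreover have "?c \<in> open_wedge k \<inter> {y. 0 < lam k y}"
    unfolding open_wedge_def Int_iff mem_Collect_eq lam_vertex by simp
  ultimately have "?c \<in> interior (cell k)" by (meson interior_maximal subset_eq)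
  then show ?thesis by simp
qed

lemma cell_closure: "cell k \<subseteq> closure (interior (cell k))"
proof -
  have "convex (cell k)" unfolding cell_def by (intro convex_Int convex_tetra convex_wedge)
  moreover have "interior (cell k) \<noteq> {}" using interior_cell by blast
  ultimately show ?thesis using convex_closure_interior closure_subset by metis
qed

lemma rep_unique:
  fixes p q :: "4 \<Rightarrow> real^3 \<Rightarrow> real"
  assumes p: "\<And>k. polyn m (p k)" "rep p u" and q: "\<And>k. polyn m' (q k)" "rep q u"
  shows "p k y = q k y"
proof -
  have "(\<lambda>y. p k y - q k y) y = 0"
  proof (rule polyn_eq_0_open[where S="interior (cell k)"])
    show "polyn (max m m') (\<lambda>y. p k y - q k y)"
      using polyn_mono[OF p(1)] polyn_mono[OF q(1)] by (intro polyn_diff) auto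
    show "interior (cell k) \<noteq> {}" using interior_cell by blast
    fix y assume y: "y \<in> interior (cell k)"
    have "p k y = q k y"
    proof (rule open_AE_eq[OF open_interior _ _ _ y])
      show "AE y in lebesgue. y \<in> interior (cell k) \<longrightarrow> p k y = q k y"
        using p(2)[unfolded rep_iff_AE] q(2)[unfolded rep_iff_AE]
        by eventually_elim (metis interior_subset subsetD)
    qed (auto intro: polyn_continuous_on p q)
    then show "p k y - q k y = 0" by simp
  qed simp
  then show ?thesis by simp
qed

text \<open>A continuous representative agrees with \<open>p k\<close> almost everywhere, hence everywhere, in the interior
  of the cell, hence on the cell. On a common face this forces equality.\<close>
lemma C0_conforming:
  assumes p: "\<And>k. polyn m (p k)" and u: "rep p u" and c: "u \<in> C0 tetra"
  shows "conforming p"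
proof -
  obtain g where g: "continuous_on tetra g" "ae_eq tetra u g" using c by (auto simp: C0_def)
  have g': "AE y in lebesgue. y \<in> tetra \<longrightarrow> u y = g y" using g(2) by (simp add: ae_eq_iff)
  have gp: "g y = p k y" if y: "y \<in> cell k" for k y
  proof -
    have sub: "interior (cell k) \<subseteq> tetra" using interior_subset by (auto simp: cell_def)
    have cl: "closure (interior (cell k)) \<subseteq> tetra" by (rule closure_minimal[OF sub closed_tetra])
    have eq: "g y = p k y" if "y \<in> interior (cell k)" for y
    proof (rule open_AE_eq[OF open_interior _ _ _ that])
      show "continuous_on (interior (cell k)) g" by (rule continuous_on_subset[OF g(1) sub])
      show "continuous_on (interior (cell k)) (p k)" by (rule polyn_continuous_on[OF p])
      show "AE y in lebesgue. y \<in> interior (cell k) \<longrightarrow> g y = p k y"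
        using g' u[unfolded rep_iff_AE]
      proof eventually_elim
        case (elim y)
        show ?case
        proof
          assume "y \<in> interior (cell k)"
          then have "y \<in> cell k" "y \<in> tetra" using interior_subset sub by blast+
          then show "g y = p k y" using elim by metis
        qed
      qed
    qed
    have "(\<lambda>y. g y - p k y) y = 0"
    proof (rule continuous_constant_on_closure[where S="interior (cell k)"])
      show "continuous_on (closure (interior (cell k))) (\<lambda>y. g y - p k y)"
        by (intro continuous_on_diff continuous_on_subset[OF g(1) cl] polyn_continuous_on[OF p])
    qed (use eq cell_closure y in auto)
    then show ?thesis by simp
  qed
  show ?thesis unfolding conforming_def
  proof (intro allI impI)
    fix a b y assume y: "lam a y = lam b y"
    show "p a y = p b y"
    proof (cases "a = b")
      case ab: False
      have "(\<lambda>y. p a y - p b y) y = 0"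
      proof (rule vanish_on_plane[OF _ _ y ab])
        show "polyn m (\<lambda>y. p a y - p b y)" by (intro polyn_diff p)
        fix y assume f: "y \<in> face_nbhd a b" and e: "lam a y = lam b y"
        have "y \<in> face_nbhd b a" using f by (auto simp: face_nbhd_def)
        then have "y \<in> cell a" "y \<in> cell b" using face_nbhd_cell f e by auto
        then show "p a y - p b y = 0" using gp by (metis diff_self)
      qed
      then show ?thesis by simp
    qed simp
  qed
qed

lemma conforming_C0:
  fixes p :: "4 \<Rightarrow> real^3 \<Rightarrow> real"
  assumes p: "\<And>k. continuous_on UNIV (p k)" "conforming p" and u: "rep p u"
  shows "u \<in> C0 tetra"
proof -
  have "continuous_on tetra (glue p)" using glue_continuous[OF p(2,1)] continuous_on_subset by blast
  moreover have "ae_eq tetra u (glue p)"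
    using rep_AE_eq[OF u rep_glue[OF p(2)]] by (simp add: ae_eq_iff)
  ultimately show ?thesis by (auto simp: C0_def)
qed

end

section \<open>The spaces in terms of polynomials on the cells\<close>

text \<open>Needed to insert the gradient of a test function into the definition of the weak curl.\<close>
lemma test_partial: "\<phi> \<in> test_functions S \<Longrightarrow> partial k \<phi> \<in> test_functions S"
proof -
  assume phi: "\<phi> \<in> test_functions S"
  let ?K = "closure {y. \<phi> y \<noteq> 0}"
  have "partial k \<phi> y = 0" if "y \<in> - ?K" for y
    unfolding partial_eq_dderiv
    by (rule dderiv_eq_0_open[OF _ that]) (use closure_subset[of "{y. \<phi> y \<noteq> 0}"] in auto)
  then have "{y. partial k \<phi> y \<noteq> 0} \<subseteq> ?K" by blast
  then have sub: "closure {y. partial k \<phi> y \<noteq> 0} \<subseteq> ?K" by (rule closure_minimal) simp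
  moreover have "compact ?K" using phi by (simp add: test_functions_def)
  ultimately have "compact (closure {y. partial k \<phi> y \<noteq> 0})"
    by (metis closed_closure compact_Int_closed inf.absorb2)
  then show ?thesis using phi sub smooth_partial by (auto simp: test_functions_def)
qed

lemma constant_if_partials_zero:
  assumes "p \<in> polys r" "\<And>j y. partial j p y = 0"
  shows "p y = p w"
proof -
  have "(p has_derivative (\<lambda>h. 0)) (at y)" for y
  proof -
    have d: "p differentiable (at y)" by (rule polys_differentiable[OF assms(1)])
    have "dderiv h p y = 0" for h
      using dderiv_dir_axis[OF d, of h] assms(2) by (simp add: partial_eq_dderiv)
    then show ?thesis using dderiv_works[OF d] by simp
  qed
  then have "\<exists>c. \<forall>y\<in>UNIV. p y = c" by (intro has_derivative_zero_constant) auto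
  then show ?thesis by auto
qed

lemma mi_deriv_0: "mi_deriv 0 f = f"
  by (simp add: mi_deriv_def)

lemma mi_deriv_axis: "mi_deriv (axis k 1) f = partial k f"
  using exhaust_3[of k] by (auto simp: mi_deriv_def axis_def)

lemma mi_order_le_1: "mi_order \<alpha> \<le> 1 \<longleftrightarrow> \<alpha> = 0 \<or> (\<exists>k. \<alpha> = axis k 1)"
proof
  assume "mi_order \<alpha> \<le> 1"
  then have s: "\<alpha> $ 1 + \<alpha> $ 2 + \<alpha> $ 3 \<le> 1" by (simp add: mi_order_def sum_3)
  show "\<alpha> = 0 \<or> (\<exists>k. \<alpha> = axis k 1)"
  proof (cases "\<alpha> = 0")
    case False
    then obtain k where "\<alpha> $ k \<noteq> 0" by (auto simp: vec_eq_iff)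
    then have "\<alpha> = axis k 1" using s exhaust_3[of k] by (auto simp: vec_eq_iff forall_3 axis_def)
    then show ?thesis by blast
  qed simp
next
  assume "\<alpha> = 0 \<or> (\<exists>k. \<alpha> = axis k 1)"
  then show "mi_order \<alpha> \<le> 1" by (auto simp: mi_order_def axis_def)
qed

text \<open>The fan together with the vertices in their original numbering.\<close>
locale alfeld_tetrahedron = alfeld_fan +
  fixes x :: "nat \<Rightarrow> real^3" and e :: "4 \<Rightarrow> nat"
  assumes e: "bij_betw e UNIV {..3}" and vertex: "\<And>k. x (e k) = z + v k" and center: "barycenter x = z"
begin

lemma e_range: "{..3} = range e"
  using e by (auto simp: bij_betw_def)

lemma all_index: "(\<forall>i\<le>3. P i) \<longleftrightarrow> (\<forall>k. P (e k))"
  using e_range by (metis atMost_iff rangeE rangeI)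

lemma e_inj: "e j = e k \<longleftrightarrow> j = k"
  using e by (auto simp: bij_betw_def inj_eq)

definition cell_vertices :: "4 \<Rightarrow> (real^3) set" where
  "cell_vertices k = sub_verts x (e k) ` {..3}"

lemma sub_verts_e: "sub_verts x (e k) (e j) = (if j = k then z else z + v j)"
  by (simp add: sub_verts_def e_inj center vertex)

lemma cell_vertices_eq: "cell_vertices k = insert z {z + v j | j. j \<noteq> k}"
  unfolding cell_vertices_def e_range image_image by (auto simp: sub_verts_e)

lemma lam_z_v: "lam j (z + v k) = (if j = k then 1 else 0)"
  using lam_vertex[of j 1 k] by simp

text \<open>Together with \<open>sum_lam\<close> this says that \<open>lam\<close> are the barycentric coordinates of \<open>y\<close>.\<close>
lemma lam_v_expand: "(\<Sum>j\<in>UNIV. lam j y *\<^sub>R v j) = y - z"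
proof -
  have "(\<Sum>j\<in>UNIV. lam j y *\<^sub>R v j) = (1/4) *\<^sub>R (\<Sum>j\<in>UNIV. v j) + (\<Sum>j\<in>UNIV. (n j \<bullet> (y - z)) *\<^sub>R v j)"
    by (simp add: lam_def scaleR_left_distrib sum.distrib scaleR_sum_right)
  then show ?thesis by (simp only: expand sum_v) simp
qed

lemma tet_eq: "tet x = tetra"
proof
  have "x ` {..3} \<subseteq> tetra" unfolding e_range image_image by (auto simp: vertex tetra_def lam_z_v)
  then show "tet x \<subseteq> tetra" unfolding tet_def by (intro hull_minimal convex_tetra)
  show "tetra \<subseteq> tet x"
  proof
    fix y assume y: "y \<in> tetra"
    have "(\<Sum>k\<in>UNIV. lam k y *\<^sub>R x (e k)) \<in> tet x"
    proof (rule convex_sum)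
      show "convex (tet x)" by (simp add: tet_def)
      show "x (e k) \<in> tet x" for k
        unfolding tet_def using e_range by (intro hull_inc) auto
    qed (use y sum_lam in \<open>auto simp: tetra_def\<close>)
    moreover have "(\<Sum>k\<in>UNIV. lam k y *\<^sub>R x (e k)) = (\<Sum>k\<in>UNIV. lam k y) *\<^sub>R z + (\<Sum>k\<in>UNIV. lam k y *\<^sub>R v k)"
      by (simp add: vertex scaleR_right_distrib sum.distrib scaleR_sum_left)
    ultimately show "y \<in> tet x" by (simp add: sum_lam lam_v_expand)
  qed
qed

lemma cell_eq: "tet (sub_verts x (e k)) = cell k"
proof
  have "cell_vertices k \<subseteq> cell k"
    by (auto simp: cell_vertices_eq cell_def tetra_def wedge_def lam_z lam_z_v)
  moreover have "convex (cell k)" unfolding cell_def by (intro convex_Int convex_tetra convex_wedge)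
  ultimately show "tet (sub_verts x (e k)) \<subseteq> cell k"
    unfolding tet_def cell_vertices_def by (intro hull_minimal)
  show "cell k \<subseteq> tet (sub_verts x (e k))"
  proof
    fix y assume y: "y \<in> cell k"
    \<comment> \<open>Subtracting \<open>lam k y\<close> from all barycentric coordinates moves the weight \<open>4 * lam k y\<close> to the barycenter.\<close>
    define c where "c = (\<lambda>j. (lam j y - lam k y) + (if j = k then 4 * lam k y else 0))"
    let ?V = "\<lambda>j. sub_verts x (e k) (e j)"
    have c0: "0 \<le> c j" for j using y by (simp add: c_def cell_def tetra_def wedge_def)
    have c1: "sum c UNIV = 1"
      unfolding c_def sum.distrib sum_subtractf by (simp add: sum_lam)
    have "(\<Sum>j\<in>UNIV. c j *\<^sub>R ?V j) \<in> tet (sub_verts x (e k))"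
    proof (rule convex_sum)
      show "convex (tet (sub_verts x (e k)))" by (simp add: tet_def)
      show "?V j \<in> tet (sub_verts x (e k))" for j
        unfolding tet_def using e_range by (intro hull_inc) auto
    qed (use c0 c1 in auto)
    moreover have "(\<Sum>j\<in>UNIV. c j *\<^sub>R ?V j) = y"
    proof -
      have "c j *\<^sub>R ?V j = c j *\<^sub>R z + (lam j y *\<^sub>R v j - lam k y *\<^sub>R v j)" for j
        by (cases "j = k") (simp_all add: sub_verts_e c_def scaleR_right_distrib scaleR_left_diff_distrib)
      then have "(\<Sum>j\<in>UNIV. c j *\<^sub>R ?V j) = (\<Sum>j\<in>UNIV. c j) *\<^sub>R z + ((\<Sum>j\<in>UNIV. lam j y *\<^sub>R v j) - lam k y *\<^sub>R (\<Sum>j\<in>UNIV. v j))"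
        by (simp add: sum.distrib sum_subtractf scaleR_sum_left scaleR_sum_right)
      then show ?thesis by (simp add: c1 lam_v_expand sum_v)
    qed
    ultimately show "y \<in> tet (sub_verts x (e k))" by simp
  qed
qed

lemma pw_polys_iff: "u \<in> pw_polys x r \<longleftrightarrow> (\<exists>p. (\<forall>k. p k \<in> polys r) \<and> rep p u)"
proof -
  have "u \<in> pw_polys x r \<longleftrightarrow> (\<forall>k. \<exists>p. p \<in> polys r \<and> ae_eq (cell k) u p)"
    by (simp add: pw_polys_def all_index cell_eq Bex_def)
  also have "\<dots> \<longleftrightarrow> (\<exists>p. \<forall>k. p k \<in> polys r \<and> ae_eq (cell k) u (p k))" by (rule choice_iff)
  finally show ?thesis by (auto simp: rep_def)
qed

lemma V0_iff: "u \<in> V0 x r \<longleftrightarrow> (\<exists>p. (\<forall>k. p k \<in> polys r) \<and> rep p u)"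
  unfolding V0_def tet_eq using pw_polys_iff rep_L2 polys_continuous by (auto; blast)

lemma C0_iff:
  assumes "\<And>k. p k \<in> polys r" "rep p u"
  shows "u \<in> C0 tetra \<longleftrightarrow> conforming p"
  using C0_conforming[OF polys_polyn[OF assms(1)] assms(2)] conforming_C0[OF polys_continuous[OF assms(1)] _ assms(2)]
  by blast

lemma M0_iff: "u \<in> M0 x r \<longleftrightarrow> (\<exists>p. (\<forall>k. p k \<in> polys r) \<and> conforming p \<and> rep p u)"
proof
  assume "u \<in> M0 x r"
  then obtain p where "\<And>k. p k \<in> polys r" "rep p u" "u \<in> C0 tetra"
    by (auto simp: M0_def tet_eq pw_polys_iff)
  then show "\<exists>p. (\<forall>k. p k \<in> polys r) \<and> conforming p \<and> rep p u" using C0_iff by blast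
next
  assume "\<exists>p. (\<forall>k. p k \<in> polys r) \<and> conforming p \<and> rep p u"
  then obtain p where "\<And>k. p k \<in> polys r" "conforming p" "rep p u" by blast
  then show "u \<in> M0 x r" using C0_iff by (auto simp: M0_def tet_eq pw_polys_iff)
qed

lemma cube_V0_iff: "u \<in> cube (V0 x r) \<longleftrightarrow> (\<exists>p. (\<forall>k. p k \<in> cube (polys r)) \<and> rep p u)"
proof
  assume "u \<in> cube (V0 x r)"
  then have "\<forall>j. \<exists>q. (\<forall>k. q k \<in> polys r) \<and> rep q (\<lambda>y. u y $ j)" by (simp add: cube_def V0_iff)
  from choice[OF this] obtain q where q: "\<And>j k. q j k \<in> polys r" "\<And>j. rep (q j) (\<lambda>y. u y $ j)" by blast
  have "rep (\<lambda>k y. \<chi> j. q j k y) u" unfolding rep_nth_iff[of _ u] vec_lambda_beta using q(2) by blast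
  moreover have "(\<lambda>y. \<chi> j. q j k y) \<in> cube (polys r)" for k using q(1) by (simp add: cube_def)
  ultimately show "\<exists>p. (\<forall>k. p k \<in> cube (polys r)) \<and> rep p u" by (intro exI[of _ "\<lambda>k y. \<chi> j. q j k y"]) simp
next
  assume "\<exists>p. (\<forall>k. p k \<in> cube (polys r)) \<and> rep p u"
  then obtain p where p: "\<And>k. p k \<in> cube (polys r)" "rep p u" by blast
  have "\<exists>q. (\<forall>k. q k \<in> polys r) \<and> rep q (\<lambda>y. u y $ j)" for j
    by (intro exI[of _ "\<lambda>k y. p k y $ j"] conjI allI cube_polysD[OF p(1)] rep_nth[OF p(2)])
  then show "u \<in> cube (V0 x r)" by (simp add: cube_def V0_iff)
qed

lemma conforming_vec:
  fixes p :: "4 \<Rightarrow> real^3 \<Rightarrow> real^3"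
  shows "conforming p \<longleftrightarrow> (\<forall>j. conforming (\<lambda>k y. p k y $ j))"
  unfolding conforming_def vec_eq_iff by blast

lemma cube_C0_iff:
  assumes "\<And>k. p k \<in> cube (polys r)" "rep p u"
  shows "u \<in> cube (C0 tetra) \<longleftrightarrow> conforming p"
  unfolding conforming_vec cube_def using C0_iff[OF cube_polysD[OF assms(1)] rep_nth[OF assms(2)]] by simp

lemma M1_iff: "u \<in> M1 x r \<longleftrightarrow> (\<exists>p. (\<forall>k. p k \<in> cube (polys r)) \<and> conforming p \<and> rep p u)"
proof -
  have "M0 x r = C0 tetra \<inter> V0 x r"
    by (auto simp: M0_iff V0_iff) (use C0_iff in blast)+
  then have "u \<in> M1 x r \<longleftrightarrow> u \<in> cube (C0 tetra) \<and> u \<in> cube (V0 x r)" by (auto simp: M1_def cube_def)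
  then show ?thesis using cube_V0_iff cube_C0_iff by blast
qed

lemma M2_eq: "M2 x r = M1 x r"
  by (simp add: M1_def M2_def)

lemma grad_field:
  assumes "\<And>k. p k \<in> polys r"
  shows "(\<lambda>y. \<chi> j. partial j (p k) y) \<in> cube (polys (r - 1))"
  using polys_partial[OF assms] by (simp add: cube_def)

lemma weak_grad_rep:
  assumes p: "\<And>k. p k \<in> polys r" "conforming p" and u: "rep p u"
  shows "(u, g) \<in> weak_grad tetra \<longleftrightarrow> rep (\<lambda>k y. \<chi> j. partial j (p k) y) g"
  unfolding weak_grad_iff[OF p u] rep_nth_iff vec_lambda_beta ..

lemma exists_rep:
  fixes p :: "4 \<Rightarrow> real^3 \<Rightarrow> real^3"
  shows "\<exists>g. rep p g"
proof
  show "rep p (\<lambda>y. \<chi> j. pw (\<lambda>k y. p k y $ j) y)"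
    unfolding rep_nth_iff[of p] vec_lambda_beta using rep_pw by blast
qed

lemma Md0_iff: "u \<in> Md0 x r \<longleftrightarrow>
  (\<exists>p. (\<forall>k. p k \<in> polys r) \<and> conforming p \<and> rep p u \<and> conforming (\<lambda>k y. \<chi> j. partial j (p k) y))"
proof
  assume "u \<in> Md0 x r"
  then obtain p g where p: "\<And>k. p k \<in> polys r" "conforming p" "rep p u"
    and g: "g \<in> cube (C0 tetra)" "(u, g) \<in> weak_grad tetra"
    by (auto simp: Md0_def M0_iff tet_eq)
  have G: "(\<lambda>y. \<chi> j. partial j (p k) y) \<in> cube (polys (r - 1))" for k by (rule grad_field[OF p(1)])
  have rg: "rep (\<lambda>k y. \<chi> j. partial j (p k) y) g" using g weak_grad_rep[OF p] by blast
  then have "conforming (\<lambda>k y. \<chi> j. partial j (p k) y)"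
    using cube_C0_iff[where p="\<lambda>k y. \<chi> j. partial j (p k) y", OF G rg] g(1) by blast
  then show "\<exists>p. (\<forall>k. p k \<in> polys r) \<and> conforming p \<and> rep p u \<and> conforming (\<lambda>k y. \<chi> j. partial j (p k) y)"
    using p by blast
next
  assume "\<exists>p. (\<forall>k. p k \<in> polys r) \<and> conforming p \<and> rep p u \<and> conforming (\<lambda>k y. \<chi> j. partial j (p k) y)"
  then obtain p where p: "\<And>k. p k \<in> polys r" "conforming p" "rep p u"
    and c: "conforming (\<lambda>k y. \<chi> j. partial j (p k) y)" by blast
  have G: "(\<lambda>y. \<chi> j. partial j (p k) y) \<in> cube (polys (r - 1))" for k by (rule grad_field[OF p(1)])
  obtain g where g: "rep (\<lambda>k y. \<chi> j. partial j (p k) y) g" using exists_rep by blast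
  then have "g \<in> cube (C0 tetra)" using cube_C0_iff[where p="\<lambda>k y. \<chi> j. partial j (p k) y", OF G g] c by blast
  moreover have "(u, g) \<in> weak_grad tetra" using weak_grad_rep[OF p] g by blast
  ultimately show "u \<in> Md0 x r" using p unfolding Md0_def M0_iff tet_eq by blast
qed

lemma Md1_iff: "u \<in> Md1 x r \<longleftrightarrow>
  (\<exists>p. (\<forall>k. p k \<in> cube (polys r)) \<and> conforming p \<and> rep p u \<and> conforming (\<lambda>k. curl_classical (p k)))"
proof
  assume "u \<in> Md1 x r"
  then obtain p g where p: "\<And>k. p k \<in> cube (polys r)" "conforming p" "rep p u"
    and g: "g \<in> cube (C0 tetra)" "(u, g) \<in> weak_curl tetra"
    by (auto simp: Md1_def M1_iff tet_eq)
  have rg: "rep (\<lambda>k. curl_classical (p k)) g" using g weak_curl_iff[OF p] by blast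
  then have "conforming (\<lambda>k. curl_classical (p k))"
    using cube_C0_iff[OF curl_classical_polys[OF p(1)] rg] g(1) by blast
  then show "\<exists>p. (\<forall>k. p k \<in> cube (polys r)) \<and> conforming p \<and> rep p u \<and> conforming (\<lambda>k. curl_classical (p k))"
    using p by blast
next
  assume "\<exists>p. (\<forall>k. p k \<in> cube (polys r)) \<and> conforming p \<and> rep p u \<and> conforming (\<lambda>k. curl_classical (p k))"
  then obtain p where p: "\<And>k. p k \<in> cube (polys r)" "conforming p" "rep p u"
    and c: "conforming (\<lambda>k. curl_classical (p k))" by blast
  obtain g where g: "rep (\<lambda>k. curl_classical (p k)) g" using exists_rep by blast
  then have "g \<in> cube (C0 tetra)" using cube_C0_iff[OF curl_classical_polys[OF p(1)] g] c by blast
  moreover have "(u, g) \<in> weak_curl tetra" using weak_curl_iff[OF p] g by blast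
  ultimately show "u \<in> Md1 x r" using p unfolding Md1_def M1_iff tet_eq by blast
qed

lemma Md2_iff: "u \<in> Md2 x r \<longleftrightarrow>
  (\<exists>p. (\<forall>k. p k \<in> cube (polys r)) \<and> conforming p \<and> rep p u \<and> conforming (\<lambda>k. div_classical (p k)))"
proof
  assume "u \<in> Md2 x r"
  then obtain p g where p: "\<And>k. p k \<in> cube (polys r)" "conforming p" "rep p u"
    and g: "g \<in> C0 tetra" "(u, g) \<in> weak_div tetra"
    by (auto simp: Md2_def M2_eq M1_iff tet_eq)
  have rg: "rep (\<lambda>k. div_classical (p k)) g" using g weak_div_iff[OF p] by blast
  then have "conforming (\<lambda>k. div_classical (p k))"
    using C0_iff[OF div_classical_polys[OF p(1)] rg] g(1) by blast
  then show "\<exists>p. (\<forall>k. p k \<in> cube (polys r)) \<and> conforming p \<and> rep p u \<and> conforming (\<lambda>k. div_classical (p k))"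
    using p by blast
next
  assume "\<exists>p. (\<forall>k. p k \<in> cube (polys r)) \<and> conforming p \<and> rep p u \<and> conforming (\<lambda>k. div_classical (p k))"
  then obtain p where p: "\<And>k. p k \<in> cube (polys r)" "conforming p" "rep p u"
    and c: "conforming (\<lambda>k. div_classical (p k))" by blast
  have g: "rep (\<lambda>k. div_classical (p k)) (pw (\<lambda>k. div_classical (p k)))" by (rule rep_pw)
  then have "pw (\<lambda>k. div_classical (p k)) \<in> C0 tetra" using C0_iff[OF div_classical_polys[OF p(1)] g] c by blast
  moreover have "(u, pw (\<lambda>k. div_classical (p k))) \<in> weak_div tetra" using weak_div_iff[OF p] g by blast
  ultimately show "u \<in> Md2 x r" using p unfolding Md2_def M2_eq M1_iff tet_eq by blast
qed

subsection \<open>Conditions at the vertices\<close>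

text \<open>The vertices shared by two cells are \<open>z\<close> and two vertices of the tetrahedron. Continuity at the
  vertices asks for this relation only, for the functions or for their derivatives.\<close>
definition agree :: "(4 \<Rightarrow> real^3 \<Rightarrow> 'b) \<Rightarrow> bool" where
  "agree q \<longleftrightarrow> (\<forall>k l. \<forall>a \<in> cell_vertices k \<inter> cell_vertices l. q k a = q l a)"

lemma agreeD: "agree q \<Longrightarrow> a \<in> cell_vertices k \<Longrightarrow> a \<in> cell_vertices l \<Longrightarrow> q k a = q l a"
  unfolding agree_def by blast

lemma agree_vec:
  fixes p :: "4 \<Rightarrow> real^3 \<Rightarrow> real^3"
  shows "agree p \<longleftrightarrow> (\<forall>j. agree (\<lambda>k y. p k y $ j))"
  unfolding agree_def vec_eq_iff by blast

lemma lam_at_vertex: "a \<in> cell_vertices k \<Longrightarrow> a \<in> cell_vertices l \<Longrightarrow> lam k a = lam l a"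
proof -
  assume k: "a \<in> cell_vertices k" and l: "a \<in> cell_vertices l"
  show ?thesis
  proof (cases "a = z")
    case False
    obtain i where i: "a = z + v i" "i \<noteq> k" using k False by (auto simp: cell_vertices_eq)
    obtain j where j: "a = z + v j" "j \<noteq> l" using l False by (auto simp: cell_vertices_eq)
    have "i = j" using lam_z_v[of i i] lam_z_v[of i j] i(1) j(1) by (auto split: if_splits)
    then show ?thesis using i j by (simp add: lam_z_v)
  qed (simp add: lam_z)
qed

lemma conforming_agree: "conforming p \<Longrightarrow> agree p"
  unfolding agree_def using lam_at_vertex conformingD by (metis IntE)

lemma fourth_index: "\<exists>d::4. d \<noteq> i \<and> d \<noteq> k \<and> d \<noteq> l"
proof -
  have "card {i, k, l} \<le> 3" by (simp add: card_insert_if)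
  have "{i, k, l} \<noteq> UNIV"
  proof
    assume "{i, k, l} = UNIV"
    then have "card (UNIV :: 4 set) \<le> 3" using \<open>card {i, k, l} \<le> 3\<close> by metis
    then show False by simp
  qed
  then show ?thesis by auto
qed

text \<open>A vertex that two cells share lies on an interior edge of the split, which belongs to three cells.\<close>
lemma third_cell:
  assumes k: "a \<in> cell_vertices k" and l: "a \<in> cell_vertices l"
  shows "\<exists>d. d \<noteq> k \<and> d \<noteq> l \<and> a \<in> cell_vertices d"
proof (cases "a = z")
  case True
  then show ?thesis using fourth_index[of k k l] by (auto simp: cell_vertices_eq)
next
  case False
  obtain i where i: "a = z + v i" "i \<noteq> k" using k False by (auto simp: cell_vertices_eq)
  obtain d where "d \<noteq> i" "d \<noteq> k" "d \<noteq> l" using fourth_index by blast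
  then show ?thesis using i by (auto simp: cell_vertices_eq)
qed

lemma Cj_cells: "u \<in> Cj_at_vertices x m \<longleftrightarrow> (\<exists>q.
    (\<forall>k. q (e k) \<in> (\<Union>s. polys s) \<and> ae_eq (cell k) u (q (e k))) \<and>
    (\<forall>a\<in>alfeld_vertices x. \<forall>\<alpha>. mi_order \<alpha> \<le> m \<longrightarrow>
      (\<forall>k l. a \<in> cell_vertices k \<and> a \<in> cell_vertices l \<longrightarrow> mi_deriv \<alpha> (q (e k)) a = mi_deriv \<alpha> (q (e l)) a)))"
  by (simp only: Cj_at_vertices_def mem_Collect_eq all_index cell_eq cell_vertices_def)

text \<open>The family in the definition of \<open>Cj_at_vertices\<close> is the given one because it is unique.\<close>
lemma Cj_iff:
  assumes p: "\<And>k. p k \<in> polys r" and u: "rep p u"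
  shows "u \<in> Cj_at_vertices x m \<longleftrightarrow> (\<forall>\<alpha>. mi_order \<alpha> \<le> m \<longrightarrow> agree (\<lambda>k. mi_deriv \<alpha> (p k)))"
proof
  assume "u \<in> Cj_at_vertices x m"
  then obtain q where q': "\<forall>k. q (e k) \<in> (\<Union>s. polys s) \<and> ae_eq (cell k) u (q (e k))"
    and Q: "\<forall>a\<in>alfeld_vertices x. \<forall>\<alpha>. mi_order \<alpha> \<le> m \<longrightarrow>
      (\<forall>k l. a \<in> cell_vertices k \<and> a \<in> cell_vertices l \<longrightarrow> mi_deriv \<alpha> (q (e k)) a = mi_deriv \<alpha> (q (e l)) a)"
    unfolding Cj_cells by (elim exE conjE) (rule that)
  have q: "q (e k) \<in> (\<Union>s. polys s)" "ae_eq (cell k) u (q (e k))" for k using q' by blast+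
  have eq: "q (e k) = p k" for k
  proof -
    have "\<forall>k. \<exists>s. q (e k) \<in> polys s" using q(1) by blast
    then obtain s where s: "\<And>k. q (e k) \<in> polys (s k)" by metis
    define M where "M = Max (range s)"
    have "q (e k) \<in> polys M" for k using s[of k] polys_mono[of "s k" M] unfolding M_def by fastforce
    then have "polyn (nat M) (q (e k))" for k by (rule polys_polyn)
    moreover have "rep (\<lambda>k. q (e k)) u" using q(2) by (simp add: rep_def)
    ultimately show ?thesis by (intro ext rep_unique[OF _ _ polys_polyn[OF p] u])
  qed
  have sub: "cell_vertices k \<subseteq> alfeld_vertices x" for k
    unfolding cell_vertices_eq alfeld_vertices_def center e_range image_image by (auto simp: vertex)
  show "\<forall>\<alpha>. mi_order \<alpha> \<le> m \<longrightarrow> agree (\<lambda>k. mi_deriv \<alpha> (p k))"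
    unfolding agree_def using Q[unfolded eq] sub by blast
next
  assume A: "\<forall>\<alpha>. mi_order \<alpha> \<le> m \<longrightarrow> agree (\<lambda>k. mi_deriv \<alpha> (p k))"
  define q where "q = (\<lambda>i. p (inv e i))"
  have qe: "q (e k) = p k" for k using e by (simp add: q_def bij_betw_def inv_f_f)
  have "\<forall>k. q (e k) \<in> (\<Union>s. polys s) \<and> ae_eq (cell k) u (q (e k))"
    unfolding qe using p u by (auto simp: rep_def)
  moreover have "\<forall>a\<in>alfeld_vertices x. \<forall>\<alpha>. mi_order \<alpha> \<le> m \<longrightarrow>
    (\<forall>k l. a \<in> cell_vertices k \<and> a \<in> cell_vertices l \<longrightarrow> mi_deriv \<alpha> (q (e k)) a = mi_deriv \<alpha> (q (e l)) a)"
    unfolding qe using A by (auto simp: agree_def)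
  ultimately show "u \<in> Cj_at_vertices x m"
    unfolding Cj_cells by (intro exI[of _ q] conjI)
qed

lemma C0_vertices_iff:
  assumes "\<And>k. p k \<in> cube (polys r)" "rep p u"
  shows "u \<in> cube (Cj_at_vertices x 0) \<longleftrightarrow> agree p"
proof -
  have "mi_order \<alpha> \<le> 0 \<longleftrightarrow> \<alpha> = 0" for \<alpha> by (auto simp: mi_order_def vec_eq_iff)
  then have "(\<lambda>y. u y $ j) \<in> Cj_at_vertices x 0 \<longleftrightarrow> agree (\<lambda>k y. p k y $ j)" for j
    unfolding Cj_iff[OF cube_polysD[OF assms(1)] rep_nth[OF assms(2)]] by (simp add: mi_deriv_0)
  then show ?thesis unfolding agree_vec cube_def by simp
qed

lemma C1_vertices_iff:
  assumes p: "\<And>k. p k \<in> cube (polys r)" "rep p u"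
  shows "u \<in> cube (Cj_at_vertices x 1) \<longleftrightarrow> agree p \<and> (\<forall>i j. agree (\<lambda>k. partial i (\<lambda>y. p k y $ j)))"
proof -
  have "(\<lambda>y. u y $ j) \<in> Cj_at_vertices x 1 \<longleftrightarrow>
    agree (\<lambda>k y. p k y $ j) \<and> (\<forall>i. agree (\<lambda>k. partial i (\<lambda>y. p k y $ j)))" for j
    unfolding Cj_iff[OF cube_polysD[OF p(1)] rep_nth[OF p(2)]]
  proof (intro iffI conjI allI impI)
    assume A: "\<forall>\<alpha>. mi_order \<alpha> \<le> 1 \<longrightarrow> agree (\<lambda>k. mi_deriv \<alpha> (\<lambda>y. p k y $ j))"
    have "mi_order (0 :: nat^3) \<le> 1" by (simp add: mi_order_def)
    then show "agree (\<lambda>k y. p k y $ j)" using A[rule_format, of 0] unfolding mi_deriv_0 by blast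
    show "agree (\<lambda>k. partial i (\<lambda>y. p k y $ j))" for i
      using A[rule_format, of "axis i 1"] mi_order_le_1 unfolding mi_deriv_axis by blast
  next
    fix \<alpha> assume B: "agree (\<lambda>k y. p k y $ j) \<and> (\<forall>i. agree (\<lambda>k. partial i (\<lambda>y. p k y $ j)))"
      and "mi_order \<alpha> \<le> 1"
    then consider "\<alpha> = 0" | i where "\<alpha> = axis i 1" unfolding mi_order_le_1 by blast
    then show "agree (\<lambda>k. mi_deriv \<alpha> (\<lambda>y. p k y $ j))"
      by cases (use B mi_deriv_0 mi_deriv_axis in \<open>simp_all del: One_nat_def\<close>)
  qed
  then show ?thesis unfolding agree_vec[of p] cube_def by blast
qed

text \<open>The three cells around an interior edge through the vertex are the input of \<open>C1_on_edge\<close>.\<close>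
lemma partials_agree:
  assumes p: "\<And>k. p k \<in> cube (polys r)" "conforming p" and c: "agree (\<lambda>k. curl_classical (p k))"
  shows "agree (\<lambda>k. partial i (\<lambda>y. p k y $ j))"
  unfolding agree_def
proof (intro allI ballI)
  fix k l a assume a: "a \<in> cell_vertices k \<inter> cell_vertices l"
  show "partial i (\<lambda>y. p k y $ j) a = partial i (\<lambda>y. p l y $ j) a"
  proof (cases "k = l")
    case False
    obtain d where d: "d \<noteq> k" "d \<noteq> l" "a \<in> cell_vertices d" using third_cell a by blast
    show ?thesis
    proof (rule C1_on_edge[OF p, of k a l d])
      show "lam k a = lam l a" "lam l a = lam d a"
        using lam_at_vertex[of a k l] lam_at_vertex[of a l d] a d(3) by auto
      show "curl_classical (p k) a = curl_classical (p l) a" "curl_classical (p l) a = curl_classical (p d) a"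
        by (rule agreeD[OF c]; use a d in blast)+
    qed (use False d in auto)
  qed simp
qed

text \<open>For a conforming family, being \<open>C\<^sup>1\<close> at the vertices is a condition on the curl only.\<close>
lemma Mc1_iff: "u \<in> Mc1 x r \<longleftrightarrow>
  (\<exists>p. (\<forall>k. p k \<in> cube (polys r)) \<and> conforming p \<and> rep p u \<and> agree (\<lambda>k. curl_classical (p k)))"
proof
  assume "u \<in> Mc1 x r"
  then obtain p where p: "\<And>k. p k \<in> cube (polys r)" "conforming p" "rep p u" and c: "u \<in> cube (Cj_at_vertices x 1)"
    unfolding Mc1_def Int_iff M1_iff by blast
  have "agree (\<lambda>k. partial i (\<lambda>y. p k y $ j))" for i j using c C1_vertices_iff[OF p(1,3)] by blast
  then have q: "a \<in> cell_vertices k \<inter> cell_vertices l \<Longrightarrow>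
      partial i (\<lambda>y. p k y $ j) a = partial i (\<lambda>y. p l y $ j) a" for i j k l a
    unfolding agree_def by blast
  have "agree (\<lambda>k. curl_classical (p k))"
    unfolding agree_def vec_eq_iff forall_3 curl_classical_nth
    by (intro allI ballI conjI arg_cong2[where f="(-)"] q)
  then show "\<exists>p. (\<forall>k. p k \<in> cube (polys r)) \<and> conforming p \<and> rep p u \<and> agree (\<lambda>k. curl_classical (p k))"
    using p by blast
next
  assume "\<exists>p. (\<forall>k. p k \<in> cube (polys r)) \<and> conforming p \<and> rep p u \<and> agree (\<lambda>k. curl_classical (p k))"
  then obtain p where p: "\<And>k. p k \<in> cube (polys r)" "conforming p" "rep p u" and c: "agree (\<lambda>k. curl_classical (p k))"
    by blast
  then show "u \<in> Mc1 x r"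
    unfolding Mc1_def using C1_vertices_iff[OF p(1,3)] partials_agree[OF p(1,2) c] conforming_agree[OF p(2)] M1_iff
    by blast
qed

lemma Vc2_iff: "u \<in> Vc2 x r \<longleftrightarrow>
  (\<exists>p. (\<forall>k. p k \<in> cube (polys r)) \<and> rep p u \<and> agree p) \<and> u \<in> Domain (weak_div tetra)"
proof -
  have "u \<in> Vc2 x r \<longleftrightarrow> u \<in> cube (V0 x r) \<and> u \<in> cube (Cj_at_vertices x 0) \<and> u \<in> Domain (weak_div tetra)"
    by (auto simp: Vc2_def Vd2_def tet_eq weak_div_def)
  then show ?thesis unfolding cube_V0_iff using C0_vertices_iff by blast
qed

section \<open>Exactness\<close>

text \<open>Introduction forms of the characterizations above. With the fact about \<open>rep\<close> as the last premise,
  the family is found by first-order matching.\<close>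
lemma V0_I: "(\<And>k. p k \<in> polys r) \<Longrightarrow> rep p u \<Longrightarrow> u \<in> V0 x r"
  using V0_iff by blast

lemma M0_I: "(\<And>k. p k \<in> polys r) \<Longrightarrow> conforming p \<Longrightarrow> rep p u \<Longrightarrow> u \<in> M0 x r"
  using M0_iff by blast

lemma M1_I: "(\<And>k. p k \<in> cube (polys r)) \<Longrightarrow> conforming p \<Longrightarrow> rep p u \<Longrightarrow> u \<in> M1 x r"
  using M1_iff by blast

lemma Md0_I: "(\<And>k. p k \<in> polys r) \<Longrightarrow> conforming p \<Longrightarrow>
    conforming (\<lambda>k y. \<chi> j. partial j (p k) y) \<Longrightarrow> rep p u \<Longrightarrow> u \<in> Md0 x r"
  using Md0_iff by blast

lemma Md1_I: "(\<And>k. p k \<in> cube (polys r)) \<Longrightarrow> conforming p \<Longrightarrow>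
    conforming (\<lambda>k. curl_classical (p k)) \<Longrightarrow> rep p u \<Longrightarrow> u \<in> Md1 x r"
  using Md1_iff by blast

lemma Md2_I: "(\<And>k. p k \<in> cube (polys r)) \<Longrightarrow> conforming p \<Longrightarrow>
    conforming (\<lambda>k. div_classical (p k)) \<Longrightarrow> rep p u \<Longrightarrow> u \<in> Md2 x r"
  using Md2_iff by blast

lemma Mc1_I: "(\<And>k. p k \<in> cube (polys r)) \<Longrightarrow> conforming p \<Longrightarrow>
    agree (\<lambda>k. curl_classical (p k)) \<Longrightarrow> rep p u \<Longrightarrow> u \<in> Mc1 x r"
  using Mc1_iff by blast

lemma Vc2_I: "(\<And>k. p k \<in> cube (polys r)) \<Longrightarrow> agree p \<Longrightarrow> (u, d) \<in> weak_div tetra \<Longrightarrow> rep p u \<Longrightarrow> u \<in> Vc2 x r"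
  using Vc2_iff by blast

lemma rep_zeroD:
  assumes "\<And>k. p k \<in> polys r" "rep p (\<lambda>_. 0)"
  shows "p k y = 0"
  by (rule rep_unique[where q="\<lambda>_ _. 0" and m'=0, OF polys_polyn[OF assms(1)] assms(2) polyn.const rep_const])

lemma rep_zero_vecD:
  fixes p :: "4 \<Rightarrow> real^3 \<Rightarrow> real^3"
  assumes "\<And>k. p k \<in> cube (polys r)" "rep p (\<lambda>_. 0)"
  shows "p k y = 0"
proof -
  have "rep (\<lambda>k y. p k y $ j) (\<lambda>_. 0)" for j using rep_nth[OF assms(2), of j] by simp
  then have "p k y $ j = 0" for j by (rule rep_zeroD[OF cube_polysD[OF assms(1)]])
  then show ?thesis by (simp add: vec_eq_iff)
qed

lemma constants_eq: "r \<ge> 0 \<Longrightarrow> constants tetra = op_ker (weak_grad tetra) (Md0 x r)"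
proof (intro set_eqI iffI)
  fix u assume r: "r \<ge> 0" and "u \<in> constants tetra"
  then obtain c where c: "ae_eq tetra u (\<lambda>_. c)" by (auto simp: constants_def)
  define p :: "4 \<Rightarrow> real^3 \<Rightarrow> real" where "p = (\<lambda>_ _. c)"
  have "p k \<in> polys r" for k using r by (simp add: p_def polys_eq polyn.const)
  moreover have "conforming p" by (simp add: p_def conforming_def)
  moreover have "rep p u"
    using rep_cong_AE[of p "\<lambda>_. c" u] c by (auto simp: ae_eq_iff p_def rep_const eq_commute)
  moreover have g: "(\<lambda>k y. \<chi> j. partial j (p k) y) = (\<lambda>k y. 0)"
    by (simp add: p_def fun_eq_iff partial_eq_dderiv vec_eq_iff)
  moreover have "conforming (\<lambda>k y. 0 :: real^3)" by (simp add: conforming_def)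
  ultimately have "u \<in> Md0 x r" "(u, \<lambda>_. 0) \<in> weak_grad tetra"
    unfolding Md0_iff using weak_grad_rep[of p r u] by (metis, simp add: rep_const)
  then show "u \<in> op_ker (weak_grad tetra) (Md0 x r)" by (simp add: op_ker_def)
next
  fix u assume "u \<in> op_ker (weak_grad tetra) (Md0 x r)"
  then have u: "u \<in> Md0 x r" "(u, \<lambda>_. 0) \<in> weak_grad tetra" by (auto simp: op_ker_def)
  then obtain p where p: "\<And>k. p k \<in> polys r" "conforming p" "rep p u" unfolding Md0_iff by blast
  have "rep (\<lambda>k y. \<chi> j. partial j (p k) y) (\<lambda>_. 0)" using u weak_grad_rep[OF p] by blast
  then have "(\<chi> j. partial j (p k) y) = 0" for k y
    by (rule rep_zero_vecD[where p="\<lambda>k y. \<chi> j. partial j (p k) y", rotated]) (rule grad_field[OF p(1)])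
  then have "partial j (p k) y = 0" for j k y by (simp add: vec_eq_iff)
  then have "p k y = p k z" for k y by (rule constant_if_partials_zero[OF p(1)])
  moreover have "p k z = p 1 z" for k by (rule conformingD[OF p(2)]) (simp add: lam_z)
  ultimately have "p = (\<lambda>_ _. p 1 z)" by (metis (no_types) ext)
  then have "rep (\<lambda>_ _. p 1 z) u" using p(3) by metis
  then have "ae_eq tetra u (\<lambda>_. p 1 z)" using rep_AE_eq[OF _ rep_const] by (simp add: ae_eq_iff)
  then show "u \<in> constants tetra" by (auto simp: constants_def)
qed

text \<open>The curl of the gradient vanishes on each cell, so it is continuous everywhere and, by
  \<open>Mc1_iff\<close>, the gradient is \<open>C\<^sup>1\<close> at the vertices.\<close>
lemma grad_image:
  assumes "u \<in> Md0 x r" "(u, g) \<in> weak_grad tetra"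
  shows "g \<in> Md1 x (r - 1)" "g \<in> Mc1 x (r - 1)" "(g, \<lambda>_. 0) \<in> weak_curl tetra"
proof -
  obtain p where p: "\<And>k. p k \<in> polys r" "conforming p" "rep p u"
    and c: "conforming (\<lambda>k y. \<chi> j. partial j (p k) y)" using assms(1) unfolding Md0_iff by blast
  let ?G = "\<lambda>k y. \<chi> j. partial j (p k) y"
  have g: "rep ?G g" using assms(2) weak_grad_rep[OF p] by blast
  have G: "?G k \<in> cube (polys (r - 1))" for k by (rule grad_field[OF p(1)])
  have "curl_classical (?G k) y = 0" for k y by (rule curl_grad[OF p(1)]) simp
  then have curl0: "(\<lambda>k. curl_classical (?G k)) = (\<lambda>k y. 0)" by (intro ext)
  have c0: "conforming (\<lambda>k y. 0 :: real^3)" by (simp add: conforming_def)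
  show "g \<in> Md1 x (r - 1)" by (rule Md1_I[OF G c _ g]) (simp only: curl0 c0)
  show "g \<in> Mc1 x (r - 1)" by (rule Mc1_I[OF G c _ g]) (simp only: curl0 conforming_agree[OF c0])
  show "(g, \<lambda>_. 0) \<in> weak_curl tetra" unfolding weak_curl_iff[OF G c g] curl0 by (rule rep_const)
qed

lemma curl_kernel:
  assumes "g \<in> M1 x (r - 1)" "(g, \<lambda>_. 0) \<in> weak_curl tetra"
  shows "\<exists>u\<in>Md0 x r. (u, g) \<in> weak_grad tetra"
proof -
  obtain p where p: "\<And>k. p k \<in> cube (polys (r - 1))" "conforming p" "rep p g"
    using assms(1) unfolding M1_iff by blast
  have "rep (\<lambda>k. curl_classical (p k)) (\<lambda>_. 0)" using assms(2) weak_curl_iff[OF p] by blast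
  then have "curl_classical (p k) y = 0" for k y by (rule rep_zero_vecD[OF curl_classical_polys[OF p(1)]])
  from grad_potential[OF p(1) this p(2)] obtain ph where ph: "\<And>k. ph k \<in> polys r" "conforming ph"
    "\<And>k j y. partial j (ph k) y = p k y $ j" by auto
  have eq: "(\<lambda>k y. \<chi> j. partial j (ph k) y) = p" by (simp add: ph(3))
  have r: "rep ph (pw ph)" by (rule rep_pw)
  have "pw ph \<in> Md0 x r" by (rule Md0_I[OF ph(1,2) _ r]) (simp only: eq p(2))
  moreover have "(pw ph, g) \<in> weak_grad tetra" unfolding weak_grad_rep[OF ph(1,2) r] eq by (rule p(3))
  ultimately show ?thesis by blast
qed

text \<open>The weak curl has weak divergence zero: test its definition with the gradient of a test function. This
  covers curls that are discontinuous across the faces.\<close>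
lemma curl_image_kernel:
  assumes "(u, g) \<in> weak_curl tetra"
  shows "(g, \<lambda>_. 0) \<in> weak_div tetra"
proof -
  have g: "u \<in> cube (L2 tetra)" "g \<in> cube (L2 tetra)" using assms by (auto simp: weak_curl_def)
  have "(LINT y|lebesgue_on tetra. (\<Sum>k\<in>UNIV. g y $ k * partial k \<phi> y)) = 0"
    if phi: "\<phi> \<in> test_functions tetra" for \<phi>
  proof -
    define \<Phi> :: "real^3 \<Rightarrow> real^3" where "\<Phi> = (\<lambda>y. \<chi> k. partial k \<phi> y)"
    have nth: "(\<lambda>y. \<Phi> y $ k) = partial k \<phi>" for k by (simp add: \<Phi>_def fun_eq_iff)
    have "\<Phi> \<in> cube (test_functions tetra)" using test_partial[OF phi] by (simp add: cube_def nth)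
    then have "(LINT y|lebesgue_on tetra. u y \<bullet> curl_classical \<Phi> y) = (LINT y|lebesgue_on tetra. g y \<bullet> \<Phi> y)"
      using assms by (simp add: weak_curl_def)
    moreover have "curl_classical \<Phi> y = 0" for y
      unfolding vec_eq_iff forall_3 curl_classical_nth nth
      using smooth_partial_commute[of \<phi>] phi by (simp add: test_functions_def)
    ultimately show ?thesis by (simp add: inner_vec_def \<Phi>_def)
  qed
  then show ?thesis using g rep_L2[of "\<lambda>_ _. 0" "\<lambda>_. 0", OF _ rep_const] by (simp add: weak_div_def)
qed

lemma curl_image:
  assumes "u \<in> Md1 x (r - 1)" "(u, g) \<in> weak_curl tetra"
  shows "g \<in> Md2 x (r - 2)" "g \<in> M2 x (r - 2)"
proof -
  obtain p where p: "\<And>k. p k \<in> cube (polys (r - 1))" "conforming p" "rep p u"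
    and c: "conforming (\<lambda>k. curl_classical (p k))" using assms(1) unfolding Md1_iff by blast
  have g: "rep (\<lambda>k. curl_classical (p k)) g" using assms(2) weak_curl_iff[OF p] by blast
  have C: "curl_classical (p k) \<in> cube (polys (r - 2))" for k using curl_classical_polys[OF p(1), of k] by simp
  have "conforming (\<lambda>k. div_classical (curl_classical (p k)))"
    unfolding conforming_def using div_classical_curl[OF p(1)] by simp
  then show "g \<in> Md2 x (r - 2)" by (rule Md2_I[OF C c _ g])
  show "g \<in> M2 x (r - 2)" unfolding M2_eq by (rule M1_I[OF C c g])
qed

lemma curl_image_c:
  assumes "u \<in> Mc1 x (r - 1)" "(u, g) \<in> weak_curl tetra"
  shows "g \<in> Vc2 x (r - 2)"
proof -
  obtain p where p: "\<And>k. p k \<in> cube (polys (r - 1))" "conforming p" "rep p u"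
    and c: "agree (\<lambda>k. curl_classical (p k))" using assms(1) unfolding Mc1_iff by blast
  have g: "rep (\<lambda>k. curl_classical (p k)) g" using assms(2) weak_curl_iff[OF p] by blast
  have C: "curl_classical (p k) \<in> cube (polys (r - 2))" for k using curl_classical_polys[OF p(1), of k] by simp
  show ?thesis by (rule Vc2_I[OF C c curl_image_kernel[OF assms(2)] g])
qed

lemma curl_domain: "M1 x r \<subseteq> Domain (weak_curl tetra)"
proof
  fix u assume "u \<in> M1 x r"
  then obtain p where p: "\<And>k. p k \<in> cube (polys r)" "conforming p" "rep p u" unfolding M1_iff by blast
  obtain g where "rep (\<lambda>k. curl_classical (p k)) g" using exists_rep by blast
  then show "u \<in> Domain (weak_curl tetra)" using weak_curl_iff[OF p] by blast
qed

lemma div_domain: "M2 x r \<subseteq> Domain (weak_div tetra)"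
proof
  fix u assume "u \<in> M2 x r"
  then obtain p where p: "\<And>k. p k \<in> cube (polys r)" "conforming p" "rep p u" unfolding M2_eq M1_iff by blast
  show "u \<in> Domain (weak_div tetra)" using weak_div_iff[OF p] rep_pw by blast
qed

lemma div_kernel:
  assumes "u \<in> M2 x (r - 2)" "(u, \<lambda>_. 0) \<in> weak_div tetra"
  shows "\<exists>w\<in>Md1 x (r - 1). (w, u) \<in> weak_curl tetra"
proof -
  obtain p where p: "\<And>k. p k \<in> cube (polys (r - 2))" "conforming p" "rep p u"
    using assms(1) unfolding M2_eq M1_iff by blast
  have "rep (\<lambda>k. div_classical (p k)) (\<lambda>_. 0)" using assms(2) weak_div_iff[OF p] by blast
  then have d: "div_classical (p k) y = 0" for k y by (rule rep_zeroD[OF div_classical_polys[OF p(1)]])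
  have jump: "(n a - n b) \<bullet> (p a y - p b y) = 0" if "lam a y = lam b y" for a b y
    using conformingD[OF p(2) that] by simp
  obtain om where om: "\<And>k. om k \<in> cube (polys (r - 2 + 1))" "conforming om" "\<And>k y. curl_classical (om k) y = p k y"
    using curl_potential[OF p(1) d jump] p(2) by blast
  have om1: "om k \<in> cube (polys (r - 1))" for k using om(1)[of k] by simp
  have eq: "(\<lambda>k. curl_classical (om k)) = p" by (intro ext om(3))
  obtain w where w: "rep om w" using exists_rep by blast
  have "w \<in> Md1 x (r - 1)" by (rule Md1_I[OF om1 om(2) _ w]) (simp only: eq p(2))
  moreover have "(w, u) \<in> weak_curl tetra" unfolding weak_curl_iff[OF om(1,2) w] eq by (rule p(3))
  ultimately show ?thesis by blast
qed

text \<open>\<open>continuous_curl_potential\<close> gives a continuous potential, and the vertex conditions on its curl \<open>u\<close>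
  make it \<open>C\<^sup>1\<close> at the vertices.\<close>
lemma div_kernel_c:
  assumes "u \<in> Vc2 x (r - 2)" "(u, \<lambda>_. 0) \<in> weak_div tetra"
  shows "\<exists>w\<in>Mc1 x (r - 1). (w, u) \<in> weak_curl tetra"
proof -
  obtain p where p: "\<And>k. p k \<in> cube (polys (r - 2))" "rep p u" "agree p"
    using assms(1) unfolding Vc2_iff by blast
  have "rep (\<lambda>k. div_classical (p k)) (\<lambda>_. 0)" by (rule weak_div_local[OF p(1,2) assms(2)])
  then have d: "div_classical (p k) y = 0" for k y by (rule rep_zeroD[OF div_classical_polys[OF p(1)]])
  obtain om where om: "\<And>k. om k \<in> cube (polys (r - 2 + 1))" "conforming om" "\<And>k y. curl_classical (om k) y = p k y"
    using continuous_curl_potential[OF p(1) d weak_div_jump[OF p(1,2) assms(2)]] by blast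
  have om1: "om k \<in> cube (polys (r - 1))" for k using om(1)[of k] by simp
  have eq: "(\<lambda>k. curl_classical (om k)) = p" by (intro ext om(3))
  obtain w where w: "rep om w" using exists_rep by blast
  have "w \<in> Mc1 x (r - 1)" by (rule Mc1_I[OF om1 om(2) _ w]) (simp only: eq p(3))
  moreover have "(w, u) \<in> weak_curl tetra" unfolding weak_curl_iff[OF om(1,2) w] eq by (rule p(2))
  ultimately show ?thesis by blast
qed

lemma div_image:
  assumes "u \<in> cube (V0 x (r - 2))" "(u, d) \<in> weak_div tetra"
  shows "d \<in> V0 x (r - 3)"
proof -
  obtain p where p: "\<And>k. p k \<in> cube (polys (r - 2))" "rep p u" using assms(1) unfolding cube_V0_iff by blast
  have D: "div_classical (p k) \<in> polys (r - 3)" for k using div_classical_polys[OF p(1), of k] by simp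
  show ?thesis by (rule V0_I[OF D weak_div_local[OF p assms(2)]])
qed

lemma div_image_C0:
  assumes "u \<in> Md2 x (r - 2)" "(u, d) \<in> weak_div tetra"
  shows "d \<in> M0 x (r - 3)"
proof -
  obtain p where p: "\<And>k. p k \<in> cube (polys (r - 2))" "conforming p" "rep p u" and c: "conforming (\<lambda>k. div_classical (p k))"
    using assms(1) unfolding Md2_iff by blast
  have D: "div_classical (p k) \<in> polys (r - 3)" for k using div_classical_polys[OF p(1), of k] by simp
  show ?thesis by (rule M0_I[OF D c iffD1[OF weak_div_iff[OF p] assms(2)]])
qed

lemma div_surjective:
  assumes "d \<in> V0 x (r - 3)"
  shows "\<exists>u\<in>M2 x (r - 2). (u, d) \<in> weak_div tetra \<and> (d \<in> C0 tetra \<longrightarrow> u \<in> Md2 x (r - 2))"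
proof -
  obtain q where q: "\<And>k. q k \<in> polys (r - 3)" "rep q d" using assms unfolding V0_iff by blast
  obtain p where p: "\<And>k. p k \<in> cube (polys (r - 3 + 1))" "conforming p" "\<And>k y. div_classical (p k) y = q k y"
    using div_onto[where q=q, OF q(1)] by blast
  have p1: "p k \<in> cube (polys (r - 2))" for k using p(1)[of k] by simp
  have eq: "(\<lambda>k. div_classical (p k)) = q" by (intro ext p(3))
  obtain u where u: "rep p u" using exists_rep by blast
  have "u \<in> M2 x (r - 2)" unfolding M2_eq by (rule M1_I[OF p1 p(2) u])
  moreover have "(u, d) \<in> weak_div tetra" unfolding weak_div_iff[OF p(1,2) u] eq by (rule q(2))
  moreover have "u \<in> Md2 x (r - 2)" if "d \<in> C0 tetra"
  proof -
    have "conforming q" using C0_iff[OF q] that by blast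
    then show ?thesis by (intro Md2_I[OF p1 p(2) _ u]) (simp only: eq)
  qed
  ultimately show ?thesis by blast
qed

lemma M2_Vc2: "M2 x r \<subseteq> Vc2 x r"
proof
  fix u assume u: "u \<in> M2 x r"
  then obtain p where p: "\<And>k. p k \<in> cube (polys r)" "conforming p" "rep p u" unfolding M2_eq M1_iff by blast
  then show "u \<in> Vc2 x r" unfolding Vc2_iff using conforming_agree[OF p(2)] div_domain u by blast
qed

lemma inclusions: "Md1 x r \<subseteq> M1 x r" "Mc1 x r \<subseteq> M1 x r" "Md2 x r \<subseteq> M2 x r" "M2 x r \<subseteq> cube (V0 x r)"
    "Vc2 x r \<subseteq> cube (V0 x r)" "M0 x r \<subseteq> V0 x r" "M0 x r \<subseteq> C0 tetra"
proof -
  show "Md1 x r \<subseteq> M1 x r" "Mc1 x r \<subseteq> M1 x r" "Md2 x r \<subseteq> M2 x r"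
    by (auto simp: Md1_def Mc1_def Md2_def)
  show "M2 x r \<subseteq> cube (V0 x r)" unfolding M2_eq using M1_iff cube_V0_iff by blast
  show "Vc2 x r \<subseteq> cube (V0 x r)" using Vc2_iff cube_V0_iff by blast
  show "M0 x r \<subseteq> V0 x r" using M0_iff V0_iff by blast
  show "M0 x r \<subseteq> C0 tetra" by (auto simp: M0_def tet_eq)
qed

lemma grad_domain: "Md0 x r \<subseteq> Domain (weak_grad tetra)"
  by (auto simp: Md0_def tet_eq)

lemma alfeld_exactness:
  assumes r: "r \<ge> 1"
  shows "exact_sequence tetra (Md0 x r) (Md1 x (r - 1)) (Md2 x (r - 2)) (Md3 x (r - 3))"
    "exact_sequence tetra (Md0 x r) (Md1 x (r - 1)) (M2 x (r - 2)) (Vd3 x (r - 3))"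
    "exact_sequence tetra (Md0 x r) (Mc1 x (r - 1)) (Vc2 x (r - 2)) (Vd3 x (r - 3))"
proof -
  have c: "constants tetra = op_ker (weak_grad tetra) (Md0 x r)" using r by (intro constants_eq) simp
  then have c': "constants tetra \<subseteq> Md0 x r" by (auto simp: op_ker_def)
  have s3: "Md3 x (r - 3) = M0 x (r - 3)" "Vd3 x (r - 3) = V0 x (r - 3)"
    by (simp_all add: Md3_def M3_def Vd3_def V3_def)
  have g1: "op_maps (weak_grad tetra) (Md0 x r) (Md1 x (r - 1))"
    "op_maps (weak_grad tetra) (Md0 x r) (Mc1 x (r - 1))"
    unfolding op_maps_def using grad_domain grad_image by blast+
  have k1: "weak_grad tetra `` Md0 x r = op_ker (weak_curl tetra) (Md1 x (r - 1))"
    "weak_grad tetra `` Md0 x r = op_ker (weak_curl tetra) (Mc1 x (r - 1))"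
    unfolding op_ker_def using grad_image curl_kernel inclusions(1,2) by blast+
  have g2: "op_maps (weak_curl tetra) (Md1 x (r - 1)) (Md2 x (r - 2))"
    "op_maps (weak_curl tetra) (Md1 x (r - 1)) (M2 x (r - 2))"
    "op_maps (weak_curl tetra) (Mc1 x (r - 1)) (Vc2 x (r - 2))"
    unfolding op_maps_def using curl_domain inclusions(1,2) curl_image curl_image_c by blast+
  have k2: "weak_curl tetra `` Md1 x (r - 1) = op_ker (weak_div tetra) (Md2 x (r - 2))"
    "weak_curl tetra `` Md1 x (r - 1) = op_ker (weak_div tetra) (M2 x (r - 2))"
    "weak_curl tetra `` Mc1 x (r - 1) = op_ker (weak_div tetra) (Vc2 x (r - 2))"
    unfolding op_ker_def
    using curl_image curl_image_c curl_image_kernel div_kernel div_kernel_c inclusions(3) by blast+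
  have dV: "Vc2 x (r - 2) \<subseteq> Domain (weak_div tetra)" using Vc2_iff by blast
  have g3: "op_maps (weak_div tetra) (Md2 x (r - 2)) (M0 x (r - 3))"
    "op_maps (weak_div tetra) (M2 x (r - 2)) (V0 x (r - 3))"
    "op_maps (weak_div tetra) (Vc2 x (r - 2)) (V0 x (r - 3))"
    unfolding op_maps_def using div_domain inclusions(3,4,5) div_image div_image_C0 dV by blast+
  have "d \<in> weak_div tetra `` Md2 x (r - 2)" if "d \<in> M0 x (r - 3)" for d
    using div_surjective[of d r] inclusions(6,7) that by blast
  then have k3a: "weak_div tetra `` Md2 x (r - 2) = M0 x (r - 3)" using div_image_C0 by blast
  have sur: "d \<in> weak_div tetra `` M2 x (r - 2)" if "d \<in> V0 x (r - 3)" for d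
    using div_surjective[OF that] by blast
  then have k3b: "weak_div tetra `` M2 x (r - 2) = V0 x (r - 3)"
    using div_image inclusions(4) by blast
  have k3c: "weak_div tetra `` Vc2 x (r - 2) = V0 x (r - 3)"
    using sur M2_Vc2 div_image inclusions(5) by blast
  show "exact_sequence tetra (Md0 x r) (Md1 x (r - 1)) (Md2 x (r - 2)) (Md3 x (r - 3))"
    "exact_sequence tetra (Md0 x r) (Md1 x (r - 1)) (M2 x (r - 2)) (Vd3 x (r - 3))"
    "exact_sequence tetra (Md0 x r) (Mc1 x (r - 1)) (Vc2 x (r - 2)) (Vd3 x (r - 3))"
    unfolding exact_sequence_def s3 using c c' g1 k1 g2 k2 g3 k3a k3b k3c by blast+
qed

end

section \<open>Barycentric coordinates of a nondegenerate tetrahedron\<close>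

text \<open>The edge vectors from one vertex form a basis of \<open>real^3\<close>. The linear parts of the barycentric
  coordinates are defined by their values on it, and the two remaining identities are linear and are checked
  on this basis.\<close>
lemma alfeld_tetrahedron_exists:
  assumes "nondegenerate x"
  shows "\<exists>v n e. alfeld_tetrahedron (barycenter x) v n x e"
proof -
  have "card (UNIV :: 4 set) = card {..3::nat}" by simp
  then obtain e :: "4 \<Rightarrow> nat" where e: "bij_betw e UNIV {..3}"
    using finite_same_card_bij[of "UNIV :: 4 set" "{..3::nat}"] by auto
  define X where "X = (\<lambda>k. x (e k))"
  define D where "D = (\<lambda>k. X k - X 1)"
  have rX: "range X = x ` {..3}" using e by (auto simp: X_def bij_betw_def image_image[symmetric])
  have injX: "inj X"
  proof (rule injI)
    fix j k assume "X j = X k"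
    then have xe: "x (e j) = x (e k)" by (simp only: X_def)
    have ix: "inj_on x {..3}" using assms by (simp only: nondegenerate_def)
    have "e j = e k" by (rule inj_onD[OF ix xe bij_betw_apply[OF e UNIV_I] bij_betw_apply[OF e UNIV_I]])
    then show "j = k" using inj_onD[OF bij_betw_imp_inj_on[OF e] _ UNIV_I UNIV_I] by blast
  qed
  have D_inj: "D j = D k \<longleftrightarrow> j = k" for j k using injX by (auto simp: D_def inj_eq)
  define B where "B = D ` (UNIV - {1})"
  have "\<not> affine_dependent (range X)" using assms rX by (simp add: nondegenerate_def)
  moreover have "range X = insert (X 1) (X ` (UNIV - {1}))" by auto
  moreover have "X 1 \<notin> X ` (UNIV - {1})" using injX by (auto simp: inj_eq)
  ultimately have "independent ((\<lambda>y. - X 1 + y) ` (X ` (UNIV - {1})))"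
    using affine_dependent_iff_dependent by metis
  moreover have "(\<lambda>y. - X 1 + y) ` (X ` (UNIV - {1})) = B" by (auto simp: B_def D_def image_image)
  ultimately have indB: "independent B" by simp
  have "inj D" by (rule injI) (simp add: D_inj)
  then have cardB: "card B = 3" unfolding B_def by (subst card_image) (auto intro: inj_on_subset)
  have spanB: "span B = UNIV"
    using card_ge_dim_independent[of B UNIV] indB cardB by auto
  \<comment> \<open>The functional with index \<open>i\<close> takes the value 1 on \<open>D i\<close>; for \<open>i = 1\<close>, where \<open>D i = 0\<close>, it is minus the
    sum of the others. The difference \<open>g i w - g i 0\<close> covers both cases.\<close>
  define g where "g = (\<lambda>i w. if w = D i then 1 else (0::real))"
  have "\<exists>L. linear L \<and> (\<forall>w\<in>B. L w = g i w - g i 0)" for i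
    using linear_independent_extend[OF indB, of "\<lambda>w. g i w - g i 0"] by blast
  then obtain L where L: "\<And>i. linear (L i)" "\<And>i w. w \<in> B \<Longrightarrow> L i w = g i w - g i 0" by metis
  have D1: "D 1 = 0" by (simp add: D_def)
  have LD: "L i (D j) = (if i = j then 1 else 0) - (if i = 1 then 1 else 0)" for i j
  proof (cases "j = 1")
    case True
    then show ?thesis using L(1)[of i] D1 by (simp add: linear_0)
  next
    case False
    then have "D j \<in> B" by (simp add: B_def)
    then have "L i (D j) = g i (D j) - g i 0" by (rule L(2))
    moreover have "g i (D j) = (if i = j then 1 else 0)"
      unfolding g_def D_inj by (rule if_cong) auto
    moreover have "g i 0 = (if i = 1 then 1 else 0)"
      unfolding g_def D1[symmetric] D_inj by (rule if_cong) auto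
    ultimately show ?thesis by simp
  qed
  define n :: "4 \<Rightarrow> real^3" where "n = (\<lambda>i. \<chi> k. L i (axis k 1))"
  have n: "n i \<bullet> w = L i w" for i w
  proof -
    have "L i w = L i (\<Sum>k\<in>UNIV. w $ k *\<^sub>R axis k 1)"
      using basis_expansion[of w] by (simp add: scalar_mult_eq_scaleR)
    also have "\<dots> = (\<Sum>k\<in>UNIV. w $ k * L i (axis k 1))" using L(1)[of i] by (simp add: linear_sum linear_cmul)
    finally show ?thesis by (simp add: n_def inner_vec_def mult.commute)
  qed
  define z where "z = barycenter x"
  have z: "z = (1/4) *\<^sub>R (\<Sum>k\<in>UNIV. X k)"
    unfolding z_def barycenter_def X_def using sum.reindex_bij_betw[OF e, of x] by simp
  define v where "v = (\<lambda>k. X k - z)"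
  have vD: "v k = D k - (1/4) *\<^sub>R (\<Sum>j\<in>UNIV. D j)" for k
    by (simp add: v_def z D_def sum_subtractf algebra_simps sum_constant_scaleR del: sum_constant)
  have dual: "n i \<bullet> v j = (if i = j then 1 else 0) - 1/4" for i j
    unfolding vD by (simp add: inner_diff_right inner_sum_right n LD sum_subtractf)
  have sum_v: "(\<Sum>k\<in>UNIV. v k) = 0"
    by (simp add: v_def sum_subtractf z sum_constant_scaleR)
  have lin: "linear (\<lambda>w. (\<Sum>j\<in>UNIV. (n j \<bullet> w) *\<^sub>R v j))"
    by (intro linearI) (simp_all add: inner_add_right scaleR_left_distrib sum.distrib scaleR_sum_right)
  have expand: "(\<Sum>j\<in>UNIV. (n j \<bullet> w) *\<^sub>R v j) = w" for w
  proof (rule linear_eq_on_span[OF lin linear_id[unfolded id_def], of B])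
    show "w \<in> span B" using spanB by simp
    fix b assume "b \<in> B"
    then obtain k where k: "b = D k" by (auto simp: B_def)
    have "(\<Sum>j\<in>UNIV. (n j \<bullet> D k) *\<^sub>R v j) = v k - v 1"
      unfolding n LD by (simp add: scaleR_left_diff_distrib sum_subtractf if_distrib[of "\<lambda>c. c *\<^sub>R _"] cong: if_cong)
    then show "(\<Sum>j\<in>UNIV. (n j \<bullet> b) *\<^sub>R v j) = b" by (simp add: k v_def D_def)
  qed
  have sum_n: "(\<Sum>k\<in>UNIV. n k) = 0"
  proof -
    have lin0: "linear (\<lambda>w. (\<Sum>k\<in>UNIV. n k) \<bullet> w)" "linear (\<lambda>w::real^3. 0::real)"
      by (auto intro!: linearI simp: inner_add_right)
    have "(\<Sum>k\<in>UNIV. n k) \<bullet> w = 0" for w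
    proof (rule linear_eq_on_span[OF lin0, of B])
      show "w \<in> span B" using spanB by simp
      fix b assume "b \<in> B"
      then obtain k where k: "b = D k" by (auto simp: B_def)
      show "(\<Sum>k\<in>UNIV. n k) \<bullet> b = 0"
        unfolding k inner_sum_left n LD by (simp add: sum_subtractf)
    qed
    then show ?thesis by (metis inner_eq_zero_iff)
  qed
  have "alfeld_tetrahedron z v n x e"
  proof
    show "x (e k) = z + v k" for k by (simp add: v_def X_def)
  qed (use sum_v sum_n dual expand e z_def in auto)
  then show ?thesis unfolding z_def by blast
qed

theorem theorem4p7:
  fixes x :: "nat \<Rightarrow> real^3" and r :: int
  assumes "nondegenerate x" and "r \<ge> 1"
  shows "exact_sequence (tet x) (Md0 x r) (Md1 x (r - 1)) (Md2 x (r - 2)) (Md3 x (r - 3)) \<and>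
         exact_sequence (tet x) (Md0 x r) (Md1 x (r - 1)) (M2 x (r - 2)) (Vd3 x (r - 3)) \<and>
         exact_sequence (tet x) (Md0 x r) (Mc1 x (r - 1)) (Vc2 x (r - 2)) (Vd3 x (r - 3))"
proof -
  obtain v n e where "alfeld_tetrahedron (barycenter x) v n x e"
    using alfeld_tetrahedron_exists[OF assms(1)] by blast
  then interpret alfeld_tetrahedron "barycenter x" v n x e .
  show ?thesis unfolding tet_eq using alfeld_exactness[OF assms(2)] by blast
qed

end
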